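(* (a) Let $1\le p\le\infty$. There exists a constant $C=C_p$ such that for every $N\in\mathbb{N}$ $$\|S_Nf\|_{M^p(\mathbb{R})}\le C\|f\|_{M^p(\mathbb{R})},\qquad f\in M^p(\mathbb{R}),$$ if and only if $1<p<\infty$. (b) For $p=1$, there exist constants $c,C>1$ such that, for $N\in\mathbb{N}$, $$\|S_N\|_{M^1(\mathbb{R})\to M^1(\mathbb{R})}\ge C\log(cN).$$ In particular: (1) for every $f\in M^p(\mathbb{R})$, $1<p<\infty$, $\lim_{N\to\infty}S_Nf=f$ in $M^p(\mathbb{R})$; (2) there exists $f\in M^1(\mathbb{R})$ such that $\|S_Nf\|_{M^1(\mathbb{R})}\to\infty$, so that $S_Nf$ does not converge to $f$ in $M^1(\mathbb{R})$.
   Context: $\mathbb{N}=\{1,2,\dots\}$, $\mathbb{N}_0=\mathbb{N}\cup\{0\}$. Hermite functions: for $n\in\mathbb{N}_0$, $h_n(t)=C_n e^{\pi t^2}\frac{d^n}{dt^n}\big(e^{-2\pi t^2}\big)$, $t\in\mathbb{R}$, where the real constant $C_n$ has sign $(-1)^n$ and is chosen so that $\|h_n\|_{L^2(\mathbb{R})}=1$. The family $(h_n)_{n\in\mathbb{N}_0}$ is an orthonormal basis of $L^2(\mathbb{R})$. Time-frequency shifts: for $z=(x,\omega)\in\mathbb{R}^2$, $\pi(z)f(t)=e^{2\pi i\omega t}f(t-x)$. Pairing: $\langle f,g\rangle=\int f\overline{g}$ on $L^2(\mathbb{R})$, extended to $f\in\mathcal{S}'(\mathbb{R})$ (tempered distributions),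 $g\in\mathcal{S}(\mathbb{R})$ (Schwartz functions), linear in $f$ and antilinear in $g$. Modulation spaces: with $\varphi(t)=2^{1/4}e^{-\pi t^2}$ and $1\le p<\infty$, $$M^p(\mathbb{R})=\Big\{f\in\mathcal{S}'(\mathbb{R}):\ \|f\|_{M^p(\mathbb{R})}^p:=\int_{\mathbb{R}^{2}}|\langle f,\pi(z)\varphi\rangle|^p\,dz<\infty\Big\},$$ and $M^\infty(\mathbb{R})$ is defined in the same way with $\|f\|_{M^\infty(\mathbb{R})}:=\sup_{z\in\mathbb{R}^2}|\langle f,\pi(z)\varphi\rangle|$. Partial Hermite expansion operator: $S_Nf:=\sum_{n=0}^N\langle f,h_n\rangle h_n$. $\|S_N\|_{M^1(\mathbb{R})\to M^1(\mathbb{R})}$ denotes its operator norm on $M^1(\mathbb{R})$.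
   Formalization: In (b) the constants are c>1 and C>0, since C>1 is impossible (the norm is at most (4/π²) log N + O(1)); in (2) "‖S_N f‖→∞" is replaced by limsup ‖S_N f‖=∞, since liminf ‖S_N f‖ is finite for every f in M^1. *)

theory Defs
  imports "HOL-Analysis.Analysis"
begin

section \<open>Schwartz functions and tempered distributions\<close>

definition iter_deriv :: "nat \<Rightarrow> (real \<Rightarrow> complex) \<Rightarrow> real \<Rightarrow> complex" where
  "iter_deriv m g = ((\<lambda>u t. vector_derivative u (at t)) ^^ m) g"

definition schwartz :: "(real \<Rightarrow> complex) set" where
  "schwartz = {g. (\<forall>m t. iter_deriv m g differentiable (at t)) \<and>
                  (\<forall>k m. bounded (range (\<lambda>t. t ^ k *\<^sub>R iter_deriv m g t)))}"

definition schwartz_seminorm :: "nat \<Rightarrow> nat \<Rightarrow> (real \<Rightarrow> complex) \<Rightarrow> real" where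
  "schwartz_seminorm k m g = (SUP t. cmod (t ^ k *\<^sub>R iter_deriv m g t))"

type_synonym distr = "(real \<Rightarrow> complex) \<Rightarrow> complex"

text \<open>A tempered distribution is a continuous linear functional on the Schwartz space. Functionals
  are total functions in HOL; requiring the value 0 off the Schwartz space makes the
  representation unique.\<close>

definition tempered :: "distr set" where
  "tempered = {f.
     (\<forall>g. g \<notin> schwartz \<longrightarrow> f g = 0) \<and>
     (\<forall>g\<in>schwartz. \<forall>h\<in>schwartz. f (\<lambda>t. g t + h t) = f g + f h) \<and>
     (\<forall>a. \<forall>g\<in>schwartz. f (\<lambda>t. a * g t) = a * f g) \<and>
     (\<exists>C n. \<forall>g\<in>schwartz. cmod (f g) \<le> C * (\<Sum>k\<le>n. \<Sum>m\<le>n. schwartz_seminorm k m g))}"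

definition distr_of :: "(real \<Rightarrow> complex) \<Rightarrow> distr" where
  "distr_of u = (\<lambda>g. if g \<in> schwartz then (LINT t|lborel. u t * g t) else 0)"

text \<open>The sesquilinear pairing extending \<open>\<langle>u, g\<rangle> = \<integral> u \<cdot> cnj g\<close>.\<close>

definition pairing :: "distr \<Rightarrow> (real \<Rightarrow> complex) \<Rightarrow> complex" where
  "pairing f g = f (\<lambda>t. cnj (g t))"

section \<open>Modulation spaces\<close>

definition tf_shift :: "real \<times> real \<Rightarrow> (real \<Rightarrow> complex) \<Rightarrow> real \<Rightarrow> complex" where
  "tf_shift z g = (\<lambda>t. exp (2 * complex_of_real pi * \<i> * complex_of_real (snd z * t)) * g (t - fst z))"

definition gaussian :: "real \<Rightarrow> complex" where
  "gaussian t = complex_of_real (2 powr (1/4) * exp (- pi * t\<^sup>2))"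

text \<open>The norm takes values in \<open>[0, \<infinity>]\<close>, so that it is meaningful on all tempered distributions.\<close>

definition mod_norm :: "ennreal \<Rightarrow> distr \<Rightarrow> ennreal" where
  "mod_norm p f =
     (if p = \<infinity> then (SUP z. ennreal (cmod (pairing f (tf_shift z gaussian))))
      else let I = (\<integral>\<^sup>+z. ennreal (cmod (pairing f (tf_shift z gaussian)) powr enn2real p) \<partial>lborel)
           in if I = \<infinity> then \<infinity> else ennreal (enn2real I powr (1 / enn2real p)))"

definition mod_space :: "ennreal \<Rightarrow> distr set" where
  "mod_space p = {f \<in> tempered. mod_norm p f < \<infinity>}"

definition mod_opnorm :: "ennreal \<Rightarrow> (distr \<Rightarrow> distr) \<Rightarrow> ennreal" where
  "mod_opnorm p T = (SUP f\<in>{f \<in> mod_space p. mod_norm p f \<le> 1}. mod_norm p (T f))"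

section \<open>Hermite expansions\<close>

definition hermite_raw :: "nat \<Rightarrow> real \<Rightarrow> real" where
  "hermite_raw n t = exp (pi * t\<^sup>2) * (deriv ^^ n) (\<lambda>s. exp (- 2 * pi * s\<^sup>2)) t"

text \<open>The unique real of sign \<open>(-1)^n\<close> that normalises the function above in \<open>L\<^sup>2\<close>.\<close>

definition hermite_const :: "nat \<Rightarrow> real" where
  "hermite_const n = (-1) ^ n / sqrt (LINT t|lborel. (hermite_raw n t)\<^sup>2)"

definition hermite_fun :: "nat \<Rightarrow> real \<Rightarrow> complex" where
  "hermite_fun n t = complex_of_real (hermite_const n * hermite_raw n t)"

definition hermite_partial :: "nat \<Rightarrow> distr \<Rightarrow> distr" where
  "hermite_partial N f = distr_of (\<lambda>t. \<Sum>n\<le>N. pairing f (hermite_fun n) * hermite_fun n t)"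

end

theory Submission
  imports Defs "HOL-Complex_Analysis.Complex_Analysis" "HOL-Probability.Sinc_Integral"
begin

text \<open>
  The Bargmann transform \<open>F \<zeta> = f (coherent \<zeta>)\<close> turns the statement into one about Taylor polynomials of
  entire functions. The coherent states are, up to conjugation and scalar factors, the time-frequency
  shifts of the Gaussian, and their
  expansion in powers of \<open>\<zeta>\<close> has the Hermite functions as coefficients. Therefore \<open>F\<close> is entire, its Taylor
  coefficients are the Hermite coefficients of \<open>f\<close> up to normalisation (\<open>tempered_coherent_sums\<close>), the
  partial Hermite expansion of \<open>f\<close> corresponds to the Taylor polynomial of \<open>F\<close>
  (\<open>hermite_partial_coherent\<close>), and the norm of \<open>M\<^sup>p\<close> is the norm of \<open>F\<close> in \<open>L\<^sup>p\<close> of the plane with a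
  radial Gaussian weight (\<open>pairing_tf_shift\<close>, \<open>mod_norm_fock_int\<close>).

  For \<open>1 < p < \<infinity>\<close> the weight is invariant under rotations, so it suffices to compare \<open>F\<close> with its Taylor
  polynomials on each circle around the origin. There the bound is the theorem of M. Riesz that
  truncation of Fourier series is bounded in \<open>L\<^sup>p\<close> (\<open>riesz_truncation\<close>). For every such \<open>p\<close> there is an
  explicit subharmonic function that compares \<open>|\<zeta>|\<^sup>p\<close> with \<open>|Re \<zeta>|\<^sup>p\<close>, and the mean value inequality for
  it yields the theorem directly, without interpolation or duality. Convergence follows by dominated
  convergence, since Taylor polynomials converge uniformly on each circle
  (\<open>fock_truncation_tendsto\<close>).

  For \<open>p = 1\<close> let \<open>f\<close> be the coherent state at \<open>w = sqrt (N / pi)\<close>. On circles of radius close to \<open>w\<close> its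
  Taylor coefficients form a Poisson distribution of mean about \<open>N\<close>, and truncation at \<open>N\<close> cuts this bell
  in the middle. Hardy's inequality, applied from the leading coefficient downwards, shows that the
  norm of the truncation is at least of order \<open>ln N\<close> (\<open>fock_annulus_lower_bound\<close>). Since the
  coefficients are nonnegative, adding further coherent states does not destroy the bound, and a
  series of coherent states with rapidly growing \<open>N\<close> is a single function with unbounded partial sums
  (\<open>coherent_sequence_lower_bound\<close>). For \<open>p = \<infinity>\<close> the same estimate is used by duality
  (\<open>hermite_partial_lower_bound_infinity\<close>).
\<close>

section \<open>Coherent states and their Hermite expansion\<close>

text \<open>
  Up to a phase and the factor \<open>exp (pi / 2 * (cmod \<zeta>)\<^sup>2)\<close> this is the complex conjugate of a
  time-frequency shift of the Gaussian (\<open>cnj_tf_shift_gaussian\<close>). The factor is chosen such that the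
  dependence on \<open>\<zeta>\<close> is holomorphic.
\<close>

definition coherent :: "complex \<Rightarrow> real \<Rightarrow> complex" where
  "coherent \<zeta> t = of_real (2 powr (1/4)) *
     exp (of_real (- pi * t\<^sup>2) + of_real (2 * pi * t) * \<zeta> - of_real (pi / 2) * \<zeta>\<^sup>2)"

text \<open>
  The derivatives of \<open>exp (- 2 pi s\<^sup>2)\<close>, for real and for complex \<open>s\<close> at once: the Hermite functions
  are defined by real derivatives, whereas Taylor's theorem and Cauchy's estimate need complex ones.
\<close>

fun gauss_der :: "nat \<Rightarrow> 'a::{real_normed_field,banach} \<Rightarrow> 'a" where
  "gauss_der 0 s = exp (- of_real (2 * pi) * s\<^sup>2)"
| "gauss_der (Suc n) s = - of_real (4 * pi) * (s * gauss_der n s + of_nat n * gauss_der (n - 1) s)"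

declare gauss_der.simps [simp del]

lemma DERIV_gauss_der:
  "(gauss_der n has_field_derivative gauss_der (Suc n) s) (at (s::'a::{real_normed_field,banach}))"
proof (induction n arbitrary: s rule: less_induct)
  case (less n)
  show ?case
  proof (cases n)
    case 0
    have "((\<lambda>s::'a. exp (- of_real (2 * pi) * s\<^sup>2)) has_field_derivative
        exp (- of_real (2 * pi) * s\<^sup>2) * (- of_real (2 * pi) * (2 * s))) (at s)"
      by (auto intro!: derivative_eq_intros)
    moreover have "gauss_der 0 = (\<lambda>s::'a. exp (- of_real (2 * pi) * s\<^sup>2))"
      by (auto simp: gauss_der.simps(1))
    ultimately show ?thesis
      using 0 by (simp add: gauss_der.simps(2) algebra_simps)
  next
    case (Suc m)
    have eq: "gauss_der n = (\<lambda>s::'a. - of_real (4 * pi) * (s * gauss_der m s + of_nat m * gauss_der (m - 1) s))"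
      using Suc by (auto simp: gauss_der.simps(2))
    have 1: "(gauss_der m has_field_derivative gauss_der (Suc m) s) (at s)"
      using less Suc by auto
    have 2: "((\<lambda>s. of_nat m * gauss_der (m - 1) s) has_field_derivative of_nat m * gauss_der m s) (at s)"
    proof (cases m)
      case (Suc k)
      have "(gauss_der k has_field_derivative gauss_der (Suc k) s) (at s)"
        using less \<open>n = Suc m\<close> Suc by auto
      then show ?thesis using Suc by (auto intro!: derivative_eq_intros)
    qed auto
    have 3: "gauss_der (Suc n) s = - of_real (4 * pi) * ((gauss_der (Suc m) s * s + gauss_der m s) + of_nat m * gauss_der m s)"
      using Suc by (simp add: gauss_der.simps(2)[of "Suc m"] algebra_simps)
    show ?thesis
      unfolding eq 3 by (rule derivative_eq_intros 1 2 refl | simp)+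
  qed
qed

lemma of_real_gauss_der: "complex_of_real (gauss_der n t) = gauss_der n (of_real t)"
  by (induction n arbitrary: t rule: less_induct)
     (case_tac x; simp add: gauss_der.simps flip: exp_of_real)

lemma higher_deriv_gauss_der:
  "(deriv ^^ n) (\<lambda>s::'a::{real_normed_field,banach}. exp (- of_real (2 * pi) * s\<^sup>2)) = gauss_der n"
proof (induction n)
  case 0 show ?case by (auto simp: gauss_der.simps(1))
next
  case (Suc n)
  then show ?case using DERIV_gauss_der[THEN DERIV_imp_deriv, of n] by auto
qed

lemma hermite_raw_eq: "hermite_raw n t = exp (pi * t\<^sup>2) * gauss_der n t"
  unfolding hermite_raw_def using higher_deriv_gauss_der[where 'a=real, of n] by (simp add: algebra_simps)

text \<open>
  The coefficient of \<open>\<zeta> ^ n\<close> in the expansion of \<open>coherent \<zeta> t\<close>. It is the Hermite function \<open>h\<^sub>n\<close> times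
  \<open>sqrt (pi ^ n / n!)\<close>, see \<open>hermite_fun_eq\<close>.
\<close>

definition hermite_coeff :: "nat \<Rightarrow> real \<Rightarrow> real" where
  "hermite_coeff n t = 2 powr (1/4) * exp (pi * t\<^sup>2) * (-1/2) ^ n / fact n * gauss_der n t"

lemma hermite_coeff_0: "hermite_coeff 0 t = 2 powr (1/4) * exp (- pi * t\<^sup>2)"
  by (simp add: hermite_coeff_def gauss_der.simps(1) mult_exp_exp)

lemma hermite_coeff_Suc:
  "(real n + 1) * hermite_coeff (Suc n) t =
     2 * pi * t * hermite_coeff n t - (if n = 0 then 0 else pi * hermite_coeff (n - 1) t)"
proof (cases n)
  case 0 then show ?thesis by (simp add: hermite_coeff_def gauss_der.simps(2))
next
  case (Suc k)
  have *: "(x + 2) * (E * (P / 4) / ((x + 2) * ((x + 1) * F)) * (- (4 * pi) * (t * D + (x + 1) * D')))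
      = 2 * pi * t * (E * (- P / 2) / ((x + 1) * F) * D) - pi * (E * P / F * D')"
    if "x \<ge> 0" "F > 0" for x E P F D D' :: real
  proof -
    have "u * (E * (P / 4) / (u * (v * F)) * (- (4 * pi) * (t * D + v * D')))
      = 2 * pi * t * (E * (- P / 2) / (v * F) * D) - pi * (E * P / F * D')" if "v > 0" "u > 0" for u v
      using \<open>F > 0\<close> that by (simp add: field_simps)
    from this[of "x + 1" "x + 2"] \<open>x \<ge> 0\<close> show ?thesis by simp
  qed
  have f: "fact (Suc (Suc k)) = (real k + 2) * ((real k + 1) * fact k)" "fact (Suc k) = (real k + 1) * fact k"
    by (simp_all add: algebra_simps)
  show ?thesis
    using *[of "real k" "fact k" "2 powr (1/4) * exp (pi * t\<^sup>2)" "(-1/2) ^ k" "gauss_der (Suc k) t" "gauss_der k t"]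
    unfolding hermite_coeff_def gauss_der.simps(2)[of "Suc k"] Suc f
    by (simp add: add_ac)
qed

lemma DERIV_hermite_coeff':
  "(hermite_coeff n has_real_derivative
      2 * pi * t * hermite_coeff n t - 2 * (real n + 1) * hermite_coeff (Suc n) t) (at t)"
proof -
  have e: "((\<lambda>t. exp (pi * t\<^sup>2)) has_real_derivative exp (pi * t\<^sup>2) * (pi * (2 * t))) (at t)"
    by (auto intro!: derivative_eq_intros)
  have eq: "hermite_coeff n = (\<lambda>t. (2 powr (1/4) * (-1/2) ^ n / fact n) * (exp (pi * t\<^sup>2) * gauss_der n t))"
    by (auto simp: hermite_coeff_def)
  have "2 * (real n + 1) * hermite_coeff (Suc n) t = - (2 powr (1/4) * (-1/2) ^ n / fact n * (exp (pi * t\<^sup>2) * gauss_der (Suc n) t))"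
    by (simp add: hermite_coeff_def divide_simps)
  then have "2 * pi * t * hermite_coeff n t - 2 * (real n + 1) * hermite_coeff (Suc n) t =
      (2 powr (1/4) * (-1/2) ^ n / fact n) * (exp (pi * t\<^sup>2) * (pi * (2 * t)) * gauss_der n t + gauss_der (Suc n) t * exp (pi * t\<^sup>2))"
    by (simp add: eq ring_distribs mult_ac)
  then show ?thesis
    using DERIV_cmult[OF DERIV_mult[OF e DERIV_gauss_der[of n t]], of "2 powr (1/4) * (-1/2) ^ n / fact n"]
    unfolding eq[symmetric] by metis
qed

text \<open>
  Differentiation, and multiplication by \<open>t\<close> according to \<open>hermite_coeff_Suc\<close>, turn these functions into
  combinations of their two neighbours, with factors of linear growth in \<open>n\<close>.
\<close>

lemma DERIV_hermite_coeff:
  "(hermite_coeff n has_real_derivative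
      (if n = 0 then 0 else pi * hermite_coeff (n - 1) t) - (real n + 1) * hermite_coeff (Suc n) t) (at t)"
  by (rule DERIV_cong[OF DERIV_hermite_coeff'[of n t]]) (use hermite_coeff_Suc[of n t] in \<open>auto simp: algebra_simps\<close>)

text \<open>
  Completing the square gives \<open>coherent \<zeta> t = 2 powr (1/4) * exp (pi t\<^sup>2) * exp (- 2 pi (t - \<zeta> / 2)\<^sup>2)\<close>.
  The series is the Taylor expansion of \<open>exp (- 2 pi s\<^sup>2)\<close> around \<open>t\<close>, taken at \<open>t - \<zeta> / 2\<close>.
\<close>

lemma coherent_sums: "(\<lambda>n. of_real (hermite_coeff n t) * \<zeta> ^ n) sums coherent \<zeta> t"
proof -
  define E where "E = (\<lambda>s::complex. exp (- of_real (2 * pi) * s\<^sup>2))"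
  have hol: "E holomorphic_on ball (of_real t) (norm \<zeta> + 1)"
    unfolding E_def by (intro holomorphic_intros)
  have "(\<lambda>n. (deriv ^^ n) E (of_real t) / fact n * ((of_real t - \<zeta>/2) - of_real t) ^ n) sums E (of_real t - \<zeta>/2)"
    by (rule holomorphic_power_series[OF hol]) (simp add: dist_norm norm_divide, smt (verit) norm_ge_zero)
  from sums_mult[OF this, of "of_real (2 powr (1/4) * exp (pi * t\<^sup>2))"]
  have "(\<lambda>n. of_real (2 powr (1/4) * exp (pi * t\<^sup>2)) * ((deriv ^^ n) E (of_real t) / fact n * (- \<zeta>/2) ^ n))
     sums (of_real (2 powr (1/4) * exp (pi * t\<^sup>2)) * E (of_real t - \<zeta>/2))" by simp
  moreover have "of_real (2 powr (1/4) * exp (pi * t\<^sup>2)) * E (of_real t - \<zeta>/2) = coherent \<zeta> t"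
    unfolding E_def coherent_def of_real_mult mult.assoc exp_of_real[symmetric] mult_exp_exp
    by (intro arg_cong2[where f="(*)"] arg_cong[where f=exp] refl)
       (simp add: power2_eq_square diff_divide_distrib add_divide_distrib algebra_simps)
  moreover have "of_real (2 powr (1/4) * exp (pi * t\<^sup>2)) * ((deriv ^^ n) E (of_real t) / fact n * (- \<zeta>/2) ^ n)
      = of_real (hermite_coeff n t) * \<zeta> ^ n" for n
  proof -
    have "(- \<zeta>/2) ^ n = (-1/2) ^ n * \<zeta> ^ n"
      by (simp flip: power_mult_distrib)
    then show ?thesis
      unfolding E_def higher_deriv_gauss_der hermite_coeff_def
      by (simp add: of_real_gauss_der mult_ac)
  qed
  ultimately show ?thesis by simp
qed

text \<open>
  Cauchy's estimate on the circle of radius \<open>\<rho> / 2\<close> around \<open>t\<close>. As \<open>\<rho>\<close> is arbitrary, the functions decay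
  faster than geometrically in \<open>n\<close>, uniformly in \<open>t\<close>.
\<close>

lemma abs_hermite_coeff_le:
  assumes "\<rho> > 0"
  shows "\<bar>hermite_coeff n t\<bar> \<le> 2 * exp (pi * \<rho>\<^sup>2) / \<rho> ^ n"
proof -
  define E where "E = (\<lambda>s::complex. exp (- of_real (2 * pi) * s\<^sup>2))"
  define r where "r = \<rho> / 2"
  have r: "r > 0" using assms by (simp add: r_def)
  have B: "norm (E s) \<le> exp (- pi * t\<^sup>2 + pi * \<rho>\<^sup>2)" if "norm (of_real t - s) = r" for s
  proof -
    define a b where "a = Re s - t" and "b = Im s"
    have ab: "a\<^sup>2 + b\<^sup>2 = r\<^sup>2"
      using that unfolding a_def b_def cmod_def
      by (metis Im_complex_of_real Re_complex_of_real cmod_def cmod_power2 minus_complex.simps norm_minus_commute diff_zero)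
    have "norm (E s) = exp (- 2 * pi * ((t + a)\<^sup>2 - b\<^sup>2))"
      by (simp add: E_def a_def b_def Re_power2)
    \<comment> \<open>With \<open>a\<^sup>2 + b\<^sup>2 = \<rho>\<^sup>2 / 4\<close> this is a quadratic inequality; the gain of \<open>- pi t\<^sup>2\<close> compensates the
      factor \<open>exp (pi t\<^sup>2)\<close> in \<open>hermite_coeff\<close>.\<close>
    also have "\<dots> \<le> exp (- pi * t\<^sup>2 + pi * \<rho>\<^sup>2)"
    proof -
      have "- t\<^sup>2 + 4 * (a\<^sup>2 + b\<^sup>2) - (- 2 * ((t + a)\<^sup>2 - b\<^sup>2)) = (t + 2 * a)\<^sup>2 + 2 * a\<^sup>2 + 2 * b\<^sup>2"
        by (simp add: power2_eq_square algebra_simps)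
      moreover have "\<dots> \<ge> 0" by simp
      ultimately have "- 2 * ((t + a)\<^sup>2 - b\<^sup>2) \<le> - t\<^sup>2 + 4 * (a\<^sup>2 + b\<^sup>2)" by linarith
      also have "\<dots> = - t\<^sup>2 + \<rho>\<^sup>2" unfolding ab r_def by (simp add: power2_eq_square)
      finally have "pi * (- 2 * ((t + a)\<^sup>2 - b\<^sup>2)) \<le> pi * (- t\<^sup>2 + \<rho>\<^sup>2)"
        by (intro mult_left_mono) auto
      then show ?thesis by (simp add: algebra_simps)
    qed
    finally show ?thesis .
  qed
  have "norm ((deriv ^^ n) E (of_real t)) \<le> fact n * exp (- pi * t\<^sup>2 + pi * \<rho>\<^sup>2) / r ^ n"
    by (rule Cauchy_inequality) (use B r in \<open>auto simp: E_def intro!: holomorphic_intros continuous_intros\<close>)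
  then have D: "\<bar>gauss_der n t\<bar> \<le> fact n * exp (- pi * t\<^sup>2 + pi * \<rho>\<^sup>2) / r ^ n"
    unfolding E_def higher_deriv_gauss_der of_real_gauss_der[symmetric] by simp
  have "\<bar>hermite_coeff n t\<bar> = 2 powr (1/4) * exp (pi * t\<^sup>2) * (1/2) ^ n / fact n * \<bar>gauss_der n t\<bar>"
    by (simp add: hermite_coeff_def abs_mult power_abs)
  also have "\<dots> \<le> 2 powr (1/4) * exp (pi * t\<^sup>2) * (1/2) ^ n / fact n * (fact n * exp (- pi * t\<^sup>2 + pi * \<rho>\<^sup>2) / r ^ n)"
    by (intro mult_left_mono D) auto
  also have "\<dots> = 2 powr (1/4) * (exp (pi * t\<^sup>2) * exp (- pi * t\<^sup>2 + pi * \<rho>\<^sup>2)) / \<rho> ^ n"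
    using assms by (simp add: r_def field_simps power_divide)
  also have "\<dots> = 2 powr (1/4) * exp (pi * \<rho>\<^sup>2) / \<rho> ^ n"
    by (simp add: mult_exp_exp)
  also have "\<dots> \<le> 2 * exp (pi * \<rho>\<^sup>2) / \<rho> ^ n"
  proof -
    have "2 powr (1/4) \<le> (2::real) powr 1" by (intro powr_mono) auto
    then show ?thesis using assms by (intro divide_right_mono mult_right_mono) auto
  qed
  finally show ?thesis .
qed

section \<open>Hermite series in the Schwartz space\<close>

fun hermite_der :: "nat \<Rightarrow> nat \<Rightarrow> real \<Rightarrow> real" where
  "hermite_der 0 n t = hermite_coeff n t"
| "hermite_der (Suc m) n t =
     (if n = 0 then 0 else pi * hermite_der m (n - 1) t) - (real n + 1) * hermite_der m (Suc n) t"

lemma DERIV_hermite_der: "(hermite_der m n has_real_derivative hermite_der (Suc m) n t) (at t)"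
proof (induction m arbitrary: n)
  case 0
  have "hermite_der 0 n = hermite_coeff n" by auto
  then show ?case using DERIV_hermite_coeff[of n t] by (simp only: hermite_der.simps)
next
  case (Suc m)
  have eq: "hermite_der (Suc m) n = (\<lambda>t. (if n = 0 then 0 else pi) * hermite_der m (n - 1) t
      - (real n + 1) * hermite_der m (Suc n) t)"
    by auto
  have "((\<lambda>t. (if n = 0 then 0 else pi) * hermite_der m (n - 1) t - (real n + 1) * hermite_der m (Suc n) t)
     has_real_derivative (if n = 0 then 0 else pi) * hermite_der (Suc m) (n - 1) t
       - (real n + 1) * hermite_der (Suc m) (Suc n) t) (at t)"
    by (intro DERIV_diff DERIV_cmult Suc.IH)
  moreover have "hermite_der (Suc (Suc m)) n t = (if n = 0 then 0 else pi) * hermite_der (Suc m) (n - 1) t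
       - (real n + 1) * hermite_der (Suc m) (Suc n) t"
    by (simp only: hermite_der.simps(2)[of "Suc m"]) (simp del: hermite_der.simps)
  ultimately show ?case unfolding eq by (simp only:)
qed

definition superexp_decay :: "(nat \<Rightarrow> real \<Rightarrow> real) \<Rightarrow> bool" where
  "superexp_decay f \<longleftrightarrow> (\<forall>\<rho>>0. \<exists>C. \<forall>n t. \<bar>f n t\<bar> \<le> C / \<rho> ^ n)"

text \<open>
  A shift of the index and a factor of linear growth are absorbed by passing from \<open>\<rho>\<close> to \<open>2 \<rho>\<close>. With the
  ladder relations this carries the uniform decay over to all Schwartz seminorms.
\<close>

lemma superexp_decay_shift:
  assumes f: "superexp_decay f" and ab: "a \<ge> 0" "b \<ge> 0"
    and g: "\<And>n t. \<bar>g n t\<bar> \<le> (if n = 0 then 0 else a * \<bar>f (n - 1) t\<bar>) + b * ((real n + 1) * \<bar>f (Suc n) t\<bar>)"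
  shows "superexp_decay g"
  unfolding superexp_decay_def
proof (intro allI impI)
  fix \<rho> :: real assume \<rho>: "\<rho> > 0"
  then obtain C where C: "\<And>n t. \<bar>f n t\<bar> \<le> C / (2 * \<rho>) ^ n"
    using f[unfolded superexp_decay_def, rule_format, of "2 * \<rho>"] by auto
  have C0: "C \<ge> 0" using C[of 0 0] by simp
  have "\<bar>g n t\<bar> \<le> (a * (2 * \<rho> * C) + b * (C / \<rho>)) / \<rho> ^ n" for n t
  proof -
    have 1: "(if n = 0 then 0 else a * \<bar>f (n - 1) t\<bar>) \<le> a * (2 * \<rho> * C) / \<rho> ^ n"
    proof (cases n)
      case (Suc k)
      have "\<bar>f k t\<bar> \<le> C / (2 * \<rho>) ^ k" by (rule C)
      also have "\<dots> \<le> C / \<rho> ^ k"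
        using \<rho> C0 by (intro divide_left_mono power_mono) auto
      also have "\<dots> \<le> 2 * (C / \<rho> ^ k)" using C0 \<rho> divide_nonneg_pos[of C "\<rho> ^ k"] zero_less_power[OF \<rho>, of k] by linarith
      also have "\<dots> = 2 * \<rho> * C / \<rho> ^ n" using \<rho> Suc by simp
      finally have "a * \<bar>f k t\<bar> \<le> a * (2 * \<rho> * C / \<rho> ^ n)" using ab by (intro mult_left_mono) auto
      then show ?thesis using Suc \<rho> by simp
    qed (use ab \<rho> C0 in auto)
    have "real n + 1 \<le> 2 ^ Suc n"
      by (metis Suc_eq_plus1 less_exp less_imp_le of_nat_le_iff of_nat_numeral of_nat_power of_nat_Suc add.commute)
    then have "(real n + 1) * \<bar>f (Suc n) t\<bar> \<le> 2 ^ Suc n * (C / (2 * \<rho>) ^ Suc n)"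
      by (intro mult_mono C) auto
    also have "\<dots> = C / \<rho> ^ Suc n" by (simp add: power_mult_distrib)
    also have "\<dots> = (C / \<rho>) / \<rho> ^ n" by simp
    finally have "b * ((real n + 1) * \<bar>f (Suc n) t\<bar>) \<le> b * ((C / \<rho>) / \<rho> ^ n)"
      using ab by (intro mult_left_mono) auto
    with 1 g[of n t] show ?thesis by (simp add: add_divide_distrib)
  qed
  then show "\<exists>C. \<forall>n t. \<bar>g n t\<bar> \<le> C / \<rho> ^ n" by blast
qed

lemma superexp_decay_hermite_der: "superexp_decay (\<lambda>n t. t ^ k * hermite_der m n t)"
proof (induction m arbitrary: k)
  case 0
  show ?case
  proof (induction k)
    case 0
    show ?case unfolding superexp_decay_def
      using abs_hermite_coeff_le by (intro allI impI) (auto intro!: exI)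
  next
    case (Suc k)
    show ?case
    proof (rule superexp_decay_shift[OF Suc, of "1/2" "1/(2*pi)"])
      fix n t
      have "t * hermite_coeff n t = (if n = 0 then 0 else hermite_coeff (n - 1) t / 2)
          + (real n + 1) * hermite_coeff (Suc n) t / (2 * pi)"
        using hermite_coeff_Suc[of n t] by (auto simp: field_simps)
      then have "t ^ k * (t * hermite_coeff n t) = t ^ k * ((if n = 0 then 0 else hermite_coeff (n - 1) t / 2)
          + (real n + 1) * hermite_coeff (Suc n) t / (2 * pi))"
        by (simp only:)
      then have eq: "t ^ Suc k * hermite_der 0 n t = (if n = 0 then 0 else (1/2) * (t ^ k * hermite_der 0 (n - 1) t))
          + (1/(2*pi)) * ((real n + 1) * (t ^ k * hermite_der 0 (Suc n) t))"
        by (simp add: ring_distribs add_divide_distrib mult_ac)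
      show "\<bar>t ^ Suc k * hermite_der 0 n t\<bar> \<le> (if n = 0 then 0 else (1/2) * \<bar>t ^ k * hermite_der 0 (n - 1) t\<bar>)
          + (1/(2*pi)) * ((real n + 1) * \<bar>t ^ k * hermite_der 0 (Suc n) t\<bar>)"
        unfolding eq by (rule order.trans[OF abs_triangle_ineq]) (auto simp: abs_mult)
    qed auto
  qed
next
  case (Suc m)
  show ?case
  proof (rule superexp_decay_shift[OF Suc, of "pi" "1"])
    fix n t
    have eq: "t ^ k * hermite_der (Suc m) n t = (if n = 0 then 0 else pi * (t ^ k * hermite_der m (n - 1) t))
        - ((real n + 1) * (t ^ k * hermite_der m (Suc n) t))"
      by (auto simp: algebra_simps)
    show "\<bar>t ^ k * hermite_der (Suc m) n t\<bar> \<le> (if n = 0 then 0 else pi * \<bar>t ^ k * hermite_der m (n - 1) t\<bar>)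
        + 1 * ((real n + 1) * \<bar>t ^ k * hermite_der m (Suc n) t\<bar>)"
      unfolding eq by (rule order.trans[OF abs_triangle_ineq4]) (auto simp: abs_mult)
  qed auto
qed

text \<open>
  The \<open>m\<close>-th derivative of \<open>\<Sum>n. c n * hermite_coeff n t\<close>. Coherent states, their Taylor polynomials and
  remainders, and single Hermite functions are all of this form, with coefficients of at most
  geometric growth.
\<close>

definition hermite_series :: "(nat \<Rightarrow> complex) \<Rightarrow> nat \<Rightarrow> real \<Rightarrow> complex" where
  "hermite_series c m t = (\<Sum>n. c n * of_real (hermite_der m n t))"

lemma hermite_der_bound:
  assumes "r > 0"
  obtains C where "C \<ge> 0" "\<And>(c::nat \<Rightarrow> complex) K n t. norm (c n) \<le> K * r ^ n \<Longrightarrow> 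
     norm (c n * complex_of_real (t ^ k * hermite_der m n t)) \<le> K * C * (1/2) ^ n"
proof -
  obtain C where C: "\<And>n t. \<bar>t ^ k * hermite_der m n t\<bar> \<le> C / (2 * r) ^ n"
    using superexp_decay_hermite_der[of k m, unfolded superexp_decay_def, rule_format, of "2 * r"] assms by auto
  have C0: "C \<ge> 0" using C[of 0 0] by (smt (verit) abs_ge_zero div_by_1 power_0)
  have "norm (c n * complex_of_real (t ^ k * hermite_der m n t)) \<le> K * C * (1/2) ^ n"
    if "norm (c n) \<le> K * r ^ n" for c K n t
  proof -
    have "K * r ^ n \<ge> 0" using that norm_ge_zero order_trans by blast
    then have "norm (c n) * \<bar>t ^ k * hermite_der m n t\<bar> \<le> (K * r ^ n) * (C / (2 * r) ^ n)"
      using that by (intro mult_mono C) auto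
    also have "\<dots> = K * C * (1/2) ^ n" using assms by (simp add: power_mult_distrib power_divide)
    finally show ?thesis by (simp add: norm_mult abs_mult norm_power power_abs)
  qed
  with C0 that show ?thesis by blast
qed

lemma hermite_series_summable:
  fixes c :: "nat \<Rightarrow> complex"
  assumes "r > 0" "\<And>n. norm (c n) \<le> K * r ^ n"
  shows "summable (\<lambda>n. norm (c n * of_real (hermite_der m n t)))"
proof -
  obtain C where C: "C \<ge> 0" "\<And>(c::nat \<Rightarrow> complex) K n t. norm (c n) \<le> K * r ^ n \<Longrightarrow> 
     norm (c n * complex_of_real (t ^ 0 * hermite_der m n t)) \<le> K * C * (1/2) ^ n"
    using hermite_der_bound[OF assms(1)] by metis
  show ?thesis
    by (rule summable_comparison_test'[where g="\<lambda>n. K * C * (1/2) ^ n"])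
       (use C(2)[of c _ K t, OF assms(2)] in \<open>auto intro!: summable_mult summable_geometric\<close>)
qed

lemma has_vector_derivative_hermite_series:
  assumes "r > 0" "\<And>n. norm (c n) \<le> K * r ^ n"
  shows "(hermite_series c m has_vector_derivative hermite_series c (Suc m) t) (at t)"
proof -
  obtain C where C: "C \<ge> 0" "\<And>(c::nat \<Rightarrow> complex) K n t. norm (c n) \<le> K * r ^ n \<Longrightarrow> 
     norm (c n * complex_of_real (t ^ 0 * hermite_der (Suc m) n t)) \<le> K * C * (1/2) ^ n"
    using hermite_der_bound[OF assms(1)] by metis
  have u: "uniform_limit UNIV (\<lambda>n t. \<Sum>i<n. c i * of_real (hermite_der (Suc m) i t)) (hermite_series c (Suc m)) sequentially"
    unfolding hermite_series_def
    by (rule Weierstrass_m_test[where M="\<lambda>n. K * C * (1/2) ^ n"])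
       (use C(2)[of c _ K, OF assms(2)] in \<open>auto intro!: summable_mult summable_geometric\<close>)
  have "\<exists>g. \<forall>x\<in>UNIV. (\<lambda>n. c n * of_real (hermite_der m n x)) sums g x \<and>
      (g has_derivative (\<lambda>h. h *\<^sub>R hermite_series c (Suc m) x)) (at x within UNIV)"
  proof (rule has_derivative_series[where f'="\<lambda>n x h. h *\<^sub>R (c n * of_real (hermite_der (Suc m) n x))"])
    show "((\<lambda>x. c n * of_real (hermite_der m n x)) has_derivative
        (\<lambda>h. h *\<^sub>R (c n * of_real (hermite_der (Suc m) n x)))) (at x within UNIV)" for n x
    proof -
      have "((\<lambda>x. of_real (hermite_der m n x)) has_vector_derivative of_real (hermite_der (Suc m) n x)) (at x)"
        by (rule has_vector_derivative_of_real) (use DERIV_hermite_der has_real_derivative_iff_has_vector_derivative in blast)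
      from has_vector_derivative_mult_right[OF this, of "c n"] show ?thesis
        by (simp add: has_vector_derivative_def)
    qed
    show "\<forall>\<^sub>F n in sequentially. \<forall>x\<in>UNIV. \<forall>h. norm ((\<Sum>i<n. h *\<^sub>R (c i * of_real (hermite_der (Suc m) i x))) -
        h *\<^sub>R hermite_series c (Suc m) x) \<le> e * norm h" if "e > 0" for e
    proof -
      have "\<forall>\<^sub>F n in sequentially. \<forall>x\<in>UNIV. dist (\<Sum>i<n. c i * of_real (hermite_der (Suc m) i x)) (hermite_series c (Suc m) x) < e"
        using uniform_limitD[OF u that] by simp
      then show ?thesis
      proof eventually_elim
        case (elim n)
        show ?case
        proof (intro ballI allI)
          fix x h :: real
          have "norm ((\<Sum>i<n. h *\<^sub>R (c i * of_real (hermite_der (Suc m) i x))) - h *\<^sub>R hermite_series c (Suc m) x)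
             = \<bar>h\<bar> * norm ((\<Sum>i<n. c i * of_real (hermite_der (Suc m) i x)) - hermite_series c (Suc m) x)"
            by (simp flip: scaleR_sum_right scaleR_diff_right del: of_real_mult hermite_der.simps)
          also have "\<dots> \<le> \<bar>h\<bar> * e"
            using elim[rule_format, of x] unfolding dist_norm by (intro mult_left_mono) auto
          finally show "norm ((\<Sum>i<n. h *\<^sub>R (c i * of_real (hermite_der (Suc m) i x))) - h *\<^sub>R hermite_series c (Suc m) x) \<le> e * norm h"
            by (simp add: mult.commute)
        qed
      qed
    qed
    show "(\<lambda>n. c n * of_real (hermite_der m n 0)) sums hermite_series c m 0"
      unfolding hermite_series_def
      by (rule summable_sums, rule summable_norm_cancel, rule hermite_series_summable[OF assms])
  qed auto
  then obtain g where g: "\<And>x. (\<lambda>n. c n * of_real (hermite_der m n x)) sums g x"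
      "\<And>x. (g has_derivative (\<lambda>h. h *\<^sub>R hermite_series c (Suc m) x)) (at x)" by auto
  have "g = hermite_series c m"
    unfolding hermite_series_def using g(1) sums_unique by blast
  with g(2) show ?thesis by (simp add: has_vector_derivative_def)
qed

lemma iter_deriv_hermite_series:
  assumes "r > 0" "\<And>n. norm (c n) \<le> K * r ^ n"
  shows "iter_deriv m (hermite_series c 0) = hermite_series c m"
proof (induction m)
  case (Suc m)
  then show ?case
    using has_vector_derivative_hermite_series[OF assms, THEN vector_derivative_at, of m]
    by (auto simp: iter_deriv_def)
qed (auto simp: iter_deriv_def)

lemma hermite_series_seminorm_bound:
  assumes "r > 0"
  obtains C where "C \<ge> 0" "\<And>(c::nat \<Rightarrow> complex) K t. (\<And>n. norm (c n) \<le> K * r ^ n) \<Longrightarrow> 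
     norm (t ^ k *\<^sub>R hermite_series c m t) \<le> K * C"
proof -
  obtain C where C: "C \<ge> 0" "\<And>(c::nat \<Rightarrow> complex) K n t. norm (c n) \<le> K * r ^ n \<Longrightarrow> 
     norm (c n * complex_of_real (t ^ k * hermite_der m n t)) \<le> K * C * (1/2) ^ n"
    using hermite_der_bound[OF assms] by metis
  have "norm (t ^ k *\<^sub>R hermite_series c m t) \<le> K * (C * 2)"
    if c: "\<And>n. norm (c n) \<le> K * r ^ n" for c K t
  proof -
    have s: "summable (\<lambda>n. c n * of_real (hermite_der m n t))"
      by (rule summable_norm_cancel, rule hermite_series_summable[OF assms c])
    have "t ^ k *\<^sub>R hermite_series c m t = (\<Sum>n. c n * of_real (t ^ k * hermite_der m n t))"
      unfolding hermite_series_def scaleR_conv_of_real suminf_mult[OF s, symmetric]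
      by (simp add: mult_ac del: hermite_der.simps)
    also have "norm \<dots> \<le> (\<Sum>n. K * C * (1/2) ^ n)"
      by (rule norm_suminf_le) (use C(2) c in \<open>auto intro!: summable_mult summable_geometric simp del: of_real_mult hermite_der.simps\<close>)
    also have "\<dots> = K * (C * 2)"
      by (subst suminf_mult) (auto simp: suminf_geometric intro!: summable_geometric)
    finally show ?thesis .
  qed
  with C(1) that[of "C * 2"] show ?thesis by auto
qed

lemma hermite_series_schwartz:
  assumes "r > 0" "\<And>n. norm (c n) \<le> K * r ^ n"
  shows "hermite_series c 0 \<in> schwartz"
  unfolding schwartz_def
proof (intro CollectI conjI allI)
  show "iter_deriv m (hermite_series c 0) differentiable (at t)" for m t
    unfolding iter_deriv_hermite_series[OF assms] using has_vector_derivative_hermite_series[OF assms, of m t] by (rule differentiableI_vector)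
  show "bounded (range (\<lambda>t. t ^ k *\<^sub>R iter_deriv m (hermite_series c 0) t))" for k m
  proof -
    obtain C where "\<And>(c::nat \<Rightarrow> complex) K t. (\<And>n. norm (c n) \<le> K * r ^ n) \<Longrightarrow> norm (t ^ k *\<^sub>R hermite_series c m t) \<le> K * C"
      using hermite_series_seminorm_bound[OF assms(1)] by metis
    then show ?thesis using assms(2) unfolding iter_deriv_hermite_series[OF assms] by (auto intro!: boundedI[of _ "K * C"])
  qed
qed

text \<open>
  The constant depends on the growth rate \<open>r\<close> of the coefficients only, so that seminorms tend to zero
  along sequences of coefficients for which \<open>K\<close> does.
\<close>

lemma hermite_series_seminorm_le:
  assumes "r > 0"
  obtains C where "C \<ge> 0" "\<And>c K. (\<And>n. norm (c n) \<le> K * r ^ n) \<Longrightarrow> 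
     schwartz_seminorm k m (hermite_series c 0) \<le> K * C"
proof -
  obtain C where "C \<ge> 0" and C: "\<And>(c::nat \<Rightarrow> complex) K t. (\<And>n. norm (c n) \<le> K * r ^ n) \<Longrightarrow> norm (t ^ k *\<^sub>R hermite_series c m t) \<le> K * C"
    using hermite_series_seminorm_bound[OF assms(1)] by metis
  have "schwartz_seminorm k m (hermite_series c 0) \<le> K * C" if "\<And>n. norm (c n) \<le> K * r ^ n" for c K
    unfolding schwartz_seminorm_def iter_deriv_hermite_series[OF assms that]
    by (rule cSUP_least) (use C[OF that] in auto)
  with \<open>C \<ge> 0\<close> that show ?thesis by blast
qed

section \<open>Tempered distributions and coherent states\<close>

lemma schwartz_continuous: "g \<in> schwartz \<Longrightarrow> continuous_on UNIV g"
  unfolding schwartz_def iter_deriv_def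
  by (auto intro!: continuous_at_imp_continuous_on differentiable_imp_continuous_within dest!: spec[of _ "0::nat"])

lemma schwartz_measurable: "g \<in> schwartz \<Longrightarrow> g \<in> borel_measurable borel"
  by (intro borel_measurable_continuous_onI schwartz_continuous)

lemma schwartz_power_bounded: "g \<in> schwartz \<Longrightarrow> \<exists>C. \<forall>t. cmod (t ^ k *\<^sub>R g t) \<le> C"
proof -
  assume "g \<in> schwartz"
  then have "bounded (range (\<lambda>t. t ^ k *\<^sub>R iter_deriv 0 g t))" unfolding schwartz_def by blast
  then show ?thesis by (auto simp: bounded_iff iter_deriv_def)
qed

lemma schwartz_sup_bound: "g \<in> schwartz \<Longrightarrow> cmod (g t) \<le> schwartz_seminorm 0 0 g"
proof -
  assume "g \<in> schwartz"
  then obtain C where "\<And>t. cmod (g t) \<le> C" using schwartz_power_bounded[of g 0] by auto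
  then show ?thesis
    unfolding schwartz_seminorm_def iter_deriv_def
    by (auto intro!: cSUP_upper2[of _ _ t] bdd_aboveI2)
qed

lemma schwartz_decay_bound: "g \<in> schwartz \<Longrightarrow> \<exists>C. \<forall>t. cmod (g t) \<le> C * inverse (1 + t\<^sup>2)"
proof -
  assume g: "g \<in> schwartz"
  obtain C0 where C0: "\<And>t. cmod (g t) \<le> C0" using schwartz_power_bounded[OF g, of 0] by auto
  obtain C2 where C2: "\<And>t. t\<^sup>2 * cmod (g t) \<le> C2" using schwartz_power_bounded[OF g, of 2] by auto
  have "cmod (g t) \<le> (C0 + C2) * inverse (1 + t\<^sup>2)" for t
  proof -
    have "1 + t\<^sup>2 > 0" by (simp add: add_pos_nonneg)
    moreover have "cmod (g t) * (1 + t\<^sup>2) \<le> C0 + C2" using C0[of t] C2[of t] by (simp add: algebra_simps)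
    ultimately show ?thesis by (simp add: divide_inverse[symmetric] pos_le_divide_eq)
  qed
  then show ?thesis by blast
qed

lemma integrable_inverse_1_plus_sq: "integrable lborel (\<lambda>t::real. inverse (1 + t\<^sup>2))"
  using integrable_inverse_1_plus_square by (simp add: set_integrable_def)

lemma schwartz_integrable: 
  assumes g: "g \<in> schwartz" shows "integrable lborel g"
proof -
  obtain C where C: "\<And>t. cmod (g t) \<le> C * inverse (1 + t\<^sup>2)" using schwartz_decay_bound[OF g] by auto
  have [measurable]: "g \<in> borel_measurable borel" by (rule schwartz_measurable[OF g])
  have "C \<ge> 0" using order.trans[OF norm_ge_zero C[of 0]] by simp
  show ?thesis
    by (rule Bochner_Integration.integrable_bound[OF integrable_mult_right[OF integrable_inverse_1_plus_sq, of C]])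
       (use C \<open>C \<ge> 0\<close> in \<open>auto simp: abs_mult add_nonneg_nonneg\<close>)
qed

lemma integrable_mult_schwartz:
  assumes u: "integrable lborel u" and g: "g \<in> schwartz" 
  shows "integrable lborel (\<lambda>t. u t * g t :: complex)"
proof -
  have [measurable]: "g \<in> borel_measurable borel" "u \<in> borel_measurable borel"
    using schwartz_measurable[OF g] u by auto
  show ?thesis
  proof (rule Bochner_Integration.integrable_bound[OF integrable_mult_right[OF u, of "complex_of_real (schwartz_seminorm 0 0 g)"]])
    show "AE x in lborel. cmod (u x * g x) \<le> cmod (complex_of_real (schwartz_seminorm 0 0 g) * u x)"
    proof (intro AE_I2)
      fix x
      have "cmod (g x) \<le> \<bar>schwartz_seminorm 0 0 g\<bar>" using schwartz_sup_bound[OF g, of x] by linarith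
      then show "cmod (u x * g x) \<le> cmod (complex_of_real (schwartz_seminorm 0 0 g) * u x)"
        by (simp add: norm_mult mult.commute[of "cmod (u x)"] mult_right_mono)
    qed
  qed simp
qed

lemma iter_deriv_Suc: "iter_deriv (Suc m) g = (\<lambda>t. vector_derivative (iter_deriv m g) (at t))"
  by (simp add: iter_deriv_def)

lemma schwartz_iter_deriv: "g \<in> schwartz \<Longrightarrow> iter_deriv m g differentiable (at t)"
  by (simp add: schwartz_def)

lemma iter_deriv_add:
  assumes "g \<in> schwartz" "h \<in> schwartz"
  shows "iter_deriv m (\<lambda>t. g t + h t) = (\<lambda>t. iter_deriv m g t + iter_deriv m h t)"
proof (induction m)
  case (Suc m)
  show ?case
    unfolding iter_deriv_Suc Suc
    using vector_derivative_add_at schwartz_iter_deriv[OF assms(1)] schwartz_iter_deriv[OF assms(2)] by blast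
qed (simp add: iter_deriv_def)

lemma iter_deriv_cmult:
  assumes "g \<in> schwartz"
  shows "iter_deriv m (\<lambda>t. a * g t) = (\<lambda>t. a * iter_deriv m g t)"
proof (induction m)
  case (Suc m)
  show ?case
    unfolding iter_deriv_Suc Suc
    using vector_derivative_mult_at[OF differentiable_const schwartz_iter_deriv[OF assms], of a] by fastforce
qed (simp add: iter_deriv_def)

lemma schwartz_add:
  assumes "g \<in> schwartz" "h \<in> schwartz" shows "(\<lambda>t. g t + h t) \<in> schwartz"
proof -
  have "bounded (range (\<lambda>t. t ^ k *\<^sub>R (iter_deriv m g t + iter_deriv m h t)))" for k m
    using assms unfolding schwartz_def scaleR_right_distrib by (auto intro!: bounded_plus_comp)
  then show ?thesis
    using assms unfolding schwartz_def
    by (auto simp: iter_deriv_add[OF assms] intro!: differentiable_add)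
qed

lemma schwartz_cmult:
  assumes "g \<in> schwartz" shows "(\<lambda>t. a * g t) \<in> schwartz"
proof -
  have "bounded (range (\<lambda>t. t ^ k *\<^sub>R (a * iter_deriv m g t)))" for k m
  proof -
    have "bounded (range (\<lambda>t. t ^ k *\<^sub>R iter_deriv m g t))"
      using assms unfolding schwartz_def by blast
    then have "bounded ((\<lambda>z. a * z) ` range (\<lambda>t. t ^ k *\<^sub>R iter_deriv m g t))"
      by (rule bounded_linear_image[OF _ bounded_linear_mult_right])
    then show ?thesis by (simp add: image_image)
  qed
  then show ?thesis
    using assms unfolding schwartz_def
    by (auto simp: iter_deriv_cmult[OF assms] intro!: differentiable_mult)
qed

lemma temperedI:
  assumes "\<And>g. g \<notin> schwartz \<Longrightarrow> f g = 0"
    and "\<And>g h. g \<in> schwartz \<Longrightarrow> h \<in> schwartz \<Longrightarrow> f (\<lambda>t. g t + h t) = f g + f h"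
    and "\<And>a g. g \<in> schwartz \<Longrightarrow> f (\<lambda>t. a * g t) = a * f g"
    and "\<And>g. g \<in> schwartz \<Longrightarrow> cmod (f g) \<le> C * schwartz_seminorm 0 0 g"
  shows "f \<in> tempered"
proof -
  have "\<exists>C n. \<forall>g\<in>schwartz. cmod (f g) \<le> C * (\<Sum>k\<le>n. \<Sum>m\<le>n. schwartz_seminorm k m g)"
    by (rule exI[of _ C], rule exI[of _ 0]) (simp add: assms(4))
  with assms(1-3) show ?thesis unfolding tempered_def by blast
qed

lemma norm_distr_of_le:
  assumes u: "integrable lborel u" and g: "g \<in> schwartz"
  shows "cmod (distr_of u g) \<le> (LINT t|lborel. cmod (u t)) * schwartz_seminorm 0 0 g"
proof -
  have "cmod (distr_of u g) \<le> (LINT t|lborel. cmod (u t * g t))"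
    using g by (simp add: distr_of_def)
  also have "\<dots> \<le> (LINT t|lborel. cmod (u t) * schwartz_seminorm 0 0 g)"
    by (intro integral_mono integrable_norm integrable_mult_schwartz u g integrable_mult_left)
       (auto simp: norm_mult intro!: mult_left_mono schwartz_sup_bound g)
  finally show ?thesis by simp
qed

lemma distr_of_tempered:
  assumes u: "integrable lborel u"
  shows "distr_of u \<in> tempered"
proof (rule temperedI)
  show "cmod (distr_of u g) \<le> (LINT t|lborel. cmod (u t)) * schwartz_seminorm 0 0 g" if "g \<in> schwartz" for g
    by (rule norm_distr_of_le[OF u that])
  show "distr_of u (\<lambda>t. g t + h t) = distr_of u g + distr_of u h" if "g \<in> schwartz" "h \<in> schwartz" for g h
    using that integrable_mult_schwartz[OF u] by (simp add: distr_of_def schwartz_add ring_distribs)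
  show "distr_of u (\<lambda>t. a * g t) = a * distr_of u g" if "g \<in> schwartz" for a g
    using that integrable_mult_schwartz[OF u] by (simp add: distr_of_def schwartz_cmult mult.left_commute)
qed (auto simp: distr_of_def)

definition hermite_mode :: "nat \<Rightarrow> real \<Rightarrow> complex" where
  "hermite_mode n t = of_real (hermite_coeff n t)"

lemma hermite_mode_series: "hermite_mode n = hermite_series (\<lambda>k. if k = n then 1 else 0) 0"
proof
  fix t
  have "hermite_series (\<lambda>k. if k = n then 1 else 0) 0 t = (\<Sum>k. if k = n then complex_of_real (hermite_coeff k t) else 0)"
    unfolding hermite_series_def by (intro suminf_cong) auto
  also have "\<dots> = hermite_mode n t"
    using sums_unique[OF sums_single[of n "\<lambda>k. complex_of_real (hermite_coeff k t)"]]
    by (simp add: hermite_mode_def cong: if_cong) 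
  finally show "hermite_mode n t = hermite_series (\<lambda>k. if k = n then 1 else 0) 0 t" ..
qed

lemma coherent_series: "coherent \<zeta> = hermite_series (\<lambda>n. \<zeta> ^ n) 0"
  unfolding hermite_series_def using coherent_sums[of _ \<zeta>] by (auto simp: sums_iff mult.commute)

lemma coherent_schwartz: "coherent \<zeta> \<in> schwartz"
  unfolding coherent_series
  by (rule hermite_series_schwartz[where r="cmod \<zeta> + 1" and K=1]) (auto simp: norm_power add_nonneg_pos intro!: power_mono)

lemma hermite_mode_schwartz: "hermite_mode n \<in> schwartz"
  unfolding hermite_mode_series by (rule hermite_series_schwartz[where r=1 and K=1]) auto

text \<open>
  The expansion of a coherent state converges in the Schwartz space, and a tempered distribution can
  be applied to it term by term. Hence \<open>\<zeta> \<mapsto> f (coherent \<zeta>)\<close>, which is the Bargmann transform of \<open>f\<close>, is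
  entire and its Taylor coefficients are the Hermite coefficients of \<open>f\<close>, up to normalisation.
\<close>

lemma tempered_coherent_sums:
  assumes f: "f \<in> tempered"
  shows "(\<lambda>n. f (hermite_mode n) * \<zeta> ^ n) sums f (coherent \<zeta>)"
proof -
  have add: "f (\<lambda>t. g t + h t) = f g + f h" if "g \<in> schwartz" "h \<in> schwartz" for g h
    using f that unfolding tempered_def by blast
  have mult: "f (\<lambda>t. a * g t) = a * f g" if "g \<in> schwartz" for a g
    using f that unfolding tempered_def by blast
  obtain C N where C: "\<And>g. g \<in> schwartz \<Longrightarrow> cmod (f g) \<le> C * (\<Sum>k\<le>N. \<Sum>m\<le>N. schwartz_seminorm k m g)"
    using f unfolding tempered_def by blast
  define r where "r = 2 * (cmod \<zeta> + 1)"
  have r: "r > 0" "cmod \<zeta> \<le> r / 2" by (auto simp: r_def add_nonneg_pos)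
  define head where "head M = hermite_series (\<lambda>n. if n < M then \<zeta> ^ n else 0) 0" for M
  define tail where "tail M = hermite_series (\<lambda>n. if n < M then 0 else \<zeta> ^ n) 0" for M
  have zn: "cmod (\<zeta> ^ n) \<le> (1/2) ^ n * r ^ n" for n
    using power_mono[OF r(2), of n] by (simp add: norm_power power_divide)
  have zn1: "cmod (\<zeta> ^ n) \<le> 1 * r ^ n" for n
    by (rule order.trans[OF zn]) (use r in \<open>auto intro!: mult_right_mono power_le_one\<close>)
  have cH: "cmod (if n < M then \<zeta> ^ n else 0) \<le> 1 * r ^ n" for n M using zn1 r by auto
  \<comment> \<open>Allowing the larger growth rate \<open>r\<close> buys the factor \<open>2 ^ (- M)\<close> for the coefficients from \<open>M\<close> on.\<close>
  have cT: "cmod (if n < M then 0 else \<zeta> ^ n) \<le> (1/2) ^ M * r ^ n" for n M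
    using order.trans[OF zn, of n "(1/2) ^ M * r ^ n"] r by (auto intro!: mult_right_mono power_decreasing)
  have H: "head M \<in> schwartz" for M
    unfolding head_def by (rule hermite_series_schwartz[OF r(1) cH])
  have T: "tail M \<in> schwartz" for M
    unfolding tail_def by (rule hermite_series_schwartz[OF r(1) cT])
  have finite_head: "head M t = (\<Sum>n<M. \<zeta> ^ n * hermite_mode n t)" for M t
    unfolding head_def hermite_series_def
    by (subst suminf_finite[of "{..<M}"]) (auto simp: hermite_mode_def)
  have fhead: "f (head M) = (\<Sum>n<M. f (hermite_mode n) * \<zeta> ^ n)" for M
  proof (induction M)
    case 0
    have "f (\<lambda>t. 0 * hermite_mode 0 t) = 0 * f (hermite_mode 0)" by (rule mult[OF hermite_mode_schwartz])
    then show ?case by (simp add: finite_head[abs_def])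
  next
    case (Suc M)
    have "head (Suc M) = (\<lambda>t. head M t + \<zeta> ^ M * hermite_mode M t)"
      by (auto simp: finite_head)
    then have "f (head (Suc M)) = f (head M) + \<zeta> ^ M * f (hermite_mode M)"
      using add[OF H schwartz_cmult[OF hermite_mode_schwartz]] mult[OF hermite_mode_schwartz] by simp
    then show ?case using Suc by simp
  qed
  have split: "coherent \<zeta> = (\<lambda>t. head M t + tail M t)" for M
  proof
    fix t
    show "coherent \<zeta> t = head M t + tail M t"
      unfolding coherent_series head_def tail_def hermite_series_def
      by (subst suminf_add)
         (auto intro!: summable_norm_cancel[OF hermite_series_summable[OF r(1) cH]]
             summable_norm_cancel[OF hermite_series_summable[OF r(1) cT]] suminf_cong simp del: hermite_der.simps)
  qed
  have "\<exists>D. \<forall>k m M. schwartz_seminorm k m (tail M) \<le> (1/2) ^ M * D k m"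
  proof -
    have "\<exists>D. \<forall>M. schwartz_seminorm k m (tail M) \<le> (1/2) ^ M * D" for k m
    proof -
      obtain B where "\<And>c K. (\<And>n. norm (c n) \<le> K * r ^ n) \<Longrightarrow> schwartz_seminorm k m (hermite_series c 0) \<le> K * B"
        using hermite_series_seminorm_le[OF r(1), of k m] by blast
      from this[OF cT] show ?thesis unfolding tail_def by blast
    qed
    then show ?thesis by metis
  qed
  then obtain D where D: "\<And>k m M. schwartz_seminorm k m (tail M) \<le> (1/2) ^ M * D k m" by blast
  have "(\<lambda>M. f (tail M)) \<longlonglongrightarrow> 0"
  proof (rule Lim_null_comparison)
    show "\<forall>\<^sub>F M in sequentially. norm (f (tail M)) \<le> (1/2) ^ M * (\<bar>C\<bar> * (\<Sum>k\<le>N. \<Sum>m\<le>N. \<bar>D k m\<bar>))"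
    proof (intro always_eventually allI)
      fix M
      have "(\<Sum>k\<le>N. \<Sum>m\<le>N. schwartz_seminorm k m (tail M)) \<le> (\<Sum>k\<le>N. \<Sum>m\<le>N. (1/2) ^ M * \<bar>D k m\<bar>)"
        by (intro sum_mono order.trans[OF D] mult_left_mono) auto
      then have le: "(\<Sum>k\<le>N. \<Sum>m\<le>N. schwartz_seminorm k m (tail M)) \<le> (1/2) ^ M * (\<Sum>k\<le>N. \<Sum>m\<le>N. \<bar>D k m\<bar>)"
        by (simp add: sum_distrib_left)
      have pos: "0 \<le> (\<Sum>k\<le>N. \<Sum>m\<le>N. schwartz_seminorm k m (tail M))"
      proof (intro sum_nonneg)
        fix k m
        show "0 \<le> schwartz_seminorm k m (tail M)"
        proof -
          have "bounded (range (\<lambda>t. t ^ k *\<^sub>R iter_deriv m (tail M) t))"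
            using T[of M] unfolding schwartz_def by blast
          then obtain B where "\<And>t. cmod (t ^ k *\<^sub>R iter_deriv m (tail M) t) \<le> B" by (auto simp: bounded_iff)
          then show ?thesis unfolding schwartz_seminorm_def
            by (intro cSUP_upper2[where x=0] bdd_aboveI2[where M=B]) auto
        qed
      qed
      have "norm (f (tail M)) \<le> C * (\<Sum>k\<le>N. \<Sum>m\<le>N. schwartz_seminorm k m (tail M))" by (rule C[OF T])
      also have "\<dots> \<le> \<bar>C\<bar> * (\<Sum>k\<le>N. \<Sum>m\<le>N. schwartz_seminorm k m (tail M))"
        using pos by (intro mult_right_mono) auto
      also have "\<dots> \<le> \<bar>C\<bar> * ((1/2) ^ M * (\<Sum>k\<le>N. \<Sum>m\<le>N. \<bar>D k m\<bar>))"
        using le by (intro mult_left_mono) auto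
      finally show "norm (f (tail M)) \<le> (1/2) ^ M * (\<bar>C\<bar> * (\<Sum>k\<le>N. \<Sum>m\<le>N. \<bar>D k m\<bar>))"
        by (simp add: mult_ac)
    qed
    show "(\<lambda>M. (1/2) ^ M * (\<bar>C\<bar> * (\<Sum>k\<le>N. \<Sum>m\<le>N. \<bar>D k m\<bar>))) \<longlonglongrightarrow> 0"
      by (intro tendsto_mult_left_zero LIMSEQ_realpow_zero) auto
  qed
  then have "(\<lambda>M. f (coherent \<zeta>) - f (tail M)) \<longlonglongrightarrow> f (coherent \<zeta>) - 0"
    by (intro tendsto_diff tendsto_const)
  moreover have "f (coherent \<zeta>) - f (tail M) = (\<Sum>n<M. f (hermite_mode n) * \<zeta> ^ n)" for M
    using add[OF H T, of M M] fhead[of M] split[of M] by simp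
  ultimately show ?thesis by (simp add: sums_def)
qed

section \<open>The Bargmann transform of partial Hermite expansions\<close>

text \<open>
  The conjugate \<open>x - \<i> \<omega>\<close> appears because the pairing conjugates the time-frequency shift.
\<close>

definition bargmann_point :: "real \<times> real \<Rightarrow> complex" where
  "bargmann_point z = Complex (fst z) (- snd z)"

definition bargmann_factor :: "real \<times> real \<Rightarrow> complex" where
  "bargmann_factor z = exp (of_real (- pi / 2 * (norm z)\<^sup>2) - \<i> * of_real (pi * fst z * snd z))"

lemma norm_bargmann_point [simp]: "cmod (bargmann_point z) = norm z"
  by (simp add: bargmann_point_def cmod_def norm_prod_def)

lemma norm_bargmann_factor: "cmod (bargmann_factor z) = exp (- pi / 2 * (norm z)\<^sup>2)"
  by (simp add: bargmann_factor_def)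

text \<open>
  Complete the square in \<open>- pi (t - x)\<^sup>2 - 2 pi \<i> \<omega> t\<close>.
\<close>

lemma cnj_tf_shift_gaussian:
  "(\<lambda>t. cnj (tf_shift z gaussian t)) = (\<lambda>t. bargmann_factor z * coherent (bargmann_point z) t)"
proof
  fix t
  obtain x w where z: "z = (x, w)" by (cases z)
  define c where "c = complex_of_real (2 powr (1/4))"
  have n: "(norm z)\<^sup>2 = x\<^sup>2 + w\<^sup>2" by (simp add: z norm_prod_def)
  have pt: "bargmann_point z = of_real x - \<i> * of_real w" by (simp add: z bargmann_point_def complex_eq_iff)
  have e1: "cnj (exp (2 * complex_of_real pi * \<i> * complex_of_real (w * t))) = exp (- 2 * complex_of_real pi * \<i> * complex_of_real (w * t))"
    by (simp add: exp_cnj)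
  have e2: "cnj (gaussian (t - x)) = c * exp (complex_of_real (- pi * (t - x)\<^sup>2))"
    by (simp only: gaussian_def c_def exp_of_real complex_cnj_complex_of_real flip: of_real_mult)
  have "cnj (tf_shift z gaussian t) = c * exp (- 2 * complex_of_real pi * \<i> * complex_of_real (w * t) + complex_of_real (- pi * (t - x)\<^sup>2))"
    unfolding tf_shift_def z fst_conv snd_conv complex_cnj_mult e1 e2 exp_add by (simp only: mult_ac)
  also have "- 2 * complex_of_real pi * \<i> * complex_of_real (w * t) + complex_of_real (- pi * (t - x)\<^sup>2)
     = (of_real (- pi / 2 * (norm z)\<^sup>2) - \<i> * of_real (pi * x * w)) + 
       (of_real (- pi * t\<^sup>2) + of_real (2 * pi * t) * bargmann_point z - of_real (pi / 2) * (bargmann_point z)\<^sup>2)"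
    unfolding n pt by (simp add: complex_eq_iff power2_eq_square algebra_simps)
  also have "c * exp \<dots> = bargmann_factor z * coherent (bargmann_point z) t"
    by (simp add: exp_add bargmann_factor_def coherent_def c_def z)
  finally show "cnj (tf_shift z gaussian t) = bargmann_factor z * coherent (bargmann_point z) t" .
qed

lemma pairing_tf_shift:
  assumes "f \<in> tempered"
  shows "pairing f (tf_shift z gaussian) = bargmann_factor z * f (coherent (bargmann_point z))"
  using assms coherent_schwartz unfolding pairing_def cnj_tf_shift_gaussian tempered_def by blast

lemma norm_coherent:
  "cmod (coherent \<zeta> t) = 2 powr (1/4) * exp (pi / 2 * (cmod \<zeta>)\<^sup>2) * exp (- pi * (t - Re \<zeta>)\<^sup>2)"
proof -
  have "cmod (coherent \<zeta> t) = 2 powr (1/4) * exp (- pi * t\<^sup>2 + 2 * pi * t * Re \<zeta> - pi / 2 * ((Re \<zeta>)\<^sup>2 - (Im \<zeta>)\<^sup>2))"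
    by (simp add: coherent_def norm_mult Re_power2)
  also have "- pi * t\<^sup>2 + 2 * pi * t * Re \<zeta> - pi / 2 * ((Re \<zeta>)\<^sup>2 - (Im \<zeta>)\<^sup>2) = pi / 2 * (cmod \<zeta>)\<^sup>2 + - pi * (t - Re \<zeta>)\<^sup>2"
    unfolding cmod_power2 by (simp add: power2_eq_square algebra_simps)
  finally show ?thesis by (simp only: exp_add mult.assoc)
qed

lemma normal_density_gaussian:
  assumes "a > 0" shows "normal_density \<mu> (1 / sqrt (2 * pi * a)) t = sqrt a * exp (- pi * a * (t - \<mu>)\<^sup>2)"
  using assms by (simp add: normal_density_def power_divide real_sqrt_divide field_simps)

lemma integral_gaussian:
  assumes "a > 0"
  shows "integrable lborel (\<lambda>t::real. exp (- pi * a * (t - \<mu>)\<^sup>2))"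
    and "(LINT t|lborel. exp (- pi * a * (t - \<mu>)\<^sup>2)) = 1 / sqrt a"
proof -
  have s: "1 / sqrt (2 * pi * a) > 0" using assms by simp
  have e: "exp (- pi * a * (t - \<mu>)\<^sup>2) = normal_density \<mu> (1 / sqrt (2 * pi * a)) t / sqrt a" for t
    using assms by (simp add: normal_density_gaussian)
  show "integrable lborel (\<lambda>t::real. exp (- pi * a * (t - \<mu>)\<^sup>2))"
    unfolding e using s by simp
  show "(LINT t|lborel. exp (- pi * a * (t - \<mu>)\<^sup>2)) = 1 / sqrt a"
    unfolding e using s by simp
qed

lemma coherent_integrable: "integrable lborel (coherent \<zeta>)"
  by (rule schwartz_integrable[OF coherent_schwartz])

lemma integral_norm_coherent:
  "(LINT t|lborel. cmod (coherent \<zeta> t)) = 2 powr (1/4) * exp (pi / 2 * (cmod \<zeta>)\<^sup>2)"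
  unfolding norm_coherent using integral_gaussian(2)[of 1 "Re \<zeta>"] by simp

lemma hermite_coeff_mult_integrable: "integrable lborel (\<lambda>t. hermite_coeff n t * hermite_coeff k t)"
proof -
  have "integrable lborel (\<lambda>t. Re (hermite_mode n t * hermite_mode k t))" 
    by (intro integrable_Re integrable_mult_schwartz schwartz_integrable hermite_mode_schwartz)
  then show ?thesis by (simp add: hermite_mode_def)
qed

lemma hermite_coeff_mult_tendsto_0:
  shows "((\<lambda>t. hermite_coeff n t * hermite_coeff k t) \<longlongrightarrow> 0) at_top"
    and "((\<lambda>t. hermite_coeff n t * hermite_coeff k t) \<longlongrightarrow> 0) at_bot"
proof -
  obtain C where C: "\<And>t. cmod (hermite_mode n t) \<le> C * inverse (1 + t\<^sup>2)"
    using schwartz_decay_bound[OF hermite_mode_schwartz[of n]] by auto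
  have le: "norm (hermite_coeff n t * hermite_coeff k t) \<le> (C * inverse (1 + t\<^sup>2)) * (2 * exp (pi * 1\<^sup>2) / 1 ^ k)" for t
    unfolding norm_mult
  proof (rule mult_mono)
    show "norm (hermite_coeff n t) \<le> C * inverse (1 + t\<^sup>2)" using C[of t] by (simp add: hermite_mode_def)
    show "norm (hermite_coeff k t) \<le> 2 * exp (pi * 1\<^sup>2) / 1 ^ k"
      unfolding real_norm_def by (rule abs_hermite_coeff_le) simp
    show "0 \<le> C * inverse (1 + t\<^sup>2)" by (rule order.trans[OF norm_ge_zero C])
  qed simp
  have "((\<lambda>t::real. C * inverse (1 + t\<^sup>2) * (2 * exp (pi * 1\<^sup>2) / 1 ^ k)) \<longlongrightarrow> C * 0 * (2 * exp (pi * 1\<^sup>2) / 1 ^ k)) at_top"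
    by (intro tendsto_intros tendsto_inverse_0_at_top filterlim_tendsto_add_at_top[OF tendsto_const] filterlim_pow_at_top filterlim_ident) auto
  then show "((\<lambda>t. hermite_coeff n t * hermite_coeff k t) \<longlongrightarrow> 0) at_top"
    unfolding mult_zero_right mult_zero_left by (rule Lim_null_comparison[OF always_eventually[OF allI[OF le]]])
  have "((\<lambda>t::real. C * inverse (1 + t\<^sup>2) * (2 * exp (pi * 1\<^sup>2) / 1 ^ k)) \<longlongrightarrow> C * 0 * (2 * exp (pi * 1\<^sup>2) / 1 ^ k)) at_bot"
    by (intro tendsto_intros tendsto_inverse_0_at_top filterlim_tendsto_add_at_top[OF tendsto_const] filterlim_pow_at_bot_even filterlim_ident) auto
  then show "((\<lambda>t. hermite_coeff n t * hermite_coeff k t) \<longlongrightarrow> 0) at_bot"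
    unfolding mult_zero_right mult_zero_left by (rule Lim_null_comparison[OF always_eventually[OF allI[OF le]]])
qed

text \<open>
  The derivative of a product of two of the functions integrates to zero. This is the statement that the
  two ladder operators are adjoint to each other, and orthogonality follows by induction.
\<close>

lemma hermite_coeff_integral_Suc:
  "(real n + 1) * (LINT t|lborel. hermite_coeff (Suc n) t * hermite_coeff k t) =
     (if k = 0 then 0 else pi * (LINT t|lborel. hermite_coeff n t * hermite_coeff (k - 1) t))"
proof -
  \<comment> \<open>The derivative of the product. The two terms with a factor \<open>t\<close> cancel if one factor is differentiated
    by \<open>DERIV_hermite_coeff'\<close>, the other by \<open>DERIV_hermite_coeff\<close>, followed by \<open>hermite_coeff_Suc\<close>.\<close>
  define D where "D t = 2 * pi * (if k = 0 then 0 else hermite_coeff n t * hermite_coeff (k - 1) t)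
      - 2 * (real n + 1) * (hermite_coeff (Suc n) t * hermite_coeff k t)" for t
  have der: "((\<lambda>t. hermite_coeff n t * hermite_coeff k t) has_real_derivative D t) (at t)" for t
    by (rule DERIV_cong[OF DERIV_mult[OF DERIV_hermite_coeff'[of n t] DERIV_hermite_coeff[of k t]]])
       (unfold hermite_coeff_Suc[of k t] D_def, auto simp: algebra_simps)
  have cont: "isCont (hermite_coeff j) t" for j t
    using DERIV_hermite_coeff' DERIV_isCont by blast
  have int: "integrable lborel D"
    unfolding D_def using hermite_coeff_mult_integrable by (cases "k = 0") auto
  have "(LBINT t=-\<infinity>..\<infinity>. D t) = 0 - 0"
  proof (rule interval_integral_FTC_integrable[where F="\<lambda>t. hermite_coeff n t * hermite_coeff k t"])
    show "isCont D t" for t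
      unfolding D_def using cont by (cases "k = 0") (auto intro!: continuous_intros)
    show "set_integrable lborel (einterval (-\<infinity>) \<infinity>) D" using int by (simp add: set_integrable_def)
    show "(((\<lambda>t. hermite_coeff n t * hermite_coeff k t) \<circ> real_of_ereal) \<longlongrightarrow> 0) (at_right (-\<infinity>))"
         "(((\<lambda>t. hermite_coeff n t * hermite_coeff k t) \<circ> real_of_ereal) \<longlongrightarrow> 0) (at_left \<infinity>)"
      using hermite_coeff_mult_tendsto_0 by (simp_all add: ereal_tendsto_simps)
  qed (use der in \<open>auto simp: has_real_derivative_iff_has_vector_derivative\<close>)
  then have "(LINT t|lborel. D t) = 0"
    by (simp add: interval_lebesgue_integral_def set_lebesgue_integral_def)
  moreover have "(LINT t|lborel. D t) = 2 * pi * (if k = 0 then 0 else LINT t|lborel. hermite_coeff n t * hermite_coeff (k - 1) t)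
      - 2 * (real n + 1) * (LINT t|lborel. hermite_coeff (Suc n) t * hermite_coeff k t)"
    unfolding D_def
    by (cases "k = 0"; simp; subst Bochner_Integration.integral_diff)
       (auto intro!: integrable_mult_right hermite_coeff_mult_integrable)
  ultimately have eq: "0 = 2 * pi * (if k = 0 then 0 else LINT t|lborel. hermite_coeff n t * hermite_coeff (k - 1) t)
      - 2 * (real n + 1) * (LINT t|lborel. hermite_coeff (Suc n) t * hermite_coeff k t)"
    by (simp only:)
  have aux: "m * Y = p * X" if "0 = 2 * p * X - 2 * m * Y" for m Y p X :: real
    using that by auto
  have "(real n + 1) * (LINT t|lborel. hermite_coeff (Suc n) t * hermite_coeff k t) =
     pi * (if k = 0 then 0 else LINT t|lborel. hermite_coeff n t * hermite_coeff (k - 1) t)"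
    by (rule aux[OF eq])
  then show ?thesis by (simp split: if_splits)
qed

lemma hermite_coeff_orthogonal:
  "(LINT t|lborel. hermite_coeff n t * hermite_coeff k t) = (if n = k then pi ^ n / fact n else 0)"
proof (induction n arbitrary: k)
  case 0
  show ?case
  proof (cases k)
    case 0
    have "hermite_coeff 0 t * hermite_coeff 0 t = sqrt 2 * exp (- pi * 2 * (t - 0)\<^sup>2)" for t
    proof -
      have "(2::real) powr (1/4) * 2 powr (1/4) = sqrt 2" by (simp add: powr_half_sqrt flip: powr_add)
      moreover have "exp (- pi * t\<^sup>2) * exp (- pi * t\<^sup>2) = exp (- pi * 2 * (t - 0)\<^sup>2)" by (simp flip: exp_add)
      moreover have "hermite_coeff 0 t * hermite_coeff 0 t = (2 powr (1/4) * 2 powr (1/4)) * (exp (- pi * t\<^sup>2) * exp (- pi * t\<^sup>2))"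
        unfolding hermite_coeff_0 by (simp only: mult_ac)
      ultimately show ?thesis by (simp only:)
    qed
    then show ?thesis using integral_gaussian(2)[of 2 0] 0 by simp
  next
    case (Suc j)
    show ?thesis
      using hermite_coeff_integral_Suc[of j 0] Suc
      by (simp add: mult.commute add_eq_0_iff)
  qed
next
  case (Suc n)
  have "(LINT t|lborel. hermite_coeff (Suc n) t * hermite_coeff k t)
      = (real n + 1) * (LINT t|lborel. hermite_coeff (Suc n) t * hermite_coeff k t) / (real n + 1)"
    by simp
  also have "\<dots> = (if k = 0 then 0 else pi * (LINT t|lborel. hermite_coeff n t * hermite_coeff (k - 1) t)) / (real n + 1)"
    by (simp only: hermite_coeff_integral_Suc)
  also have "\<dots> = (if Suc n = k then pi ^ Suc n / fact (Suc n) else 0)"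
    by (cases k) (auto simp: Suc.IH add.commute)
  finally show ?case .
qed

lemma distr_of_hermite_mode:
  "distr_of (hermite_mode n) (hermite_mode k) = (if n = k then of_real (pi ^ n / fact n) else 0)"
proof -
  have "distr_of (hermite_mode n) (hermite_mode k) = (LINT t|lborel. of_real (hermite_coeff n t * hermite_coeff k t))"
    using hermite_mode_schwartz by (simp add: distr_of_def hermite_mode_def)
  also have "\<dots> = of_real (LINT t|lborel. hermite_coeff n t * hermite_coeff k t)"
    by (rule integral_complex_of_real)
  finally show ?thesis by (simp add: hermite_coeff_orthogonal)
qed

lemma distr_of_hermite_mode_coherent:
  "distr_of (hermite_mode n) (coherent \<zeta>) = (of_real pi * \<zeta>) ^ n / fact n"
proof -
  have "(\<lambda>k. distr_of (hermite_mode n) (hermite_mode k) * \<zeta> ^ k) sums distr_of (hermite_mode n) (coherent \<zeta>)"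
    by (intro tempered_coherent_sums distr_of_tempered schwartz_integrable hermite_mode_schwartz)
  moreover have "(\<lambda>k. distr_of (hermite_mode n) (hermite_mode k) * \<zeta> ^ k) = (\<lambda>k. if k = n then of_real (pi ^ k / fact k) * \<zeta> ^ k else 0)"
    by (auto simp: distr_of_hermite_mode)
  ultimately show ?thesis
    using sums_unique2[OF _ sums_single[of n "\<lambda>k. of_real (pi ^ k / fact k) * \<zeta> ^ k"]]
    by (auto simp: power_mult_distrib)
qed

lemma integral_coherent_hermite_mode: 
  "(LINT t|lborel. coherent \<eta> t * hermite_mode n t) = (of_real pi * \<eta>) ^ n / fact n"
  using distr_of_hermite_mode_coherent[of n \<eta>] coherent_schwartz by (simp add: distr_of_def mult.commute)

text \<open>
  Expanding one factor and using orthogonality avoids a Gaussian integral with complex parameters.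
\<close>

lemma integral_coherent_coherent: 
  "(LINT t|lborel. coherent \<eta> t * coherent \<zeta> t) = exp (of_real pi * \<eta> * \<zeta>)"
proof -
  have "(\<lambda>k. distr_of (coherent \<eta>) (hermite_mode k) * \<zeta> ^ k) sums distr_of (coherent \<eta>) (coherent \<zeta>)"
    by (intro tempered_coherent_sums distr_of_tempered coherent_integrable)
  moreover have "distr_of (coherent \<eta>) (hermite_mode k) * \<zeta> ^ k = (of_real pi * \<eta> * \<zeta>) ^ k /\<^sub>R fact k" for k
    using hermite_mode_schwartz
    by (simp add: distr_of_def integral_coherent_hermite_mode power_mult_distrib scaleR_conv_of_real divide_inverse mult_ac)
  ultimately show ?thesis
    using sums_unique2[OF _ exp_converges[of "of_real pi * \<eta> * \<zeta>"]] coherent_schwartz by (simp add: distr_of_def)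
qed

lemma hermite_fun_eq: "hermite_fun n = (\<lambda>t. of_real (sqrt (fact n / pi ^ n)) * hermite_mode n t)"
proof
  fix t
  define K :: real where "K = 2 ^ n * fact n / 2 powr (1/4)"
  have K: "K > 0" by (simp add: K_def)
  have raw: "hermite_raw n t = (-1) ^ n * (K * hermite_coeff n t)" for t
    by (simp add: hermite_raw_eq K_def hermite_coeff_def power_divide power_mult_distrib[symmetric])
  have "(LINT t|lborel. (hermite_raw n t)\<^sup>2) = (LINT t|lborel. K\<^sup>2 * (hermite_coeff n t * hermite_coeff n t))"
    unfolding raw power_mult_distrib by (simp add: power2_eq_square power_mult_distrib[symmetric])
  also have "\<dots> = K\<^sup>2 * (pi ^ n / fact n)" by (simp add: hermite_coeff_orthogonal)
  finally have norm_sq: "(LINT t|lborel. (hermite_raw n t)\<^sup>2) = K\<^sup>2 * (pi ^ n / fact n)" .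
  have "sqrt (K\<^sup>2 * x) = K * sqrt x" for x using K by (simp add: real_sqrt_mult)
  then have "hermite_const n = (-1) ^ n / (K * sqrt (pi ^ n / fact n))"
    unfolding hermite_const_def norm_sq by (simp only:)
  then have "hermite_const n * hermite_raw n t = hermite_coeff n t / sqrt (pi ^ n / fact n)"
    using K by (simp add: raw power_mult_distrib[symmetric])
  also have "\<dots> = sqrt (fact n / pi ^ n) * hermite_coeff n t" by (simp add: real_sqrt_divide)
  finally show "hermite_fun n t = of_real (sqrt (fact n / pi ^ n)) * hermite_mode n t"
    by (simp only: hermite_fun_def hermite_mode_def of_real_mult)
qed

lemma hermite_partial_eq:
  assumes f: "f \<in> tempered"
  shows "hermite_partial N f = distr_of (\<lambda>t. \<Sum>n\<le>N. f (hermite_mode n) * of_real (fact n / pi ^ n) * hermite_mode n t)"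
proof -
  have pair: "pairing f (hermite_fun n) = of_real (sqrt (fact n / pi ^ n)) * f (hermite_mode n)" for n
  proof -
    have "(\<lambda>t. cnj (hermite_fun n t)) = (\<lambda>t. of_real (sqrt (fact n / pi ^ n)) * hermite_mode n t)"
      unfolding hermite_fun_eq by (simp add: hermite_mode_def)
    then show ?thesis
      using f hermite_mode_schwartz[of n] unfolding pairing_def tempered_def by simp
  qed
  have sq: "complex_of_real (sqrt (fact n / pi ^ n)) * of_real (sqrt (fact n / pi ^ n)) = of_real (fact n / pi ^ n)" for n
    by (simp flip: of_real_mult real_sqrt_mult del: of_real_divide)
  have "pairing f (hermite_fun n) * hermite_fun n t = f (hermite_mode n) * of_real (fact n / pi ^ n) * hermite_mode n t" for n t
  proof -
    have "s * b * (s * m) = b * (s * s) * m" for s b m :: complex by (simp add: mult_ac)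
    then show ?thesis unfolding pair unfolding hermite_fun_eq sq[symmetric] .
  qed
  then show ?thesis by (simp add: hermite_partial_def)
qed

lemma hermite_partial_tempered:
  assumes "f \<in> tempered" shows "hermite_partial N f \<in> tempered"
  unfolding hermite_partial_eq[OF assms]
  by (intro distr_of_tempered Bochner_Integration.integrable_sum integrable_mult_right schwartz_integrable hermite_mode_schwartz)

text \<open>
  By orthogonality the partial Hermite expansion is the Taylor polynomial of the Bargmann transform.
\<close>

lemma hermite_partial_coherent:
  assumes "f \<in> tempered"
  shows "hermite_partial N f (coherent \<zeta>) = (\<Sum>n\<le>N. f (hermite_mode n) * \<zeta> ^ n)"
proof -
  have int: "integrable lborel (\<lambda>t. hermite_mode n t * coherent \<zeta> t)" for n
    by (intro integrable_mult_schwartz schwartz_integrable hermite_mode_schwartz coherent_schwartz)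
  have "hermite_partial N f (coherent \<zeta>) =
     (LINT t|lborel. (\<Sum>n\<le>N. f (hermite_mode n) * of_real (fact n / pi ^ n) * (hermite_mode n t * coherent \<zeta> t)))"
    unfolding hermite_partial_eq[OF assms] distr_of_def using coherent_schwartz
    by (simp add: sum_distrib_right mult.assoc)
  also have "\<dots> = (\<Sum>n\<le>N. f (hermite_mode n) * of_real (fact n / pi ^ n) * (LINT t|lborel. hermite_mode n t * coherent \<zeta> t))"
    by (subst Bochner_Integration.integral_sum) (auto intro!: integrable_mult_right int)
  also have "\<dots> = (\<Sum>n\<le>N. f (hermite_mode n) * \<zeta> ^ n)"
  proof (intro sum.cong refl)
    fix n
    have "(LINT t|lborel. hermite_mode n t * coherent \<zeta> t) = (of_real pi * \<zeta>) ^ n / fact n"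
      using integral_coherent_hermite_mode[of \<zeta> n] by (simp add: mult.commute)
    then show "f (hermite_mode n) * of_real (fact n / pi ^ n) * (LINT t|lborel. hermite_mode n t * coherent \<zeta> t) = f (hermite_mode n) * \<zeta> ^ n"
      by (simp add: power_mult_distrib)
  qed
  finally show ?thesis .
qed

section \<open>Means of subharmonic functions over circles\<close>

lemma has_real_derivative_along_curve:
  assumes "(\<Phi> has_derivative (\<lambda>h. a * Re h + b * Im h)) (at (u r))"
    and "(u has_vector_derivative u') (at r)"
  shows "((\<lambda>r. \<Phi> (u r) :: real) has_real_derivative a * Re u' + b * Im u') (at r)"
proof -
  have "((\<lambda>r. \<Phi> (u r)) has_derivative (\<lambda>h. a * Re (h *\<^sub>R u') + b * Im (h *\<^sub>R u'))) (at r)"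
    using has_derivative_compose[OF assms(2)[unfolded has_vector_derivative_def] assms(1)] .
  then show ?thesis
    by (rule has_derivative_imp_has_field_derivative) (simp add: algebra_simps)
qed

lemma has_real_derivative_Re_Im:
  assumes "(u has_vector_derivative u') (at r)"
  shows "((\<lambda>r. Re (u r)) has_real_derivative Re u') (at r)" "((\<lambda>r. Im (u r)) has_real_derivative Im u') (at r)"
  using bounded_linear.has_vector_derivative[OF bounded_linear_Re assms]
    bounded_linear.has_vector_derivative[OF bounded_linear_Im assms]
  by (simp_all add: has_real_derivative_iff_has_vector_derivative)

text \<open>
  Let \<open>M r\<close> be the integral of \<open>\<Phi> \<circ> F\<close> over the circle of radius \<open>r\<close>. Then \<open>K r = r * M' r\<close> satisfies
  \<open>r * K' r = \<integral> r\<^sup>2 \<Delta>(\<Phi> \<circ> F) d\<theta> \<ge> 0\<close>, because the tangential part of the Laplacian integrates to zero over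
  the circle. So \<open>K\<close> increases from \<open>K 0 = 0\<close>, hence \<open>M\<close> increases, and \<open>M 0 \<le> M 1\<close> is the claim. The
  argument differentiates \<open>\<Phi>\<close> twice, which is why the majorants below are regularised.
\<close>

lemma subharmonic_circle_mean:
  fixes \<Phi> gx gy gxx gxy gyx gyy :: "complex \<Rightarrow> real"
  assumes \<Phi>: "\<And>\<zeta>. (\<Phi> has_derivative (\<lambda>h. gx \<zeta> * Re h + gy \<zeta> * Im h)) (at \<zeta>)"
    and gx: "\<And>\<zeta>. (gx has_derivative (\<lambda>h. gxx \<zeta> * Re h + gxy \<zeta> * Im h)) (at \<zeta>)"
    and gy: "\<And>\<zeta>. (gy has_derivative (\<lambda>h. gyx \<zeta> * Re h + gyy \<zeta> * Im h)) (at \<zeta>)"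
    and cont: "continuous_on UNIV gxx" "continuous_on UNIV gxy" "continuous_on UNIV gyx" "continuous_on UNIV gyy"
    and laplace: "\<And>\<zeta>. gxx \<zeta> + gyy \<zeta> \<ge> 0"
    and F: "F holomorphic_on UNIV"
  shows "2 * pi * \<Phi> (F 0) \<le> integral {-pi..pi} (\<lambda>\<theta>. \<Phi> (F (cis \<theta>)))"
proof -
  define F1 where "F1 = deriv F"
  define F2 where "F2 = deriv F1"
  have F1: "F1 holomorphic_on UNIV" unfolding F1_def by (intro holomorphic_deriv F open_UNIV)
  have F2: "F2 holomorphic_on UNIV" unfolding F2_def by (intro holomorphic_deriv F1 open_UNIV)
  have dF: "(F has_field_derivative F1 z) (at z)" for z
    unfolding F1_def using holomorphic_derivI[OF F open_UNIV] by auto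
  have dF1: "(F1 has_field_derivative F2 z) (at z)" for z
    unfolding F2_def using holomorphic_derivI[OF F1 open_UNIV] by auto
  have c1: "continuous_on UNIV \<Phi>" "continuous_on UNIV gx" "continuous_on UNIV gy"
    using \<Phi> gx gy by (auto intro!: continuous_at_imp_continuous_on has_derivative_continuous)
  have c2: "continuous_on UNIV F" "continuous_on UNIV F1" "continuous_on UNIV F2"
    using F F1 F2 by (auto intro: holomorphic_on_imp_continuous_on)
  define z where "z r \<theta> = complex_of_real r * cis \<theta>" for r \<theta>
  define Z where "Z r \<theta> = F1 (z r \<theta>) * z r \<theta>" for r \<theta>
  define Y where "Y r \<theta> = F2 (z r \<theta>) * z r \<theta> * z r \<theta> + F1 (z r \<theta>) * z r \<theta>" for r \<theta>
  define V where "V r \<theta> = F1 (z r \<theta>) * cis \<theta>" for r \<theta>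
  define Vr where "Vr r \<theta> = (F2 (z r \<theta>) * z r \<theta> + F1 (z r \<theta>)) * cis \<theta>" for r \<theta>
  define pull where "pull \<phi> r \<theta> = \<phi> (F (z r \<theta>))" for \<phi> :: "complex \<Rightarrow> real" and r \<theta>
  \<comment> \<open>\<open>W1\<close> is the radial derivative of \<open>\<Phi> \<circ> F\<close>, \<open>k = r W1\<close>, and \<open>k1\<close> is the radial derivative of \<open>k\<close>.\<close>
  define W1 where "W1 r \<theta> = pull gx r \<theta> * Re (V r \<theta>) + pull gy r \<theta> * Im (V r \<theta>)" for r \<theta>
  define k where "k r \<theta> = pull gx r \<theta> * Re (Z r \<theta>) + pull gy r \<theta> * Im (Z r \<theta>)" for r \<theta>
  define k1 where "k1 r \<theta> = (pull gxx r \<theta> * Re (V r \<theta>) + pull gxy r \<theta> * Im (V r \<theta>)) * Re (Z r \<theta>) + pull gx r \<theta> * Re (Vr r \<theta>)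
     + ((pull gyx r \<theta> * Re (V r \<theta>) + pull gyy r \<theta> * Im (V r \<theta>)) * Im (Z r \<theta>) + pull gy r \<theta> * Im (Vr r \<theta>))" for r \<theta>
  \<comment> \<open>The tangential derivative of \<open>\<Phi> \<circ> F\<close>, and the Laplacian of \<open>\<Phi> \<circ> F\<close> times \<open>r\<^sup>2\<close>.\<close>
  define j where "j r \<theta> = pull gy r \<theta> * Re (Z r \<theta>) - pull gx r \<theta> * Im (Z r \<theta>)" for r \<theta>
  define S where "S r \<theta> = (pull gxx r \<theta> + pull gyy r \<theta>) * (cmod (Z r \<theta>))\<^sup>2" for r \<theta>
  note [continuous_intros] =
    continuous_on_compose2[OF c1(1)] continuous_on_compose2[OF c1(2)] continuous_on_compose2[OF c1(3)]
    continuous_on_compose2[OF c2(1)] continuous_on_compose2[OF c2(2)] continuous_on_compose2[OF c2(3)]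
    continuous_on_compose2[OF cont(1)] continuous_on_compose2[OF cont(2)] continuous_on_compose2[OF cont(3)] continuous_on_compose2[OF cont(4)]
  have cz: "continuous_on A (\<lambda>x. z (f x) (g x))" if "continuous_on A f" "continuous_on A g" for A :: "'x::topological_space set" and f g
    unfolding z_def using that by (intro continuous_intros) 
  have zr: "((\<lambda>r. z r \<theta>) has_vector_derivative cis \<theta>) (at r)" for r \<theta>
    unfolding z_def by (auto intro!: derivative_eq_intros simp: has_vector_derivative_def scaleR_conv_of_real)
  have zt: "((\<lambda>\<theta>. z r \<theta>) has_vector_derivative \<i> * z r \<theta>) (at \<theta>)" for r \<theta>
  proof -
    have "(cis has_vector_derivative \<i> * cis \<theta>) (at \<theta>)"
      by (auto intro!: derivative_eq_intros simp: has_vector_derivative_def scaleR_conv_of_real mult_ac)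
    from has_vector_derivative_mult_right[OF this, of "of_real r"] show ?thesis
      by (simp add: z_def mult_ac)
  qed
  have Fr: "((\<lambda>r. F (z r \<theta>)) has_vector_derivative V r \<theta>) (at r)" for r \<theta>
    using field_vector_diff_chain_at[OF zr dF] by (simp add: o_def mult.commute V_def)
  have Ft: "((\<lambda>\<theta>. F (z r \<theta>)) has_vector_derivative \<i> * Z r \<theta>) (at \<theta>)" for r \<theta>
    using field_vector_diff_chain_at[OF zt dF] by (simp add: o_def mult_ac Z_def)
  have Zr: "((\<lambda>r. Z r \<theta>) has_vector_derivative Vr r \<theta>) (at r)" for r \<theta>
    unfolding Z_def Vr_def
    using has_vector_derivative_mult[OF field_vector_diff_chain_at[OF zr dF1, unfolded o_def] zr]
    by (simp add: algebra_simps)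
  have Zt: "((\<lambda>\<theta>. Z r \<theta>) has_vector_derivative \<i> * Y r \<theta>) (at \<theta>)" for r \<theta>
    unfolding Z_def Y_def
    using has_vector_derivative_mult[OF field_vector_diff_chain_at[OF zt dF1, unfolded o_def] zt]
    by (simp add: algebra_simps)
  have pull_r: "((\<lambda>r. pull \<phi> r \<theta>) has_real_derivative a * Re (V r \<theta>) + b * Im (V r \<theta>)) (at r)"
    and pull_t: "((\<lambda>\<theta>. pull \<phi> r \<theta>) has_real_derivative a * Re (\<i> * Z r \<theta>) + b * Im (\<i> * Z r \<theta>)) (at \<theta>)"
    if "(\<phi> has_derivative (\<lambda>h. a * Re h + b * Im h)) (at (F (z r \<theta>)))" for \<phi> a b r \<theta>
    unfolding pull_def
    using has_real_derivative_along_curve[of \<phi> a b "\<lambda>r. F (z r \<theta>)"] has_real_derivative_along_curve[of \<phi> a b "\<lambda>\<theta>. F (z r \<theta>)"]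
      that Fr Ft by blast+
  have dW: "((\<lambda>r. pull \<Phi> r \<theta>) has_real_derivative W1 r \<theta>) (at r)" for r \<theta>
    using pull_r[OF \<Phi>] by (simp add: W1_def pull_def)
  have dk: "((\<lambda>r. k r \<theta>) has_real_derivative k1 r \<theta>) (at r)" for r \<theta>
    using DERIV_add[OF DERIV_mult[OF pull_r[OF gx] has_real_derivative_Re_Im(1)[OF Zr]]
        DERIV_mult[OF pull_r[OF gy] has_real_derivative_Re_Im(2)[OF Zr]]]
    unfolding k_def k1_def by (rule DERIV_cong) (simp add: pull_def algebra_simps)
  \<comment> \<open>The Laplacian in polar coordinates: \<open>r k1 + (d/d\<theta>) j = S\<close>; the mixed second derivatives cancel.\<close>
  have dj: "((\<lambda>\<theta>. j r \<theta>) has_real_derivative S r \<theta> - r * k1 r \<theta>) (at \<theta>)" for r \<theta>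
  proof -
    have rZ: "of_real r * Vr r \<theta> = Y r \<theta>" "of_real r * V r \<theta> = Z r \<theta>"
      unfolding Vr_def V_def Y_def z_def Z_def by (simp_all add: algebra_simps)
    have r: "r * Re (V r \<theta>) = Re (Z r \<theta>)" "r * Im (V r \<theta>) = Im (Z r \<theta>)"
       "r * Re (Vr r \<theta>) = Re (Y r \<theta>)" "r * Im (Vr r \<theta>) = Im (Y r \<theta>)"
      unfolding rZ[symmetric] by simp_all
    have "r * k1 r \<theta> = (pull gxx r \<theta> * (r * Re (V r \<theta>)) + pull gxy r \<theta> * (r * Im (V r \<theta>))) * Re (Z r \<theta>) + pull gx r \<theta> * (r * Re (Vr r \<theta>))
     + ((pull gyx r \<theta> * (r * Re (V r \<theta>)) + pull gyy r \<theta> * (r * Im (V r \<theta>))) * Im (Z r \<theta>) + pull gy r \<theta> * (r * Im (Vr r \<theta>)))"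
      unfolding k1_def by (simp add: algebra_simps)
    then have rk: "r * k1 r \<theta> = (pull gxx r \<theta> * Re (Z r \<theta>) + pull gxy r \<theta> * Im (Z r \<theta>)) * Re (Z r \<theta>) + pull gx r \<theta> * Re (Y r \<theta>)
     + ((pull gyx r \<theta> * Re (Z r \<theta>) + pull gyy r \<theta> * Im (Z r \<theta>)) * Im (Z r \<theta>) + pull gy r \<theta> * Im (Y r \<theta>))"
      unfolding r .
    show ?thesis
      using DERIV_diff[OF DERIV_mult[OF pull_t[OF gy] has_real_derivative_Re_Im(1)[OF Zt]]
          DERIV_mult[OF pull_t[OF gx] has_real_derivative_Re_Im(2)[OF Zt]]]
      unfolding j_def S_def rk cmod_power2
      by (rule DERIV_cong) (simp add: pull_def algebra_simps power2_eq_square)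
  qed
  define M where "M r = integral {-pi..pi} (pull \<Phi> r)" for r
  define K where "K r = integral {-pi..pi} (k r)" for r
  have cW1: "continuous_on A (\<lambda>x. W1 (f x) (g x))" if "continuous_on A f" "continuous_on A g" for A :: "'x::topological_space set" and f g
    unfolding W1_def V_def pull_def using that by (intro continuous_intros cz) auto
  have ck: "continuous_on A (\<lambda>x. k (f x) (g x))" if "continuous_on A f" "continuous_on A g" for A :: "'x::topological_space set" and f g
    unfolding k_def Z_def pull_def using that by (intro continuous_intros cz) auto
  have ck1: "continuous_on A (\<lambda>x. k1 (f x) (g x))" if "continuous_on A f" "continuous_on A g" for A :: "'x::topological_space set" and f g
    unfolding k1_def Z_def V_def Vr_def pull_def using that by (intro continuous_intros cz) auto
  have dM: "(M has_real_derivative integral {-pi..pi} (W1 r)) (at r)" for r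
  proof -
    have "((\<lambda>r. integral (cbox (-pi) pi) (pull \<Phi> r)) has_field_derivative integral (cbox (-pi) pi) (W1 r)) (at r within UNIV)"
    proof (rule leibniz_rule_field_derivative)
      show "continuous_on (UNIV \<times> cbox (-pi) pi) (\<lambda>(x, t). W1 x t)"
        unfolding split_beta by (intro cW1 continuous_intros)
      show "pull \<Phi> x integrable_on cbox (-pi) pi" for x
        unfolding pull_def by (rule integrable_continuous) (intro continuous_intros cz; simp)
    qed (use dW in auto)
    then show ?thesis unfolding M_def[abs_def] by simp
  qed
  have dK: "(K has_real_derivative integral {-pi..pi} (k1 r)) (at r)" for r
  proof -
    have "((\<lambda>r. integral (cbox (-pi) pi) (k r)) has_field_derivative integral (cbox (-pi) pi) (k1 r)) (at r within UNIV)"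
    proof (rule leibniz_rule_field_derivative)
      show "continuous_on (UNIV \<times> cbox (-pi) pi) (\<lambda>(x, t). k1 x t)"
        unfolding split_beta by (intro ck1 continuous_intros)
      show "k x integrable_on cbox (-pi) pi" for x
        by (rule integrable_continuous) (intro ck continuous_intros)
    qed (use dk in auto)
    then show ?thesis unfolding K_def[abs_def] by simp
  qed
  \<comment> \<open>By periodicity of \<open>j\<close> its derivative integrates to 0, which leaves the nonnegative Laplacian.\<close>
  have k1_nonneg: "integral {-pi..pi} (k1 r) \<ge> 0" if "r > 0" for r
  proof -
    have "((\<lambda>\<theta>. S r \<theta> - r * k1 r \<theta>) has_integral (j r pi - j r (-pi))) {-pi..pi}"
      by (rule fundamental_theorem_of_calculus)
         (use dj in \<open>auto simp: has_real_derivative_iff_has_vector_derivative[symmetric] intro: has_field_derivative_at_within\<close>)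
    moreover have "j r pi = j r (-pi)" by (simp add: j_def Z_def z_def pull_def cis.ctr)
    ultimately have "((\<lambda>\<theta>. S r \<theta> - r * k1 r \<theta>) has_integral 0) {-pi..pi}" by simp
    moreover have "((\<lambda>\<theta>. r * k1 r \<theta>) has_integral r * integral {-pi..pi} (k1 r)) {-pi..pi}"
      by (intro has_integral_mult_right integrable_integral integrable_continuous_interval ck1 continuous_intros)
    ultimately have "((\<lambda>\<theta>. (S r \<theta> - r * k1 r \<theta>) + r * k1 r \<theta>) has_integral 0 + r * integral {-pi..pi} (k1 r)) {-pi..pi}"
      by (rule has_integral_add)
    then have "((\<lambda>\<theta>. S r \<theta>) has_integral r * integral {-pi..pi} (k1 r)) {-pi..pi}" by simp
    then have "0 \<le> r * integral {-pi..pi} (k1 r)"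
      by (rule has_integral_nonneg) (simp add: S_def pull_def laplace)
    with that show ?thesis by (simp add: zero_le_mult_iff)
  qed
  have K0: "K 0 = 0" by (simp add: K_def k_def[abs_def] Z_def z_def)
  have K_nonneg: "K r \<ge> 0" if "r > 0" for r
  proof -
    have "K 0 \<le> K r"
      by (rule DERIV_nonneg_imp_increasing_open[of 0 r])
         (use that dK k1_nonneg in \<open>auto intro!: DERIV_continuous_on dK intro: DERIV_subset\<close>)
    then show ?thesis using K0 by simp
  qed
  have W1_nonneg: "integral {-pi..pi} (W1 r) \<ge> 0" if "r > 0" for r
  proof -
    have "K r = integral {-pi..pi} (\<lambda>\<theta>. r * W1 r \<theta>)"
      unfolding K_def k_def W1_def Z_def V_def z_def by (rule integral_cong) (simp add: algebra_simps)
    also have "\<dots> = r * integral {-pi..pi} (W1 r)" by simp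
    finally show ?thesis using K_nonneg[OF that] that by (simp add: zero_le_mult_iff)
  qed
  have "M 0 \<le> M 1"
    by (rule DERIV_nonneg_imp_increasing_open[of 0 1])
       (use dM W1_nonneg in \<open>auto intro!: DERIV_continuous_on intro: DERIV_subset\<close>)
  then show ?thesis by (simp add: M_def pull_def[abs_def] z_def)
qed

section \<open>Subharmonic majorants of powers\<close>

text \<open>
  The partial derivatives are hidden behind the quantifiers, so that sums and multiples of such functions
  only have to keep track of the Laplacian \<open>L\<close>.
\<close>

definition C2_laplacian :: "(complex \<Rightarrow> real) \<Rightarrow> (complex \<Rightarrow> real) \<Rightarrow> bool" where
  "C2_laplacian \<Phi> L \<longleftrightarrow> (\<exists>gx gy gxx gxy gyx gyy.
     (\<forall>\<zeta>. (\<Phi> has_derivative (\<lambda>h. gx \<zeta> * Re h + gy \<zeta> * Im h)) (at \<zeta>)) \<and>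
     (\<forall>\<zeta>. (gx has_derivative (\<lambda>h. gxx \<zeta> * Re h + gxy \<zeta> * Im h)) (at \<zeta>)) \<and>
     (\<forall>\<zeta>. (gy has_derivative (\<lambda>h. gyx \<zeta> * Re h + gyy \<zeta> * Im h)) (at \<zeta>)) \<and>
     continuous_on UNIV gxx \<and> continuous_on UNIV gxy \<and> continuous_on UNIV gyx \<and> continuous_on UNIV gyy \<and>
     (\<forall>\<zeta>. L \<zeta> = gxx \<zeta> + gyy \<zeta>))"

lemma C2_laplacian_circle_mean:
  assumes "C2_laplacian \<Phi> L" "\<And>\<zeta>. L \<zeta> \<ge> 0" "F holomorphic_on UNIV"
  shows "2 * pi * \<Phi> (F 0) \<le> integral {-pi..pi} (\<lambda>\<theta>. \<Phi> (F (cis \<theta>)))"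
proof -
  obtain gx gy gxx gxy gyx gyy where 1:
     "\<And>\<zeta>. (\<Phi> has_derivative (\<lambda>h. gx \<zeta> * Re h + gy \<zeta> * Im h)) (at \<zeta>)"
     "\<And>\<zeta>. (gx has_derivative (\<lambda>h. gxx \<zeta> * Re h + gxy \<zeta> * Im h)) (at \<zeta>)"
     "\<And>\<zeta>. (gy has_derivative (\<lambda>h. gyx \<zeta> * Re h + gyy \<zeta> * Im h)) (at \<zeta>)"
     "continuous_on UNIV gxx" "continuous_on UNIV gxy" "continuous_on UNIV gyx" "continuous_on UNIV gyy"
     "\<And>\<zeta>. L \<zeta> = gxx \<zeta> + gyy \<zeta>" using assms(1) unfolding C2_laplacian_def by blast
  show ?thesis
    by (rule subharmonic_circle_mean[OF 1(1-7) _ assms(3)]) (use assms(2) 1(8) in auto)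
qed

lemma C2_laplacian_continuous:
  assumes "C2_laplacian \<Phi> L" shows "continuous_on UNIV \<Phi>"
proof -
  have "\<exists>D. (\<Phi> has_derivative D) (at \<zeta>)" for \<zeta>
    using assms unfolding C2_laplacian_def by blast
  then show ?thesis
    by (auto intro!: continuous_at_imp_continuous_on dest: has_derivative_continuous)
qed

lemma C2_laplacian_lincomb:
  assumes "C2_laplacian \<Phi> L" "C2_laplacian \<Psi> M"
  shows "C2_laplacian (\<lambda>\<zeta>. a * \<Phi> \<zeta> - \<Psi> \<zeta>) (\<lambda>\<zeta>. a * L \<zeta> - M \<zeta>)"
proof -
  obtain gx gy gxx gxy gyx gyy where 1:
     "\<And>\<zeta>. (\<Phi> has_derivative (\<lambda>h. gx \<zeta> * Re h + gy \<zeta> * Im h)) (at \<zeta>)"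
     "\<And>\<zeta>. (gx has_derivative (\<lambda>h. gxx \<zeta> * Re h + gxy \<zeta> * Im h)) (at \<zeta>)"
     "\<And>\<zeta>. (gy has_derivative (\<lambda>h. gyx \<zeta> * Re h + gyy \<zeta> * Im h)) (at \<zeta>)"
     "continuous_on UNIV gxx" "continuous_on UNIV gxy" "continuous_on UNIV gyx" "continuous_on UNIV gyy"
     "\<And>\<zeta>. L \<zeta> = gxx \<zeta> + gyy \<zeta>" using assms(1) unfolding C2_laplacian_def by blast
  obtain kx ky kxx kxy kyx kyy where 2:
     "\<And>\<zeta>. (\<Psi> has_derivative (\<lambda>h. kx \<zeta> * Re h + ky \<zeta> * Im h)) (at \<zeta>)"
     "\<And>\<zeta>. (kx has_derivative (\<lambda>h. kxx \<zeta> * Re h + kxy \<zeta> * Im h)) (at \<zeta>)"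
     "\<And>\<zeta>. (ky has_derivative (\<lambda>h. kyx \<zeta> * Re h + kyy \<zeta> * Im h)) (at \<zeta>)"
     "continuous_on UNIV kxx" "continuous_on UNIV kxy" "continuous_on UNIV kyx" "continuous_on UNIV kyy"
     "\<And>\<zeta>. M \<zeta> = kxx \<zeta> + kyy \<zeta>" using assms(2) unfolding C2_laplacian_def by blast
  have lc: "((\<lambda>\<zeta>. a * f \<zeta> - g \<zeta>) has_derivative (\<lambda>h. (a * p - p') * Re h + (a * q - q') * Im h)) (at \<zeta>)"
    if "(f has_derivative (\<lambda>h. p * Re h + q * Im h)) (at \<zeta>)" "(g has_derivative (\<lambda>h. p' * Re h + q' * Im h)) (at \<zeta>)"
    for f g :: "complex \<Rightarrow> real" and p q p' q' \<zeta>
    using has_derivative_diff[OF has_derivative_mult_right[OF that(1), of a] that(2)] by (simp add: algebra_simps)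
  show ?thesis
    unfolding C2_laplacian_def
    by (rule exI[of _ "\<lambda>\<zeta>. a * gx \<zeta> - kx \<zeta>"], rule exI[of _ "\<lambda>\<zeta>. a * gy \<zeta> - ky \<zeta>"],
        rule exI[of _ "\<lambda>\<zeta>. a * gxx \<zeta> - kxx \<zeta>"], rule exI[of _ "\<lambda>\<zeta>. a * gxy \<zeta> - kxy \<zeta>"],
        rule exI[of _ "\<lambda>\<zeta>. a * gyx \<zeta> - kyx \<zeta>"], rule exI[of _ "\<lambda>\<zeta>. a * gyy \<zeta> - kyy \<zeta>"])
       (intro conjI allI lc 1 2 continuous_intros, simp add: 1(8) 2(8) algebra_simps)
qed

text \<open>
  The squares of \<open>Re \<zeta>\<close> and of the modulus, shifted by \<open>\<epsilon>\<close> so that their real powers are smooth at the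
  zeros.
\<close>

definition reg_re :: "real \<Rightarrow> complex \<Rightarrow> real" where "reg_re \<epsilon> \<zeta> = (Re \<zeta>)\<^sup>2 + \<epsilon>"
definition reg_abs :: "real \<Rightarrow> complex \<Rightarrow> real" where "reg_abs \<epsilon> \<zeta> = (Re \<zeta>)\<^sup>2 + (Im \<zeta>)\<^sup>2 + \<epsilon>"
definition reg_mono :: "real \<Rightarrow> real \<Rightarrow> real \<Rightarrow> complex \<Rightarrow> real" where
  "reg_mono \<epsilon> \<alpha> \<beta> \<zeta> = reg_abs \<epsilon> \<zeta> powr \<alpha> * reg_re \<epsilon> \<zeta> powr \<beta>"

context
  fixes \<epsilon> :: real
  assumes eps: "\<epsilon> > 0"
begin

lemma reg_pos: "reg_re \<epsilon> \<zeta> > 0" "reg_abs \<epsilon> \<zeta> > 0" "reg_re \<epsilon> \<zeta> \<le> reg_abs \<epsilon> \<zeta>"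
  using eps by (auto simp: reg_re_def reg_abs_def add_nonneg_pos)

lemma reg_mono_has_derivative:
  "(reg_mono \<epsilon> \<alpha> \<beta> has_derivative (\<lambda>h.
      2 * Re \<zeta> * (\<alpha> * reg_mono \<epsilon> (\<alpha> - 1) \<beta> \<zeta> + \<beta> * reg_mono \<epsilon> \<alpha> (\<beta> - 1) \<zeta>) * Re h
      + 2 * Im \<zeta> * (\<alpha> * reg_mono \<epsilon> (\<alpha> - 1) \<beta> \<zeta>) * Im h)) (at \<zeta>)"
proof -
  have dq: "(reg_abs \<epsilon> has_derivative (\<lambda>h. 2 * Re \<zeta> * Re h + 2 * Im \<zeta> * Im h)) (at \<zeta>)"
    unfolding reg_abs_def[abs_def] by (auto intro!: derivative_eq_intros)
  have dX: "(reg_re \<epsilon> has_derivative (\<lambda>h. 2 * Re \<zeta> * Re h)) (at \<zeta>)"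
    unfolding reg_re_def[abs_def] by (auto intro!: derivative_eq_intros)
  have pw: "((\<lambda>z. f z powr a) has_derivative (\<lambda>h. a * f \<zeta> powr (a - 1) * D h)) (at \<zeta>)"
    if f: "(f has_derivative D) (at \<zeta>)" "f \<zeta> > 0" for f :: "complex \<Rightarrow> real" and D a
    using has_derivative_powr[OF f(1) has_derivative_const f(2), of a] f(2)
    by (simp add: powr_diff mult_ac)
  show ?thesis
    unfolding reg_mono_def[abs_def]
    by (rule has_derivative_eq_rhs[OF has_derivative_mult[OF pw[OF dq reg_pos(2)] pw[OF dX reg_pos(1)]]])
       (simp add: algebra_simps)
qed

lemma continuous_on_reg_mono: "continuous_on UNIV (reg_mono \<epsilon> \<alpha> \<beta>)"
  using reg_mono_has_derivative by (auto intro!: continuous_at_imp_continuous_on has_derivative_continuous)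

lemma C2_laplacian_reg_mono:
  "C2_laplacian (reg_mono \<epsilon> \<alpha> \<beta>) (\<lambda>\<zeta>.
     4 * \<alpha> * reg_mono \<epsilon> (\<alpha> - 1) \<beta> \<zeta> + 2 * \<beta> * reg_mono \<epsilon> \<alpha> (\<beta> - 1) \<zeta>
     + 4 * (Re \<zeta>)\<^sup>2 * (\<alpha> * (\<alpha> - 1) * reg_mono \<epsilon> (\<alpha> - 2) \<beta> \<zeta> + 2 * \<alpha> * \<beta> * reg_mono \<epsilon> (\<alpha> - 1) (\<beta> - 1) \<zeta> + \<beta> * (\<beta> - 1) * reg_mono \<epsilon> \<alpha> (\<beta> - 2) \<zeta>)
     + 4 * (Im \<zeta>)\<^sup>2 * (\<alpha> * (\<alpha> - 1) * reg_mono \<epsilon> (\<alpha> - 2) \<beta> \<zeta>))"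
proof -
  let ?m = "reg_mono \<epsilon>"
  define gxx where "gxx \<zeta> = 2 * (\<alpha> * ?m (\<alpha> - 1) \<beta> \<zeta> + \<beta> * ?m \<alpha> (\<beta> - 1) \<zeta>)
     + 4 * (Re \<zeta>)\<^sup>2 * (\<alpha> * (\<alpha> - 1) * ?m (\<alpha> - 2) \<beta> \<zeta> + 2 * \<alpha> * \<beta> * ?m (\<alpha> - 1) (\<beta> - 1) \<zeta> + \<beta> * (\<beta> - 1) * ?m \<alpha> (\<beta> - 2) \<zeta>)" for \<zeta>
  define gxy where "gxy \<zeta> = 4 * Re \<zeta> * Im \<zeta> * (\<alpha> * (\<alpha> - 1) * ?m (\<alpha> - 2) \<beta> \<zeta> + \<alpha> * \<beta> * ?m (\<alpha> - 1) (\<beta> - 1) \<zeta>)" for \<zeta>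
  define gyy where "gyy \<zeta> = 2 * \<alpha> * ?m (\<alpha> - 1) \<beta> \<zeta> + 4 * (Im \<zeta>)\<^sup>2 * (\<alpha> * (\<alpha> - 1) * ?m (\<alpha> - 2) \<beta> \<zeta>)" for \<zeta>
  have c: "continuous_on UNIV gxx" "continuous_on UNIV gxy" "continuous_on UNIV gyy"
    unfolding gxx_def[abs_def] gxy_def[abs_def] gyy_def[abs_def] by (intro continuous_intros continuous_on_reg_mono)+
  have lc: "((\<lambda>\<zeta>. a * f \<zeta> + b * g \<zeta>) has_derivative (\<lambda>h. (a * p + b * p') * Re h + (a * q + b * q') * Im h)) (at \<zeta>)"
    if "(f has_derivative (\<lambda>h. p * Re h + q * Im h)) (at \<zeta>)" "(g has_derivative (\<lambda>h. p' * Re h + q' * Im h)) (at \<zeta>)"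
    for f g :: "complex \<Rightarrow> real" and a b p q p' q' \<zeta>
    using has_derivative_add[OF has_derivative_mult_right[OF that(1), of a] has_derivative_mult_right[OF that(2), of b]] by (simp add: algebra_simps)
  have re: "((\<lambda>\<zeta>. 2 * Re \<zeta> * f \<zeta>) has_derivative (\<lambda>h. A * Re h + B * Im h)) (at \<zeta>)"
    if "(f has_derivative (\<lambda>h. p * Re h + q * Im h)) (at \<zeta>)" "A = 2 * f \<zeta> + 2 * Re \<zeta> * p" "B = 2 * Re \<zeta> * q"
    for f :: "complex \<Rightarrow> real" and p q \<zeta> A B
    by (rule has_derivative_eq_rhs[OF has_derivative_mult[OF _ that(1), of "\<lambda>\<zeta>. 2 * Re \<zeta>" "\<lambda>h. 2 * Re h"]])
       (auto intro!: derivative_eq_intros simp: that(2,3) algebra_simps)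
  have im: "((\<lambda>\<zeta>. 2 * Im \<zeta> * f \<zeta>) has_derivative (\<lambda>h. A * Re h + B * Im h)) (at \<zeta>)"
    if "(f has_derivative (\<lambda>h. p * Re h + q * Im h)) (at \<zeta>)" "A = 2 * Im \<zeta> * p" "B = 2 * f \<zeta> + 2 * Im \<zeta> * q"
    for f :: "complex \<Rightarrow> real" and p q \<zeta> A B
    by (rule has_derivative_eq_rhs[OF has_derivative_mult[OF _ that(1), of "\<lambda>\<zeta>. 2 * Im \<zeta>" "\<lambda>h. 2 * Im h"]])
       (auto intro!: derivative_eq_intros simp: that(2,3) algebra_simps)
  have gx: "((\<lambda>\<zeta>. 2 * Re \<zeta> * (\<alpha> * ?m (\<alpha> - 1) \<beta> \<zeta> + \<beta> * ?m \<alpha> (\<beta> - 1) \<zeta>)) has_derivative (\<lambda>h. gxx \<zeta> * Re h + gxy \<zeta> * Im h)) (at \<zeta>)" for \<zeta>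
    by (rule re[OF lc[OF reg_mono_has_derivative reg_mono_has_derivative]])
       (simp_all add: gxx_def gxy_def algebra_simps power2_eq_square)
  have gy: "((\<lambda>\<zeta>. 2 * Im \<zeta> * (\<alpha> * ?m (\<alpha> - 1) \<beta> \<zeta>)) has_derivative (\<lambda>h. gxy \<zeta> * Re h + gyy \<zeta> * Im h)) (at \<zeta>)" for \<zeta>
    using im[OF lc[OF reg_mono_has_derivative[of "\<alpha> - 1" \<beta> \<zeta>] reg_mono_has_derivative[of 0 0 \<zeta>], of \<alpha> 0] refl refl]
    by (simp add: gyy_def gxy_def algebra_simps power2_eq_square)
  show ?thesis
    unfolding C2_laplacian_def
    by (rule exI[of _ "\<lambda>\<zeta>. 2 * Re \<zeta> * (\<alpha> * ?m (\<alpha> - 1) \<beta> \<zeta> + \<beta> * ?m \<alpha> (\<beta> - 1) \<zeta>)"],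
        rule exI[of _ "\<lambda>\<zeta>. 2 * Im \<zeta> * (\<alpha> * ?m (\<alpha> - 1) \<beta> \<zeta>)"],
        rule exI[of _ gxx], rule exI[of _ gxy], rule exI[of _ gxy], rule exI[of _ gyy])
       (intro conjI allI gx gy reg_mono_has_derivative c, simp add: gxx_def gyy_def algebra_simps)
qed

end

lemma powr_add_le:
  fixes a b s :: real
  assumes "a > 0" "b > 0" "0 < s" "s \<le> 1"
  shows "(a + b) powr s \<le> a powr s + b powr s"
proof -
  have "x \<le> x powr s" if "0 < x" "x \<le> 1" for x :: real
    using powr_mono'[of s 1 x] that assms by simp
  from this[of "a / (a + b)"] this[of "b / (a + b)"] assms
  have "a / (a + b) + b / (a + b) \<le> (a / (a + b)) powr s + (b / (a + b)) powr s" by (intro add_mono) auto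
  also have "a / (a + b) + b / (a + b) = 1" using assms by (simp flip: add_divide_distrib)
  also have "(a / (a + b)) powr s + (b / (a + b)) powr s = (a powr s + b powr s) / (a + b) powr s"
    using assms by (simp add: powr_divide add_divide_distrib)
  finally show ?thesis using assms by (simp add: pos_le_divide_eq)
qed

lemma add_powr_le:
  fixes a b s :: real
  assumes "a \<ge> 0" "b \<ge> 0" "s > 0"
  shows "(a + b) powr s \<le> 2 powr s * (a powr s + b powr s)"
proof -
  have "(a + b) powr s \<le> (2 * max a b) powr s" using assms by (intro powr_mono2) auto
  also have "\<dots> = 2 powr s * (max a b) powr s" using assms by (simp add: powr_mult)
  also have "\<dots> \<le> 2 powr s * (a powr s + b powr s)" by (intro mult_left_mono) (auto simp: max_def)
  finally show ?thesis .
qed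

text \<open>
  Composed with an entire function \<open>F\<close> and integrated over the unit circle, such a function bounds the mean
  of \<open>|F|\<^sup>p\<close>, \<open>p = 2 s\<close>, by that of \<open>|Re F|\<^sup>p\<close>. The last condition takes care of the centre: the
  majorant is applied to two functions whose values there are \<open>\<zeta>\<close> and \<open>\<i> * \<zeta>\<close>.
\<close>

definition riesz_majorant :: "real \<Rightarrow> real \<Rightarrow> real \<Rightarrow> (complex \<Rightarrow> real) \<Rightarrow> bool" where
  "riesz_majorant s C \<epsilon> \<Phi> \<longleftrightarrow> (\<exists>L. C2_laplacian \<Phi> L \<and> (\<forall>\<zeta>. L \<zeta> \<ge> 0)) \<and>
     (\<forall>\<zeta>. \<Phi> \<zeta> \<le> C * reg_re \<epsilon> \<zeta> powr s - reg_abs \<epsilon> \<zeta> powr s / 2) \<and> (\<forall>\<zeta>. \<Phi> \<zeta> + \<Phi> (\<i> * \<zeta>) \<ge> 0)"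

text \<open>
  Write \<open>X\<close> and \<open>q\<close> for the two regularised squares, so that \<open>X \<le> q\<close>. The majorant is \<open>A * X\<^sup>s - q\<^sup>s\<close>. For
  \<open>s \<le> 1\<close> the Laplacian of \<open>X\<^sup>s\<close> is at least \<open>2 s (2 s - 1) X powr (s - 1)\<close>, and that of \<open>q\<^sup>s\<close> is at most
  \<open>4 s q powr (s - 1) \<le> 4 s X powr (s - 1)\<close>; the constant \<open>A = 2 / (2 s - 1)\<close> balances the two. At the
  centre the inequality is the subadditivity of \<open>t \<mapsto> t powr s\<close>.
\<close>

lemma riesz_majorant_small_exponent:
  assumes s: "s > 1/2" "s \<le> 1" and e: "\<epsilon> > 0"
  shows "\<exists>\<Phi>. riesz_majorant s (2 / (2 * s - 1)) \<epsilon> \<Phi>"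
proof -
  define A where "A = 2 / (2 * s - 1)"
  have A: "A \<ge> 2" "A * (2 * s - 1) = 2" using s by (auto simp: A_def field_simps)
  let ?X = "reg_re \<epsilon>" and ?q = "reg_abs \<epsilon>"
  note pos = reg_pos[OF e]
  let ?\<Phi> = "\<lambda>\<zeta>. A * reg_mono \<epsilon> 0 s \<zeta> - reg_mono \<epsilon> s 0 \<zeta>"
  have \<Phi>: "?\<Phi> \<zeta> = A * ?X \<zeta> powr s - ?q \<zeta> powr s" for \<zeta>
    using pos[of \<zeta>] by (simp add: reg_mono_def)
  let ?L = "\<lambda>\<zeta>. A * (2 * s * ?X \<zeta> powr (s - 1) + 4 * (Re \<zeta>)\<^sup>2 * (s * (s - 1) * ?X \<zeta> powr (s - 2)))
      - (4 * s * ?q \<zeta> powr (s - 1) + 4 * (s * (s - 1)) * ?q \<zeta> powr (s - 2) * ((Re \<zeta>)\<^sup>2 + (Im \<zeta>)\<^sup>2))"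
  have C2: "C2_laplacian ?\<Phi> ?L"
  proof -
    have p0: "?X \<zeta> powr 0 = 1" "?q \<zeta> powr 0 = 1" for \<zeta> using pos[of \<zeta>] by auto
    show ?thesis
      using C2_laplacian_lincomb[OF C2_laplacian_reg_mono[OF e, of 0 s] C2_laplacian_reg_mono[OF e, of s 0], of A]
      by (simp only: reg_mono_def p0) (simp add: algebra_simps)
  qed
  have L: "?L \<zeta> \<ge> 0" for \<zeta>
  proof -
    define x y X q where "x = (Re \<zeta>)\<^sup>2" and "y = (Im \<zeta>)\<^sup>2" and "X = ?X \<zeta>" and "q = ?q \<zeta>"
    have Xq: "X > 0" "q > 0" "X \<le> q" "x \<ge> 0" "y \<ge> 0" "x \<le> X"
      using pos[of \<zeta>] e by (auto simp: X_def q_def x_def y_def reg_re_def)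
    have X2: "X powr (s - 2) * X = X powr (s - 1)"
      using Xq powr_mult_base[of X "s - 2"] by (simp add: mult.commute)
    have "s * (s - 1) \<le> 0" using s by (simp add: mult_le_0_iff)
    have "x * X powr (s - 2) \<le> X powr (s - 1)"
      unfolding X2[symmetric] using Xq by (simp add: mult.commute mult_left_mono)
    then have "(s * (s - 1)) * X powr (s - 1) \<le> (s * (s - 1)) * (x * X powr (s - 2))"
      using \<open>s * (s - 1) \<le> 0\<close> by (rule mult_left_mono_neg)
    then have "2 * s * X powr (s - 1) + 4 * ((s * (s - 1)) * X powr (s - 1)) \<le> 2 * s * X powr (s - 1) + 4 * x * (s * (s - 1) * X powr (s - 2))"
      by (simp add: mult_ac)
    also have "2 * s * X powr (s - 1) + 4 * ((s * (s - 1)) * X powr (s - 1)) = 2 * s * (2 * s - 1) * X powr (s - 1)"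
      by (simp add: algebra_simps)
    finally have "A * (2 * s * (2 * s - 1) * X powr (s - 1)) \<le> A * (2 * s * X powr (s - 1) + 4 * x * (s * (s - 1) * X powr (s - 2)))"
      using A by (intro mult_left_mono) auto
    also have "A * (2 * s * (2 * s - 1) * X powr (s - 1)) = 4 * s * X powr (s - 1)"
      using A(2) by (metis (no_types, opaque_lifting) mult.assoc mult.commute mult_2 numeral_Bit0 distrib_right)
    finally have 1: "4 * s * X powr (s - 1) \<le> A * (2 * s * X powr (s - 1) + 4 * x * (s * (s - 1) * X powr (s - 2)))" .
    have "q powr (s - 1) \<le> X powr (s - 1)" using Xq s by (intro powr_mono2') auto
    then have 2: "4 * s * q powr (s - 1) \<le> 4 * s * X powr (s - 1)" using s by (intro mult_left_mono) auto
    have 3: "4 * (s * (s - 1)) * q powr (s - 2) * (x + y) \<le> 0"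
    proof (rule mult_nonpos_nonneg, rule mult_nonpos_nonneg)
      show "4 * (s * (s - 1)) \<le> 0" using \<open>s * (s - 1) \<le> 0\<close> by linarith
    qed (use Xq in auto)
    show ?thesis using 1 2 3 unfolding x_def y_def X_def q_def by linarith
  qed
  have up: "?\<Phi> \<zeta> \<le> A * ?X \<zeta> powr s - ?q \<zeta> powr s / 2" for \<zeta>
    unfolding \<Phi> using powr_ge_zero[of "?q \<zeta>" s] by linarith
  have cen: "?\<Phi> \<zeta> + ?\<Phi> (\<i> * \<zeta>) \<ge> 0" for \<zeta>
  proof -
    have q: "?q (\<i> * \<zeta>) = ?q \<zeta>" by (simp add: reg_abs_def)
    have "?q \<zeta> powr s \<le> (?X \<zeta> + ?X (\<i> * \<zeta>)) powr s"
      using pos[of \<zeta>] e s by (intro powr_mono2) (auto simp: reg_abs_def reg_re_def)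
    also have "\<dots> \<le> ?X \<zeta> powr s + ?X (\<i> * \<zeta>) powr s"
      using pos s by (intro powr_add_le) auto
    finally have "2 * ?q \<zeta> powr s \<le> A * (?X \<zeta> powr s + ?X (\<i> * \<zeta>) powr s)"
      using A(1) by (intro mult_mono) auto
    then show ?thesis unfolding \<Phi> q by (simp add: algebra_simps)
  qed
  show ?thesis
    unfolding riesz_majorant_def A_def[symmetric]
    by (rule exI[of _ ?\<Phi>], intro conjI allI up cen, rule exI[of _ ?L]) (intro conjI allI C2 L)
qed

text \<open>
  For \<open>s > 1\<close> the Laplacian of \<open>X\<^sup>s\<close> degenerates where \<open>X\<close> is small, so the majorant is
  \<open>a * q powr (s - 1) * X - q\<^sup>s\<close> instead. The Laplacian of \<open>q powr (s - 1) * X\<close> is at least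
  \<open>2 q powr (s - 1)\<close> and that of \<open>q\<^sup>s\<close> is at most \<open>4 s\<^sup>2 q powr (s - 1)\<close>, whence \<open>a = 2 s\<^sup>2\<close>. The upper
  bound is Young's inequality, in the form of a case distinction whether \<open>a * X \<le> q / 2\<close>.
\<close>

lemma riesz_majorant_large_exponent:
  assumes s: "s \<ge> 1" and e: "\<epsilon> > 0"
  shows "\<exists>\<Phi>. riesz_majorant s (2 * s\<^sup>2 * (4 * s\<^sup>2) powr (s - 1)) \<epsilon> \<Phi>"
proof -
  define a where "a = 2 * s\<^sup>2"
  have a: "a \<ge> 2" using s by (simp add: a_def)
  define C where "C = a * (2 * a) powr (s - 1)"
  have C0: "C \<ge> 0" using a by (simp add: C_def)
  let ?X = "reg_re \<epsilon>" and ?q = "reg_abs \<epsilon>"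
  note pos = reg_pos[OF e]
  let ?\<Phi> = "\<lambda>\<zeta>. a * reg_mono \<epsilon> (s - 1) 1 \<zeta> - reg_mono \<epsilon> s 0 \<zeta>"
  have \<Phi>: "?\<Phi> \<zeta> = a * (?q \<zeta> powr (s - 1) * ?X \<zeta>) - ?q \<zeta> powr s" for \<zeta>
    using pos[of \<zeta>] by (simp add: reg_mono_def)
  let ?L = "\<lambda>\<zeta>. a * (4 * (s - 1) * ?q \<zeta> powr (s - 2) * ?X \<zeta> + 2 * ?q \<zeta> powr (s - 1)
        + 8 * (s - 1) * ?q \<zeta> powr (s - 2) * (Re \<zeta>)\<^sup>2 
        + 4 * (s - 1) * (s - 2) * ?q \<zeta> powr (s - 3) * ?X \<zeta> * ((Re \<zeta>)\<^sup>2 + (Im \<zeta>)\<^sup>2))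
      - (4 * s * ?q \<zeta> powr (s - 1) + 4 * (s * (s - 1)) * ?q \<zeta> powr (s - 2) * ((Re \<zeta>)\<^sup>2 + (Im \<zeta>)\<^sup>2))"
  have C2: "C2_laplacian ?\<Phi> ?L"
  proof -
    have p0: "?X \<zeta> powr 0 = 1" "?q \<zeta> powr 0 = 1" "?X \<zeta> powr 1 = ?X \<zeta>" for \<zeta> using pos[of \<zeta>] by auto
    have e1: "s - 1 - 1 = s - 2" "s - 1 - 2 = s - 3" "1 - 1 = (0::real)" by auto
    show ?thesis
      using C2_laplacian_lincomb[OF C2_laplacian_reg_mono[OF e, of "s - 1" 1] C2_laplacian_reg_mono[OF e, of s 0], of a]
      by (simp only: reg_mono_def p0 e1) (simp add: algebra_simps)
  qed
  have L: "?L \<zeta> \<ge> 0" for \<zeta>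
  proof -
    define x y X q where "x = (Re \<zeta>)\<^sup>2" and "y = (Im \<zeta>)\<^sup>2" and "X = ?X \<zeta>" and "q = ?q \<zeta>"
    have Xq: "X > 0" "q > 0" "x \<ge> 0" "y \<ge> 0" "x + y \<le> q"
      using pos[of \<zeta>] e by (auto simp: X_def q_def x_def y_def reg_abs_def)
    have q1: "q powr (s - 3) * q = q powr (s - 2)" "q powr (s - 2) * q = q powr (s - 1)"
      using Xq powr_mult_base[of q "s - 3"] powr_mult_base[of q "s - 2"] by (simp_all add: mult.commute)
    have "0 \<le> q + (s - 2) * (x + y)"
    proof -
      define w T where "w = x + y" and "T = (s - 2) * w"
      have "- 1 * w \<le> T" unfolding T_def using s Xq by (intro mult_right_mono) (auto simp: w_def)
      then have "0 \<le> q + T" using Xq(5) unfolding w_def[symmetric] by linarith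
      then show ?thesis by (simp only: T_def w_def)
    qed
    then have "0 \<le> 4 * (s - 1) * q powr (s - 3) * X * (q + (s - 2) * (x + y))"
      using s Xq by (intro mult_nonneg_nonneg) auto
    also have "\<dots> = 4 * (s - 1) * (q powr (s - 3) * q) * X + 4 * (s - 1) * (s - 2) * q powr (s - 3) * X * (x + y)"
      by (simp add: algebra_simps)
    finally have 1: "0 \<le> 4 * (s - 1) * q powr (s - 2) * X + 4 * (s - 1) * (s - 2) * q powr (s - 3) * X * (x + y)"
      unfolding q1 .
    have 2: "0 \<le> 8 * (s - 1) * q powr (s - 2) * x" using s Xq by (intro mult_nonneg_nonneg) auto
    have "a * (2 * q powr (s - 1)) \<le> a * (4 * (s - 1) * q powr (s - 2) * X + 2 * q powr (s - 1)
        + 8 * (s - 1) * q powr (s - 2) * x + 4 * (s - 1) * (s - 2) * q powr (s - 3) * X * (x + y))"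
      using a 1 2 by (intro mult_left_mono) auto
    moreover have "4 * (s * (s - 1)) * q powr (s - 2) * (x + y) \<le> 4 * (s * (s - 1)) * q powr (s - 2) * q"
      using s Xq by (intro mult_left_mono mult_nonneg_nonneg) auto
    moreover have "4 * (s * (s - 1)) * q powr (s - 2) * q = 4 * (s * (s - 1)) * q powr (s - 1)"
      using q1(2) by (simp add: mult.assoc)
    moreover have "a * (2 * q powr (s - 1)) = 4 * s * q powr (s - 1) + 4 * (s * (s - 1)) * q powr (s - 1)"
      by (simp add: a_def algebra_simps power2_eq_square)
    ultimately show ?thesis unfolding x_def y_def X_def q_def by linarith
  qed
  have up: "?\<Phi> \<zeta> \<le> C * ?X \<zeta> powr s - ?q \<zeta> powr s / 2" for \<zeta>
  proof -
    define X q where "X = ?X \<zeta>" and "q = ?q \<zeta>"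
    have Xq: "X > 0" "q > 0" using pos[of \<zeta>] by (auto simp: X_def q_def)
    have qs: "q powr (s - 1) * q = q powr s" "X powr (s - 1) * X = X powr s"
      using Xq powr_mult_base[of q "s - 1"] powr_mult_base[of X "s - 1"] by (simp_all add: mult.commute)
    have "a * (q powr (s - 1) * X) \<le> C * X powr s + q powr s / 2"
    proof (cases "a * X \<le> q / 2")
      case True
      then have "q powr (s - 1) * (a * X) \<le> q powr (s - 1) * (q / 2)" by (intro mult_left_mono) auto
      also have "\<dots> = q powr s / 2" using qs by simp
      finally have "q powr (s - 1) * (a * X) \<le> q powr s / 2" .
      moreover have "a * (q powr (s - 1) * X) = q powr (s - 1) * (a * X)" by (simp only: mult_ac)
      moreover have "0 \<le> C * X powr s" using C0 by simp
      ultimately show ?thesis by linarith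
    next
      case False
      then have "q \<le> 2 * a * X" by simp
      then have "q powr (s - 1) \<le> (2 * a * X) powr (s - 1)" using Xq s by (intro powr_mono2) auto
      also have "\<dots> = (2 * a) powr (s - 1) * X powr (s - 1)" using Xq a by (simp add: powr_mult)
      finally have "a * (q powr (s - 1) * X) \<le> a * ((2 * a) powr (s - 1) * X powr (s - 1) * X)"
        using Xq a by (intro mult_left_mono mult_right_mono) auto
      also have "\<dots> = C * X powr s" unfolding C_def qs[symmetric] by (simp add: mult_ac)
      finally show ?thesis using powr_ge_zero[of q s] by linarith
    qed
    then show ?thesis unfolding \<Phi> X_def q_def by linarith
  qed
  have cen: "?\<Phi> \<zeta> + ?\<Phi> (\<i> * \<zeta>) \<ge> 0" for \<zeta>
  proof -
    have q: "?q (\<i> * \<zeta>) = ?q \<zeta>" by (simp add: reg_abs_def)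
    have "2 * ?q \<zeta> \<le> a * (?X \<zeta> + ?X (\<i> * \<zeta>))"
      using a pos[of \<zeta>] e by (intro mult_mono) (auto simp: reg_abs_def reg_re_def)
    then have "?q \<zeta> powr (s - 1) * (2 * ?q \<zeta>) \<le> ?q \<zeta> powr (s - 1) * (a * (?X \<zeta> + ?X (\<i> * \<zeta>)))"
      by (intro mult_left_mono) auto
    moreover have "?q \<zeta> powr (s - 1) * ?q \<zeta> = ?q \<zeta> powr s"
      using pos(2)[of \<zeta>] powr_mult_base[of "?q \<zeta>" "s - 1"] by (simp add: mult.commute)
    ultimately show ?thesis unfolding \<Phi> q by (simp add: algebra_simps)
  qed
  have C: "2 * s\<^sup>2 * (4 * s\<^sup>2) powr (s - 1) = C" by (simp add: C_def a_def)
  show ?thesis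
    unfolding riesz_majorant_def C
    by (rule exI[of _ ?\<Phi>], intro conjI allI up cen, rule exI[of _ ?L]) (intro conjI allI C2 L)
qed

lemma riesz_majorant_exists:
  fixes s :: real
  assumes "s > 1/2"
  obtains C where "C \<ge> 0" "\<And>\<epsilon>. \<epsilon> > 0 \<Longrightarrow> \<exists>\<Phi>. riesz_majorant s C \<epsilon> \<Phi>"
proof (cases "s \<le> 1")
  case True
  with assms that[of "2 / (2 * s - 1)"] riesz_majorant_small_exponent[of s] show ?thesis by simp
next
  case False
  with that[of "2 * s\<^sup>2 * (4 * s\<^sup>2) powr (s - 1)"] riesz_majorant_large_exponent[of s] show ?thesis by simp
qed

section \<open>Truncation of Fourier series in \<open>L\<^sup>p\<close>\<close>

abbreviation taylor :: "(nat \<Rightarrow> complex) \<Rightarrow> complex \<Rightarrow> complex" where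
  "taylor c z \<equiv> (\<Sum>n. c n * z ^ n)"

abbreviation taylor_upto :: "nat \<Rightarrow> (nat \<Rightarrow> complex) \<Rightarrow> complex \<Rightarrow> complex" where
  "taylor_upto N c z \<equiv> (\<Sum>n\<le>N. c n * z ^ n)"

definition circle_lp :: "real \<Rightarrow> (complex \<Rightarrow> complex) \<Rightarrow> complex \<Rightarrow> real" where
  "circle_lp p F z = integral {-pi..pi} (\<lambda>\<theta>. cmod (F (cis \<theta> * z)) powr p)"

lemma power_series_holomorphic:
  assumes "\<And>z::complex. summable (\<lambda>n. c n * z ^ n)"
  shows "taylor c holomorphic_on UNIV"
  unfolding holomorphic_on_def field_differentiable_def
  using termdiffs_strong_converges_everywhere[OF assms] by fastforce

text \<open>
  On the unit circle \<open>z ^ (- N)\<close> times the series is \<open>cnj A + B\<close>, where \<open>A\<close> collects the conjugates of the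
  frequencies up to \<open>N\<close> and \<open>B\<close> the higher ones. Both are entire, and the truncated series has the
  modulus of \<open>A\<close>.
\<close>

lemma riesz_split:
  assumes c: "\<And>z::complex. summable (\<lambda>n. c n * z ^ n)"
  obtains A B where "A holomorphic_on UNIV" "B holomorphic_on UNIV" "B 0 = 0"
    "\<And>\<theta>. cmod (A (cis \<theta>)) = cmod (taylor_upto N c (cis \<theta>))"
    "\<And>\<theta>. cmod (cnj (A (cis \<theta>)) + B (cis \<theta>)) = cmod (taylor c (cis \<theta>))"
proof -
  define A where "A z = (\<Sum>n\<le>N. cnj (c n) * z ^ (N - n))" for z
  define B where "B z = z * (\<Sum>n. c (n + (N + 1)) * z ^ n)" for z
  have sB: "summable (\<lambda>n. c (n + (N + 1)) * z ^ n)" for z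
  proof (cases "z = 0")
    case False
    have "summable (\<lambda>n. c (n + (N + 1)) * z ^ (n + (N + 1)))"
      using c[of z] by (subst summable_iff_shift)
    then have "summable (\<lambda>n. c (n + (N + 1)) * z ^ (n + (N + 1)) / z ^ (N + 1))" by (rule summable_divide)
    then show ?thesis using False by (simp add: power_add)
  qed (use summable_0_powser in auto)
  have hA: "A holomorphic_on UNIV" unfolding A_def by (intro holomorphic_intros)
  have hB: "B holomorphic_on UNIV" unfolding B_def by (intro holomorphic_intros power_series_holomorphic sB)
  have pA: "cis \<theta> ^ N * cnj (A (cis \<theta>)) = taylor_upto N c (cis \<theta>)" for \<theta>
  proof -
    have "cis \<theta> ^ N * cnj (cis \<theta>) ^ (N - n) = cis \<theta> ^ n" if "n \<le> N" for n
    proof -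
      have "cis \<theta> ^ N = cis \<theta> ^ n * cis \<theta> ^ (N - n)" using that by (simp flip: power_add)
      moreover have "cis \<theta> ^ (N - n) * cnj (cis \<theta>) ^ (N - n) = 1"
        by (simp flip: power_mult_distrib add: cis_cnj cis_mult)
      ultimately show ?thesis by (simp add: mult.assoc)
    qed
    then have *: "cis \<theta> ^ N * (c n * cnj (cis \<theta>) ^ (N - n)) = c n * cis \<theta> ^ n" if "n \<le> N" for n
      using that by (simp add: mult.left_commute)
    show ?thesis unfolding A_def by (simp add: sum_distrib_left del: cis_cnj) (intro sum.cong refl, use * in auto)
  qed
  have pB: "cis \<theta> ^ N * B (cis \<theta>) = (\<Sum>n. c (n + (N + 1)) * cis \<theta> ^ (n + (N + 1)))" for \<theta>
  proof -
    have "cis \<theta> ^ N * B (cis \<theta>) = cis \<theta> ^ (N + 1) * (\<Sum>n. c (n + (N + 1)) * cis \<theta> ^ n)"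
      by (simp add: B_def mult_ac)
    also have "\<dots> = (\<Sum>n. cis \<theta> ^ (N + 1) * (c (n + (N + 1)) * cis \<theta> ^ n))"
      by (rule suminf_mult[OF sB, symmetric])
    also have "\<dots> = (\<Sum>n. c (n + (N + 1)) * cis \<theta> ^ (n + (N + 1)))"
      by (intro suminf_cong) (simp add: power_add mult_ac)
    finally show ?thesis .
  qed
  have sum: "cis \<theta> ^ N * (cnj (A (cis \<theta>)) + B (cis \<theta>)) = taylor c (cis \<theta>)" for \<theta>
    unfolding distrib_left pA pB
    using suminf_split_initial_segment[OF c[of "cis \<theta>"], of "N + 1"] by (simp add: lessThan_Suc_atMost add.commute)
  show ?thesis
  proof (rule that[OF hA hB])
    show "B 0 = 0" by (simp add: B_def)
    show "cmod (A (cis \<theta>)) = cmod (taylor_upto N c (cis \<theta>))" for \<theta>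
      using arg_cong[OF pA[of \<theta>], of cmod] by (simp add: norm_mult norm_power)
    show "cmod (cnj (A (cis \<theta>)) + B (cis \<theta>)) = cmod (taylor c (cis \<theta>))" for \<theta>
      using arg_cong[OF sum[of \<theta>], of cmod] by (simp add: norm_mult norm_power)
  qed
qed

text \<open>
  Let \<open>h = cnj A + B\<close> be the splitting above. The entire functions \<open>A + B\<close> and \<open>\<i> * (A - B)\<close> have the real
  parts \<open>Re h\<close> and \<open>Im h\<close> on the unit circle, and together they determine \<open>A\<close>. A majorant bounds their
  \<open>L\<^sup>p\<close> means by those of their real parts, hence of \<open>|h|\<close>, which is the modulus of the full series.
  The regularisation tends to zero at the end; other circles are reached by rescaling the coefficients.
\<close>

theorem riesz_truncation:
  fixes p :: real
  assumes p: "p > 1"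
  obtains C where "C \<ge> 0" "\<And>c N z. (\<And>z. summable (\<lambda>n. c n * z ^ n)) \<Longrightarrow>
    circle_lp p (taylor_upto N c) z \<le> C * circle_lp p (taylor c) z"
proof -
  define s where "s = p / 2"
  have s: "s > 1/2" "s > 0" using p by (auto simp: s_def)
  obtain C where C: "C \<ge> 0" and maj: "\<And>\<epsilon>. \<epsilon> > 0 \<Longrightarrow> \<exists>\<Phi>. riesz_majorant s C \<epsilon> \<Phi>"
    using riesz_majorant_exists[OF s(1)] by blast
  define D where "D = 4 * C * 2 powr s"
  have D: "D \<ge> 0" using C by (simp add: D_def)
  have "integral {-pi..pi} (\<lambda>\<theta>. cmod (taylor_upto N c (cis \<theta>)) powr p)
      \<le> D * integral {-pi..pi} (\<lambda>\<theta>. cmod (taylor c (cis \<theta>)) powr p)"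
    if c: "\<And>z::complex. summable (\<lambda>n. c n * z ^ n)" for c N
  proof -
    obtain A B where AB: "A holomorphic_on UNIV" "B holomorphic_on UNIV" "B 0 = 0"
      and P: "\<And>\<theta>. cmod (A (cis \<theta>)) = cmod (taylor_upto N c (cis \<theta>))"
      and H: "\<And>\<theta>. cmod (cnj (A (cis \<theta>)) + B (cis \<theta>)) = cmod (taylor c (cis \<theta>))"
      using riesz_split[OF c, of N] by blast
    define F1 F2 where "F1 z = A z + B z" and "F2 z = \<i> * (A z - B z)" for z
    have F: "F1 holomorphic_on UNIV" "F2 holomorphic_on UNIV"
      unfolding F1_def F2_def by (intro holomorphic_intros AB)+
    define h where "h \<theta> = cnj (A (cis \<theta>)) + B (cis \<theta>)" for \<theta>
    have cA: "continuous_on UNIV A" "continuous_on UNIV B"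
      using AB by (auto intro: holomorphic_on_imp_continuous_on)
    have ccis: "continuous_on T (\<lambda>\<theta>. G (cis \<theta>))" if "continuous_on UNIV G" for T and G :: "complex \<Rightarrow> 'b::topological_space"
      by (rule continuous_on_compose2[OF that]) (auto intro!: continuous_intros)
    have ch: "continuous_on T h" for T unfolding h_def by (intro continuous_intros ccis cA)
    define IP IH where "IP = integral {-pi..pi} (\<lambda>\<theta>. cmod (A (cis \<theta>)) powr p)" and "IH = integral {-pi..pi} (\<lambda>\<theta>. cmod (h \<theta>) powr p)"
    have iP: "((\<lambda>\<theta>. cmod (A (cis \<theta>)) powr p) has_integral IP) {-pi..pi}"
      unfolding IP_def by (intro integrable_integral integrable_continuous_interval continuous_on_powr' continuous_intros ccis cA) (use p in auto)
    have iH: "((\<lambda>\<theta>. cmod (h \<theta>) powr p) has_integral IH) {-pi..pi}"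
      unfolding IH_def by (intro integrable_integral integrable_continuous_interval continuous_on_powr' continuous_intros ch) (use p in auto)
    have key: "IP \<le> D * IH + D * (2 * pi) * \<delta>" if "\<delta> > 0" for \<delta>
    proof -
      \<comment> \<open>Chosen such that the regularisation costs exactly a multiple of \<open>\<delta>\<close>.\<close>
      define \<epsilon> where "\<epsilon> = \<delta> powr (1 / s)"
      have e: "\<epsilon> > 0" using that by (simp add: \<epsilon>_def)
      have es: "\<epsilon> powr s = \<delta>" using that s by (simp add: \<epsilon>_def powr_powr)
      obtain \<Phi> L where \<Phi>: "C2_laplacian \<Phi> L" "\<And>\<zeta>. L \<zeta> \<ge> 0" 
          "\<And>\<zeta>. \<Phi> \<zeta> \<le> C * reg_re \<epsilon> \<zeta> powr s - reg_abs \<epsilon> \<zeta> powr s / 2" "\<And>\<zeta>. \<Phi> \<zeta> + \<Phi> (\<i> * \<zeta>) \<ge> 0"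
        using maj[OF e] unfolding riesz_majorant_def by blast
      have c\<Phi>: "continuous_on UNIV \<Phi>" by (rule C2_laplacian_continuous[OF \<Phi>(1)])
      have i\<Phi>: "((\<lambda>\<theta>. \<Phi> (G (cis \<theta>))) has_integral integral {-pi..pi} (\<lambda>\<theta>. \<Phi> (G (cis \<theta>)))) {-pi..pi}"
        if "G holomorphic_on UNIV" for G
        by (intro integrable_integral integrable_continuous_interval ccis continuous_on_compose2[OF c\<Phi> holomorphic_on_imp_continuous_on[OF that]]) auto
      \<comment> \<open>This is where \<open>B 0 = 0\<close> enters: the centre values are \<open>\<zeta>\<close> and \<open>\<i> * \<zeta>\<close>.\<close>
      have "F2 0 = \<i> * F1 0" by (simp add: F1_def F2_def AB(3))
      then have "0 \<le> 2 * pi * (\<Phi> (F1 0) + \<Phi> (F2 0))" using \<Phi>(4)[of "F1 0"] by simp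
      also have "\<dots> \<le> integral {-pi..pi} (\<lambda>\<theta>. \<Phi> (F1 (cis \<theta>))) + integral {-pi..pi} (\<lambda>\<theta>. \<Phi> (F2 (cis \<theta>)))"
        unfolding distrib_left by (intro add_mono C2_laplacian_circle_mean[OF \<Phi>(1,2)] F)
      finally have pos: "0 \<le> integral {-pi..pi} (\<lambda>\<theta>. \<Phi> (F1 (cis \<theta>))) + integral {-pi..pi} (\<lambda>\<theta>. \<Phi> (F2 (cis \<theta>)))" .
      have pw: "cmod (A (cis \<theta>)) powr p + 2 * (\<Phi> (F1 (cis \<theta>)) + \<Phi> (F2 (cis \<theta>))) \<le> D * cmod (h \<theta>) powr p + D * \<delta>" for \<theta>
      proof -
        define w where "w = cis \<theta>"
        have re: "Re (F1 w) = Re (h \<theta>)" "Re (F2 w) = Im (h \<theta>)"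
          by (simp_all add: F1_def F2_def h_def w_def)
        have nz: "cmod z powr p = ((cmod z)\<^sup>2) powr s" for z
          by (cases "z = 0") (simp_all add: s_def powr_powr flip: powr_numeral)
        have X: "reg_re \<epsilon> (F1 w) powr s \<le> 2 powr s * (cmod (h \<theta>) powr p + \<delta>)" "reg_re \<epsilon> (F2 w) powr s \<le> 2 powr s * (cmod (h \<theta>) powr p + \<delta>)"
        proof -
          have 1: "((cmod (h \<theta>))\<^sup>2 + \<epsilon>) powr s \<le> 2 powr s * (cmod (h \<theta>) powr p + \<delta>)"
            unfolding nz es[symmetric] using s e by (intro add_powr_le) auto
          have 2: "(x + \<epsilon>) powr s \<le> ((cmod (h \<theta>))\<^sup>2 + \<epsilon>) powr s" if "x \<le> (cmod (h \<theta>))\<^sup>2" "x \<ge> 0" for x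
            using s e that by (intro powr_mono2) auto
          show "reg_re \<epsilon> (F1 w) powr s \<le> 2 powr s * (cmod (h \<theta>) powr p + \<delta>)" "reg_re \<epsilon> (F2 w) powr s \<le> 2 powr s * (cmod (h \<theta>) powr p + \<delta>)"
            unfolding reg_re_def re by (rule order.trans[OF 2 1]; simp add: cmod_power2)+
        qed
        have q: "cmod z powr p \<le> reg_abs \<epsilon> z powr s" for z
          unfolding nz reg_abs_def cmod_power2 using s e by (intro powr_mono2) auto
        have "2 * A w = F1 w - \<i> * F2 w" by (simp add: F1_def F2_def algebra_simps)
        then have "2 * cmod (A w) \<le> cmod (F1 w) + cmod (F2 w)"
          using norm_triangle_ineq4[of "F1 w" "\<i> * F2 w"] by (metis norm_mult norm_numeral mult_1 norm_ii)
        then have "cmod (A w) \<le> max (cmod (F1 w)) (cmod (F2 w))" by linarith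
        then have "cmod (A w) powr p \<le> (max (cmod (F1 w)) (cmod (F2 w))) powr p" using p by (intro powr_mono2) auto
        also have "\<dots> \<le> cmod (F1 w) powr p + cmod (F2 w) powr p" by (simp add: max_def)
        also have "\<dots> \<le> reg_abs \<epsilon> (F1 w) powr s + reg_abs \<epsilon> (F2 w) powr s" by (intro add_mono q)
        also have "\<dots> \<le> 2 * (C * reg_re \<epsilon> (F1 w) powr s - \<Phi> (F1 w)) + 2 * (C * reg_re \<epsilon> (F2 w) powr s - \<Phi> (F2 w))"
        proof -
          have "y \<le> 2 * (a - b)" if "b \<le> a - y / 2" for a b y :: real using that by simp
          then show ?thesis by (intro add_mono) (use \<Phi>(3) in blast)+
        qed
        finally have "cmod (A w) powr p + 2 * (\<Phi> (F1 w) + \<Phi> (F2 w)) \<le> 2 * (C * reg_re \<epsilon> (F1 w) powr s) + 2 * (C * reg_re \<epsilon> (F2 w) powr s)"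
          by (simp add: algebra_simps)
        also have "\<dots> \<le> 2 * (C * (2 powr s * (cmod (h \<theta>) powr p + \<delta>))) + 2 * (C * (2 powr s * (cmod (h \<theta>) powr p + \<delta>)))"
          using X C by (intro add_mono mult_left_mono) auto
        also have "\<dots> = D * cmod (h \<theta>) powr p + D * \<delta>" by (simp add: D_def algebra_simps)
        finally show ?thesis by (simp only: w_def)
      qed
      have "IP + 2 * (integral {-pi..pi} (\<lambda>\<theta>. \<Phi> (F1 (cis \<theta>))) + integral {-pi..pi} (\<lambda>\<theta>. \<Phi> (F2 (cis \<theta>)))) 
          \<le> D * IH + (pi - (-pi)) * (D * \<delta>)"
      proof (rule has_integral_le[OF _ _ pw])
        show "((\<lambda>\<theta>. cmod (A (cis \<theta>)) powr p + 2 * (\<Phi> (F1 (cis \<theta>)) + \<Phi> (F2 (cis \<theta>)))) has_integral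
           IP + 2 * (integral {-pi..pi} (\<lambda>\<theta>. \<Phi> (F1 (cis \<theta>))) + integral {-pi..pi} (\<lambda>\<theta>. \<Phi> (F2 (cis \<theta>))))) {-pi..pi}"
          by (intro has_integral_add has_integral_mult_right iP i\<Phi> F)
        have "((\<lambda>\<theta>. D * \<delta>) has_integral (pi - (-pi)) * (D * \<delta>)) {-pi..pi}"
          using has_integral_const_real[of "D * \<delta>" "-pi" pi] by simp
        then show "((\<lambda>\<theta>. D * cmod (h \<theta>) powr p + D * \<delta>) has_integral D * IH + (pi - (-pi)) * (D * \<delta>)) {-pi..pi}"
          by (intro has_integral_add has_integral_mult_right iH)
      qed
      then show ?thesis using pos by (simp add: algebra_simps)
    qed
    have "IP \<le> D * IH"
    proof (rule field_le_epsilon)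
      fix e :: real assume e: "e > 0"
      define \<delta> where "\<delta> = e / (D * (2 * pi) + 1)"
      have pos: "D * (2 * pi) + 1 > 0" using D by (intro add_nonneg_pos) auto
      have "D * (2 * pi) * \<delta> \<le> (D * (2 * pi) + 1) * \<delta>" using e pos by (intro mult_right_mono) (auto simp: \<delta>_def)
      also have "\<dots> = e" using pos by (simp add: \<delta>_def)
      finally show "IP \<le> D * IH + e" using key[of \<delta>] e pos by (simp add: \<delta>_def)
    qed
    then show ?thesis unfolding IP_def IH_def h_def P H .
  qed
  note unit_circle = this
  have "circle_lp p (taylor_upto N c) z \<le> D * circle_lp p (taylor c) z" if c: "\<And>z. summable (\<lambda>n. c n * z ^ n)" for c N z
  proof -
    have "summable (\<lambda>n. (c n * z ^ n) * w ^ n)" for w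
      using c[of "z * w"] by (simp add: power_mult_distrib mult.assoc)
    from unit_circle[OF this, of N] show ?thesis
      by (simp add: circle_lp_def power_mult_distrib mult_ac)
  qed
  with that[of D] D show ?thesis by blast
qed

section \<open>Averaging over rotations\<close>

lemma bargmann_point_measurable [measurable]: "bargmann_point \<in> borel_measurable borel"
proof -
  have "bargmann_point = (\<lambda>z. of_real (fst z) - \<i> * of_real (snd z))"
    by (auto simp: bargmann_point_def complex_eq_iff)
  moreover have "(\<lambda>z. complex_of_real (fst z) - \<i> * complex_of_real (snd z)) \<in> borel_measurable borel"
    by (intro borel_measurable_continuous_onI continuous_intros)
  ultimately show ?thesis by (simp only:)
qed

lemma nn_integral_shear:
  fixes f :: "real \<times> real \<Rightarrow> ennreal"
  assumes [measurable]: "f \<in> borel_measurable borel"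
  shows "(\<integral>\<^sup>+z. f (fst z + a * snd z, snd z) \<partial>lborel) = (\<integral>\<^sup>+z. f z \<partial>lborel)"
    and "(\<integral>\<^sup>+z. f (fst z, snd z + a * fst z) \<partial>lborel) = (\<integral>\<^sup>+z. f z \<partial>lborel)"
proof -
  have fc: "(\<lambda>x. f (h x)) \<in> borel_measurable borel" if "continuous_on UNIV h" for h :: "'x::topological_space \<Rightarrow> real \<times> real"
    by (rule measurable_compose[OF borel_measurable_continuous_onI[OF that] assms])
  have m: "f \<in> borel_measurable (lborel \<Otimes>\<^sub>M lborel)" using assms by (simp add: lborel_prod)
  have m1: "(\<lambda>z. f (fst z + a * snd z, snd z)) \<in> borel_measurable (lborel \<Otimes>\<^sub>M lborel)"
    using fc[of "\<lambda>z. (fst z + a * snd z, snd z)"] by (simp add: lborel_prod continuous_intros)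
  have m2: "(\<lambda>z. f (fst z, snd z + a * fst z)) \<in> borel_measurable (lborel \<Otimes>\<^sub>M lborel)"
    using fc[of "\<lambda>z. (fst z, snd z + a * fst z)"] by (simp add: lborel_prod continuous_intros)
  have tr: "(\<integral>\<^sup>+x. h (x + t) \<partial>lborel) = (\<integral>\<^sup>+x. h x \<partial>lborel)" if "h \<in> borel_measurable borel" for h :: "real \<Rightarrow> ennreal" and t
    using nn_integral_real_affine[OF that, of 1 t] by (simp add: add.commute)
  have "(\<integral>\<^sup>+z. f (fst z + a * snd z, snd z) \<partial>(lborel \<Otimes>\<^sub>M lborel)) = (\<integral>\<^sup>+y. \<integral>\<^sup>+x. f (x + a * y, y) \<partial>lborel \<partial>lborel)"
    using lborel_pair.nn_integral_snd[OF m1] by simp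
  also have "\<dots> = (\<integral>\<^sup>+y. \<integral>\<^sup>+x. f (x, y) \<partial>lborel \<partial>lborel)"
    by (intro nn_integral_cong tr fc continuous_intros)
  also have "\<dots> = (\<integral>\<^sup>+z. f z \<partial>(lborel \<Otimes>\<^sub>M lborel))"
    using lborel_pair.nn_integral_snd[OF m] by simp
  finally show "(\<integral>\<^sup>+z. f (fst z + a * snd z, snd z) \<partial>lborel) = (\<integral>\<^sup>+z. f z \<partial>lborel)"
    by (simp add: lborel_prod)
  have "(\<integral>\<^sup>+z. f (fst z, snd z + a * fst z) \<partial>(lborel \<Otimes>\<^sub>M lborel)) = (\<integral>\<^sup>+x. \<integral>\<^sup>+y. f (x, y + a * x) \<partial>lborel \<partial>lborel)"
    using lborel.nn_integral_fst[OF m2] by simp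
  also have "\<dots> = (\<integral>\<^sup>+x. \<integral>\<^sup>+y. f (x, y) \<partial>lborel \<partial>lborel)"
    by (intro nn_integral_cong tr fc continuous_intros)
  also have "\<dots> = (\<integral>\<^sup>+z. f z \<partial>(lborel \<Otimes>\<^sub>M lborel))"
    using lborel.nn_integral_fst[OF m] by simp
  finally show "(\<integral>\<^sup>+z. f (fst z, snd z + a * fst z) \<partial>lborel) = (\<integral>\<^sup>+z. f z \<partial>lborel)"
    by (simp add: lborel_prod)
qed

text \<open>
  A rotation with \<open>sin \<theta> \<noteq> 0\<close> is a product of three shears, and shears preserve Lebesgue measure by
  Fubini's theorem and translation invariance. Otherwise split off a quarter turn.
\<close>

lemma nn_integral_rotate:
  fixes g :: "complex \<Rightarrow> ennreal"
  assumes g[measurable]: "g \<in> borel_measurable borel"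
  shows "(\<integral>\<^sup>+z. g (cis \<theta> * bargmann_point z) \<partial>lborel) = (\<integral>\<^sup>+z. g (bargmann_point z) \<partial>lborel)"
proof -
  have rot: "(\<integral>\<^sup>+z. g (cis \<theta> * bargmann_point z) \<partial>lborel) = (\<integral>\<^sup>+z. g (bargmann_point z) \<partial>lborel)"
    if s: "sin \<theta> \<noteq> 0" and g[measurable]: "g \<in> borel_measurable borel" for \<theta> and g :: "complex \<Rightarrow> ennreal"
  proof -
    have gc: "(\<lambda>z. g (bargmann_point (h z))) \<in> borel_measurable borel" if "continuous_on UNIV h" for h :: "real \<times> real \<Rightarrow> real \<times> real"
      by (rule measurable_compose[OF measurable_compose[OF borel_measurable_continuous_onI[OF that] bargmann_point_measurable] g])
    \<comment> \<open>The slope of the outer shears is the tangent of half the angle.\<close>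
    define a where "a = (1 - cos \<theta>) / sin \<theta>"
    define b where "b = - sin \<theta>"
    have ab: "a * b = cos \<theta> - 1" using s by (simp add: a_def b_def)
    have a2: "a * (1 + cos \<theta>) = sin \<theta>"
      using s sin_squared_eq[of \<theta>] by (simp add: a_def field_simps power2_eq_square)
    define S1 where "S1 z = (fst z + a * snd z, snd z :: real)" for z
    define S2 where "S2 z = (fst z :: real, snd z + b * fst z)" for z
    have "cis \<theta> * bargmann_point z = bargmann_point (S1 (S2 (S1 z)))" for z
    proof -
      obtain x y where z: "z = (x, y)" by (cases z)
      have 1: "y + b * (x + a * y) = - sin \<theta> * x + cos \<theta> * y"
      proof -
        have "y + b * (x + a * y) = (1 + a * b) * y + b * x" by (simp add: algebra_simps)
        then show ?thesis unfolding ab by (simp add: b_def)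
      qed
      have "x + a * y + a * (- sin \<theta> * x + cos \<theta> * y) = (1 + a * b) * x + (a * (1 + cos \<theta>)) * y"
        by (simp add: b_def algebra_simps)
      then have 2: "x + a * y + a * (- sin \<theta> * x + cos \<theta> * y) = cos \<theta> * x + sin \<theta> * y"
        unfolding ab a2 by simp
      show ?thesis unfolding z S1_def S2_def fst_conv snd_conv 1 2 by (simp add: bargmann_point_def complex_eq_iff algebra_simps)
    qed
    moreover have "(\<integral>\<^sup>+z. g (bargmann_point (S1 (S2 (S1 z)))) \<partial>lborel) = (\<integral>\<^sup>+z. g (bargmann_point (S1 (S2 z))) \<partial>lborel)"
      unfolding S1_def S2_def fst_conv snd_conv by (rule nn_integral_shear(1)[of "\<lambda>z. g (bargmann_point (fst z + a * (snd z + b * fst z), snd z + b * fst z))" a, unfolded fst_conv snd_conv]) (intro gc continuous_intros)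
    moreover have "\<dots> = (\<integral>\<^sup>+z. g (bargmann_point (S1 z)) \<partial>lborel)"
      unfolding S1_def S2_def fst_conv snd_conv by (rule nn_integral_shear(2)[of "\<lambda>z. g (bargmann_point (fst z + a * snd z, snd z))" b, unfolded fst_conv snd_conv]) (intro gc continuous_intros)
    moreover have "\<dots> = (\<integral>\<^sup>+z. g (bargmann_point z) \<partial>lborel)"
      unfolding S1_def fst_conv snd_conv by (rule nn_integral_shear(1)[of "\<lambda>z. g (bargmann_point z)" a]) (intro gc continuous_intros)
    ultimately show ?thesis by simp
  qed
  show ?thesis
  proof (cases "sin \<theta> = 0")
    case False
    then show ?thesis by (rule rot[OF _ g])
  next
    case True
    have c: "cis \<theta> = cis (pi/2) * cis (\<theta> - pi/2)" by (simp only: cis_mult) simp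
    have "cos \<theta> \<noteq> 0" using True sin_cos_squared_add[of \<theta>] by auto
    then have s: "sin (\<theta> - pi/2) \<noteq> 0" by (simp add: sin_diff)
    have m: "(\<lambda>w. g (cis (pi/2) * w)) \<in> borel_measurable borel" by measurable
    have "(\<integral>\<^sup>+z. g (cis \<theta> * bargmann_point z) \<partial>lborel) = (\<integral>\<^sup>+z. g (cis (pi/2) * (cis (\<theta> - pi/2) * bargmann_point z)) \<partial>lborel)"
      unfolding c by (simp add: mult.assoc)
    also have "\<dots> = (\<integral>\<^sup>+z. g (cis (pi/2) * bargmann_point z) \<partial>lborel)" by (rule rot[OF s m])
    also have "\<dots> = (\<integral>\<^sup>+z. g (bargmann_point z) \<partial>lborel)" by (rule rot[OF _ g]) simp
    finally show ?thesis .
  qed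
qed

text \<open>
  Averaging over rotations takes the place of polar coordinates.
\<close>

lemma nn_integral_circle_average:
  fixes g :: "complex \<Rightarrow> ennreal"
  assumes g[measurable]: "g \<in> borel_measurable borel" and ab: "a \<le> b"
  shows "(\<integral>\<^sup>+z. (\<integral>\<^sup>+\<theta>. g (cis \<theta> * bargmann_point z) * indicator {a..b} \<theta> \<partial>lborel) \<partial>lborel)
    = ennreal (b - a) * (\<integral>\<^sup>+z. g (bargmann_point z) \<partial>lborel)"
proof -
  have [measurable]: "cis \<in> borel_measurable borel"
    by (intro borel_measurable_continuous_onI continuous_intros)
  have P: "pair_sigma_finite (lborel :: (real \<times> real) measure) (lborel :: real measure)"
    by (simp add: pair_sigma_finite_def lborel.sigma_finite_measure_axioms)
  have "(\<integral>\<^sup>+z. (\<integral>\<^sup>+\<theta>. g (cis \<theta> * bargmann_point z) * indicator {a..b} \<theta> \<partial>lborel) \<partial>lborel)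
     = (\<integral>\<^sup>+\<theta>. (\<integral>\<^sup>+z. g (cis \<theta> * bargmann_point z) * indicator {a..b} \<theta> \<partial>lborel) \<partial>lborel)"
    by (rule pair_sigma_finite.Fubini'[OF P, symmetric]) (unfold split_beta, measurable)
  also have "\<dots> = (\<integral>\<^sup>+\<theta>. (\<integral>\<^sup>+z. g (bargmann_point z) \<partial>lborel) * indicator {a..b} \<theta> \<partial>lborel)"
    by (intro nn_integral_cong) (simp add: nn_integral_multc nn_integral_rotate[OF g])
  also have "\<dots> = ennreal (b - a) * (\<integral>\<^sup>+z. g (bargmann_point z) \<partial>lborel)"
    using ab by (subst nn_integral_cmult_indicator) (auto simp: mult.commute)
  finally show ?thesis .
qed

definition fock_abs :: "(complex \<Rightarrow> complex) \<Rightarrow> complex \<Rightarrow> real" where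
  "fock_abs F \<zeta> = cmod (F \<zeta>) * exp (- pi / 2 * (cmod \<zeta>)\<^sup>2)"

text \<open>
  For the Bargmann transform \<open>F\<close> of \<open>f\<close> this is the \<open>q\<close>-th power of the norm of \<open>f\<close> in \<open>M\<^sup>q\<close>.
\<close>

definition fock_int :: "real \<Rightarrow> (complex \<Rightarrow> complex) \<Rightarrow> ennreal" where
  "fock_int q F = (\<integral>\<^sup>+z. ennreal (fock_abs F (bargmann_point z) powr q) \<partial>lborel)"

lemma fock_abs_nonneg: "fock_abs F \<zeta> \<ge> 0" by (simp add: fock_abs_def)

lemma fock_abs_measurable: 
  assumes "continuous_on UNIV F" shows "fock_abs F \<in> borel_measurable borel"
  unfolding fock_abs_def[abs_def] using assms by (intro borel_measurable_continuous_onI continuous_intros)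

lemma circle_lp_nonneg: "circle_lp p F z \<ge> 0"
  unfolding circle_lp_def by (cases "(\<lambda>\<theta>. cmod (F (cis \<theta> * z)) powr p) integrable_on {-pi..pi}")
    (auto intro: integral_nonneg simp: not_integrable_integral)

lemma circle_lp_integrable:
  assumes F: "continuous_on UNIV F" and q: "q > 0"
  shows "(\<lambda>\<theta>. cmod (F (cis \<theta> * z)) powr q) integrable_on {-pi..pi}"
  by (intro integrable_continuous_interval continuous_on_powr' continuous_intros continuous_on_compose2[OF F])
     (use q in auto)

lemma circle_lp_measurable:
  assumes F: "continuous_on UNIV F" and q: "q > 0"
  shows "(\<lambda>z. ennreal (exp (- pi / 2 * (norm z)\<^sup>2) powr q * circle_lp q F (bargmann_point z))) \<in> borel_measurable borel"
proof -
  have cb: "continuous_on UNIV bargmann_point"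
    by (auto simp: bargmann_point_def[abs_def] Complex_eq intro!: continuous_intros)
  have "continuous_on (UNIV \<times> cbox (-pi) pi) (\<lambda>(z, \<theta>). cmod (F (cis \<theta> * bargmann_point z)) powr q)"
    unfolding split_beta
    by (intro continuous_on_powr' continuous_intros continuous_on_compose2[OF F] continuous_on_compose2[OF cb]) (use q in auto)
  from integral_continuous_on_param[OF this] have "continuous_on UNIV (\<lambda>z. circle_lp q F (bargmann_point z))"
    by (simp add: circle_lp_def)
  then show ?thesis
    by (intro borel_measurable_continuous_onI continuous_on_ennreal continuous_intros) auto
qed

lemma fock_int_circle:
  assumes F: "continuous_on UNIV F" and q: "q > 0"
  shows "ennreal (2 * pi) * fock_int q F =
    (\<integral>\<^sup>+z. ennreal (exp (- pi / 2 * (norm z)\<^sup>2) powr q * circle_lp q F (bargmann_point z)) \<partial>lborel)"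
proof -
  have [measurable]: "fock_abs F \<in> borel_measurable borel" by (rule fock_abs_measurable[OF F])
  have "(\<integral>\<^sup>+\<theta>. ennreal (fock_abs F (cis \<theta> * bargmann_point z) powr q) * indicator {-pi..pi} \<theta> \<partial>lborel)
      = ennreal (exp (- pi / 2 * (norm z)\<^sup>2) powr q * circle_lp q F (bargmann_point z))" for z
  proof (rule nn_integral_has_integral_lebesgue')
    show "((\<lambda>\<theta>. fock_abs F (cis \<theta> * bargmann_point z) powr q) has_integral
        exp (- pi / 2 * (norm z)\<^sup>2) powr q * circle_lp q F (bargmann_point z)) {-pi..pi}"
    proof -
      have "fock_abs F (cis \<theta> * bargmann_point z) powr q = exp (- pi / 2 * (norm z)\<^sup>2) powr q * cmod (F (cis \<theta> * bargmann_point z)) powr q" for \<theta>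
        by (simp add: fock_abs_def norm_mult powr_mult)
      then show ?thesis
        unfolding circle_lp_def by (simp only:) (intro has_integral_mult_right integrable_integral circle_lp_integrable F q)
    qed
  qed simp
  then show ?thesis
    using nn_integral_circle_average[of "\<lambda>\<zeta>. ennreal (fock_abs F \<zeta> powr q)" "-pi" pi]
    by (simp add: fock_int_def)
qed

lemma taylor_continuous:
  assumes "\<And>z. summable (\<lambda>n. c n * z ^ n)"
  shows "continuous_on UNIV (taylor c)"
  by (intro holomorphic_on_imp_continuous_on power_series_holomorphic assms)

text \<open>
  The weight is radial, so an inequality between means over all circles integrates to one between the
  weighted norms.
\<close>

lemma fock_int_mono_circle:
  assumes F: "continuous_on UNIV F" and G: "continuous_on UNIV G" and q: "q > 0" and C: "C \<ge> 0"
    and le: "\<And>z. circle_lp q G z \<le> C * circle_lp q F z"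
  shows "fock_int q G \<le> ennreal C * fock_int q F"
proof -
  let ?e = "\<lambda>z::real \<times> real. exp (- pi / 2 * (norm z)\<^sup>2) powr q"
  have "ennreal (2 * pi) * fock_int q G = (\<integral>\<^sup>+z. ennreal (?e z * circle_lp q G (bargmann_point z)) \<partial>lborel)"
    by (rule fock_int_circle[OF G q])
  also have "\<dots> \<le> (\<integral>\<^sup>+z. ennreal C * ennreal (?e z * circle_lp q F (bargmann_point z)) \<partial>lborel)"
  proof (rule nn_integral_mono)
    fix z
    have "?e z * circle_lp q G (bargmann_point z) \<le> ?e z * (C * circle_lp q F (bargmann_point z))" by (intro mult_left_mono le) simp
    then show "ennreal (?e z * circle_lp q G (bargmann_point z)) \<le> ennreal C * ennreal (?e z * circle_lp q F (bargmann_point z))"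
      unfolding ennreal_mult'[OF C, symmetric] by (intro ennreal_leI) (simp add: mult_ac)
  qed
  also have "\<dots> = ennreal C * (\<integral>\<^sup>+z. ennreal (?e z * circle_lp q F (bargmann_point z)) \<partial>lborel)"
    using circle_lp_measurable[OF F q] by (intro nn_integral_cmult) simp
  also have "\<dots> = ennreal (2 * pi) * (ennreal C * fock_int q F)"
    by (subst fock_int_circle[OF F q, symmetric]) (simp add: mult_ac)
  finally show ?thesis
    by (subst (asm) ennreal_mult_le_mult_iff) auto
qed

theorem fock_truncation_bound:
  fixes p :: real
  assumes p: "p > 1"
  obtains C where "C \<ge> 0" "\<And>c N. (\<And>z. summable (\<lambda>n. c n * z ^ n)) \<Longrightarrow>
    fock_int p (taylor_upto N c) \<le> ennreal C * fock_int p (taylor c)"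
proof -
  obtain C where C: "C \<ge> 0" and riesz: "\<And>c N z. (\<And>z. summable (\<lambda>n. c n * z ^ n)) \<Longrightarrow>
    circle_lp p (taylor_upto N c) z \<le> C * circle_lp p (taylor c) z"
    using riesz_truncation[OF p] by blast
  have "fock_int p (taylor_upto N c) \<le> ennreal C * fock_int p (taylor c)" if c: "\<And>z. summable (\<lambda>n. c n * z ^ n)" for c N
    by (rule fock_int_mono_circle[OF taylor_continuous[OF c] _ _ C riesz[OF c]]) (use p in \<open>auto intro!: continuous_intros\<close>)
  with C that show ?thesis by blast
qed

section \<open>Convergence of Taylor polynomials in weighted norms\<close>

lemma entire_series_abs_summable:
  assumes "\<And>z::complex. summable (\<lambda>n. c n * z ^ n)"
  shows "summable (\<lambda>n. cmod (c n * z ^ n))"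
  by (rule powser_insidea[OF assms[of "of_real (cmod z + 1)"]])
     (metis abs_of_nonneg add_nonneg_nonneg less_add_one norm_ge_zero norm_of_real zero_le_one)

lemma series_tail_bound:
  fixes c :: "nat \<Rightarrow> complex"
  assumes c: "\<And>z::complex. summable (\<lambda>n. c n * z ^ n)" and z: "cmod z \<le> r"
  shows "cmod (taylor_upto N c z - taylor c z) \<le> (\<Sum>n. cmod (c (n + Suc N)) * r ^ (n + Suc N))"
proof -
  have r: "r \<ge> 0" using z norm_ge_zero order_trans by blast
  have s: "summable (\<lambda>n. cmod (c (n + Suc N)) * r ^ (n + Suc N))"
    using summable_ignore_initial_segment[OF entire_series_abs_summable[OF c, of "of_real r"], of "Suc N"] r
    by (simp add: norm_mult norm_power)
  have "taylor c z = (\<Sum>n. c (n + Suc N) * z ^ (n + Suc N)) + (\<Sum>n<Suc N. c n * z ^ n)"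
    by (rule suminf_split_initial_segment[OF c])
  then have "taylor_upto N c z - taylor c z = - (\<Sum>n. c (n + Suc N) * z ^ (n + Suc N))"
    by (simp add: lessThan_Suc_atMost del: sum.lessThan_Suc)
  also have "cmod \<dots> = cmod (\<Sum>n. c (n + Suc N) * z ^ (n + Suc N))" by simp
  also have "\<dots> \<le> (\<Sum>n. cmod (c (n + Suc N)) * r ^ (n + Suc N))"
    by (rule norm_suminf_le[OF _ s]) (unfold norm_mult norm_power, intro mult_left_mono power_mono z, auto)
  finally show ?thesis .
qed

lemma series_tail_tendsto_0:
  fixes c :: "nat \<Rightarrow> complex"
  assumes c: "\<And>z::complex. summable (\<lambda>n. c n * z ^ n)" and r: "r \<ge> 0"
  shows "(\<lambda>N. \<Sum>n. cmod (c (n + Suc N)) * r ^ (n + Suc N)) \<longlonglongrightarrow> 0"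
proof -
  let ?a = "\<lambda>n. cmod (c n) * r ^ n"
  have s: "summable ?a"
    using entire_series_abs_summable[OF c, of "of_real r"] r by (simp add: norm_mult norm_power)
  have "(\<lambda>N. suminf ?a - (\<Sum>n<Suc N. ?a n)) \<longlonglongrightarrow> suminf ?a - suminf ?a"
    by (intro tendsto_diff tendsto_const LIMSEQ_Suc[OF summable_LIMSEQ[OF s]])
  moreover have "suminf ?a - (\<Sum>n<Suc N. ?a n) = (\<Sum>n. ?a (n + Suc N))" for N
    using suminf_split_initial_segment[OF s, of "Suc N"] by (simp del: sum.lessThan_Suc)
  ultimately show ?thesis by simp
qed

lemma circle_lp_diff_le:
  assumes p: "p > 0" and F: "continuous_on UNIV F" and G: "continuous_on UNIV G"
  shows "circle_lp p (\<lambda>\<zeta>. F \<zeta> - G \<zeta>) z \<le> 2 powr p * (circle_lp p F z + circle_lp p G z)"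
proof -
  note i = circle_lp_integrable[OF _ p]
  have "circle_lp p (\<lambda>\<zeta>. F \<zeta> - G \<zeta>) z
     \<le> integral {-pi..pi} (\<lambda>\<theta>. 2 powr p * (cmod (F (cis \<theta> * z)) powr p + cmod (G (cis \<theta> * z)) powr p))"
    unfolding circle_lp_def
  proof (rule integral_le)
    show "(\<lambda>\<theta>. cmod (F (cis \<theta> * z) - G (cis \<theta> * z)) powr p) integrable_on {-pi..pi}"
      by (intro i[of "\<lambda>\<zeta>. F \<zeta> - G \<zeta>"] continuous_intros F G)
    show "(\<lambda>\<theta>. 2 powr p * (cmod (F (cis \<theta> * z)) powr p + cmod (G (cis \<theta> * z)) powr p)) integrable_on {-pi..pi}"
      by (intro integrable_on_mult_right integrable_add i F G)
    have "cmod (u - v) powr p \<le> 2 powr p * (cmod u powr p + cmod v powr p)" for u v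
      using p by (intro order.trans[OF powr_mono2[OF _ _ norm_triangle_ineq4] add_powr_le]) auto
    then show "cmod (F (cis \<theta> * z) - G (cis \<theta> * z)) powr p \<le> 2 powr p * (cmod (F (cis \<theta> * z)) powr p + cmod (G (cis \<theta> * z)) powr p)" for \<theta>
      by blast
  qed
  also have "\<dots> = 2 powr p * (circle_lp p F z + circle_lp p G z)"
    using i[OF F] i[OF G] by (simp add: circle_lp_def integral_add)
  finally show ?thesis .
qed

text \<open>
  Dominated convergence: on each circle the Taylor polynomials converge uniformly, and by
  \<open>riesz_truncation\<close> the mean of the difference is at most a fixed multiple of the mean of the function
  itself.
\<close>

theorem fock_truncation_tendsto:
  fixes p :: real
  assumes p: "p > 1" and c: "\<And>z. summable (\<lambda>n. c n * z ^ n)" and fin: "fock_int p (taylor c) < \<infinity>"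
  shows "(\<lambda>N. fock_int p (\<lambda>\<zeta>. taylor_upto N c \<zeta> - taylor c \<zeta>)) \<longlonglongrightarrow> 0"
proof -
  obtain C where C: "C \<ge> 0" and riesz: "\<And>c N z. (\<And>z. summable (\<lambda>n. c n * z ^ n)) \<Longrightarrow>
    circle_lp p (taylor_upto N c) z \<le> C * circle_lp p (taylor c) z"
    using riesz_truncation[OF p] by blast
  have p0: "p > 0" using p by simp
  let ?I = "\<lambda>F z. circle_lp p F (bargmann_point z)"
  let ?e = "\<lambda>z::real \<times> real. exp (- pi / 2 * (norm z)\<^sup>2) powr p"
  define D where "D N \<zeta> = taylor_upto N c \<zeta> - taylor c \<zeta>" for N \<zeta>
  have cF: "continuous_on UNIV (taylor c)" by (rule taylor_continuous[OF c])
  have cP: "continuous_on UNIV (taylor_upto N c)" for N by (intro continuous_intros)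
  have cD: "continuous_on UNIV (D N)" for N unfolding D_def by (intro continuous_intros cF cP)
  note meas = circle_lp_measurable[OF _ p0]
  define K where "K = 2 powr p * (C + 1)"
  have K: "K \<ge> 0" using C by (simp add: K_def)
  have le: "?I (D N) z \<le> K * ?I (taylor c) z" for N z
  proof -
    have "?I (D N) z \<le> 2 powr p * (?I (taylor_upto N c) z + ?I (taylor c) z)"
      unfolding D_def by (rule circle_lp_diff_le[OF p0 cP cF])
    also have "\<dots> \<le> 2 powr p * (C * ?I (taylor c) z + ?I (taylor c) z)"
      by (intro mult_left_mono add_right_mono riesz c) auto
    also have "\<dots> = K * ?I (taylor c) z" by (simp only: K_def distrib_left distrib_right mult.assoc mult_1)
    finally show ?thesis .
  qed
  have lim: "(\<lambda>N. ennreal (?e z * ?I (D N) z)) \<longlonglongrightarrow> 0" for z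
  proof -
    define r where "r = norm z"
    let ?t = "\<lambda>N. \<Sum>n. cmod (c (n + Suc N)) * r ^ (n + Suc N)"
    have t: "?t \<longlonglongrightarrow> 0" by (rule series_tail_tendsto_0[OF c]) (simp add: r_def)
    have t0: "?t N \<ge> 0" for N
      using order.trans[OF norm_ge_zero series_tail_bound[OF c, of 0 r N]] by (simp add: r_def)
    have I: "?I (D N) z \<le> 2 * pi * ?t N powr p" for N
    proof -
      have "?I (D N) z \<le> integral {-pi..pi} (\<lambda>\<theta>. ?t N powr p)"
        unfolding circle_lp_def
      proof (rule integral_le)
        show "(\<lambda>\<theta>. cmod (D N (cis \<theta> * bargmann_point z)) powr p) integrable_on {-pi..pi}"
          by (rule circle_lp_integrable[OF cD p0])
        show "cmod (D N (cis \<theta> * bargmann_point z)) powr p \<le> ?t N powr p" for \<theta>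
          unfolding D_def using p by (intro powr_mono2 series_tail_bound[OF c]) (auto simp: norm_mult r_def)
      qed auto
      then show ?thesis by simp
    qed
    have "(\<lambda>N. ?e z * ?I (D N) z) \<longlonglongrightarrow> 0"
    proof (rule tendsto_sandwich[of "\<lambda>_. 0" _ _ "\<lambda>N. ?e z * (2 * pi * ?t N powr p)"])
      show "\<forall>\<^sub>F N in sequentially. 0 \<le> ?e z * ?I (D N) z" by (auto simp: circle_lp_nonneg)
      show "\<forall>\<^sub>F N in sequentially. ?e z * ?I (D N) z \<le> ?e z * (2 * pi * ?t N powr p)"
        by (intro always_eventually allI mult_left_mono I) simp
      have "(\<lambda>N. ?e z * (2 * pi * ?t N powr p)) \<longlonglongrightarrow> ?e z * (2 * pi * 0 powr p)"
        by (intro tendsto_intros t) (use p t0 in auto)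
      then show "(\<lambda>N. ?e z * (2 * pi * ?t N powr p)) \<longlonglongrightarrow> 0" by simp
    qed auto
    then show ?thesis using tendsto_ennrealI by fastforce
  qed
  have "(\<lambda>N. \<integral>\<^sup>+z. ennreal (?e z * ?I (D N) z) \<partial>lborel) \<longlonglongrightarrow> (\<integral>\<^sup>+z. 0 \<partial>(lborel :: (real \<times> real) measure))"
  proof (rule nn_integral_dominated_convergence[where w="\<lambda>z. ennreal K * ennreal (?e z * ?I (taylor c) z)"])
    show "(\<integral>\<^sup>+z. ennreal K * ennreal (?e z * ?I (taylor c) z) \<partial>lborel) < \<infinity>"
    proof -
      have "(\<integral>\<^sup>+z. ennreal K * ennreal (?e z * ?I (taylor c) z) \<partial>lborel) = ennreal K * (\<integral>\<^sup>+z. ennreal (?e z * ?I (taylor c) z) \<partial>lborel)"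
        using meas[OF cF] by (intro nn_integral_cmult) simp
      also have "\<dots> = ennreal K * (ennreal (2 * pi) * fock_int p (taylor c))"
        by (subst fock_int_circle[OF cF p0]) (rule refl)
      also have "\<dots> < \<infinity>" using fin by (simp add: ennreal_mult_less_top)
      finally show ?thesis .
    qed
    show "AE z in lborel. ennreal (?e z * ?I (D N) z) \<le> ennreal K * ennreal (?e z * ?I (taylor c) z)" for N
    proof (rule AE_I2)
      fix z
      have "?e z * ?I (D N) z \<le> ?e z * (K * ?I (taylor c) z)" by (intro mult_left_mono le) simp
      then show "ennreal (?e z * ?I (D N) z) \<le> ennreal K * ennreal (?e z * ?I (taylor c) z)"
        unfolding ennreal_mult'[OF K, symmetric] by (intro ennreal_leI) (simp add: mult_ac)
    qed
  qed (use meas[OF cD] meas[OF cF] lim in auto)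
  then have "(\<lambda>N. ennreal (2 * pi) * fock_int p (D N)) \<longlonglongrightarrow> 0"
    by (subst fock_int_circle[OF cD p0]) simp
  then have "(\<lambda>N. ennreal (1 / (2 * pi)) * (ennreal (2 * pi) * fock_int p (D N))) \<longlonglongrightarrow> ennreal (1 / (2 * pi)) * 0"
    by (intro tendsto_intros) auto
  then show ?thesis
    unfolding mult.assoc[symmetric] by (simp add: D_def[abs_def] flip: ennreal_mult)
qed

section \<open>Boundedness and convergence in modulation spaces\<close>

text \<open>
  The passage from the integral to the norm in \<open>mod_norm\<close>.
\<close>

definition lp_root :: "real \<Rightarrow> ennreal \<Rightarrow> ennreal" where
  "lp_root q I = (if I = \<infinity> then \<infinity> else ennreal (enn2real I powr (1 / q)))"

lemma lp_root_mono_scaled: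
  assumes "q > 0" "C \<ge> 0" "I \<le> ennreal C * J" "J < \<infinity>"
  shows "lp_root q I \<le> ennreal (C powr (1 / q)) * lp_root q J"
proof -
  obtain j where j: "J = ennreal j" "j \<ge> 0" using assms(4) by (cases J) auto
  have le: "I \<le> ennreal (C * j)" using assms(2,3) j by (simp add: ennreal_mult)
  then have "I < \<infinity>" using le_less_trans[OF le ennreal_less_top] by simp
  then obtain i where i: "I = ennreal i" "i \<ge> 0" by (cases I) auto
  have "i \<le> C * j" using le i j assms(2) by simp
  then have "i powr (1 / q) \<le> C powr (1 / q) * j powr (1 / q)"
    using i j assms powr_mono2[of "1 / q" i "C * j"] by (simp add: powr_mult)
  then show ?thesis using i j by (simp add: lp_root_def flip: ennreal_mult)
qed

lemma lp_root_1: "lp_root 1 I = I"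
  by (cases I) (auto simp: lp_root_def)

lemma lp_root_tendsto_0:
  assumes "q > 0" "(I \<longlonglongrightarrow> 0)"
  shows "(\<lambda>N. lp_root q (I N)) \<longlonglongrightarrow> 0"
proof -
  have fin: "\<forall>\<^sub>F N in sequentially. I N < \<infinity>"
    using order_tendstoD(2)[OF assms(2), of "\<infinity>"] by simp
  have "(\<lambda>N. enn2real (I N)) \<longlonglongrightarrow> 0"
    using tendsto_enn2real[of I 0] assms(2) by simp
  then have "(\<lambda>N. enn2real (I N) powr (1 / q)) \<longlonglongrightarrow> 0 powr (1 / q)"
    using assms(1) by (intro tendsto_powr') auto
  then have "(\<lambda>N. ennreal (enn2real (I N) powr (1 / q))) \<longlonglongrightarrow> ennreal 0"
    by (intro tendsto_ennrealI) simp
  moreover have "\<forall>\<^sub>F N in sequentially. ennreal (enn2real (I N) powr (1 / q)) = lp_root q (I N)"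
    using fin by eventually_elim (auto simp: lp_root_def)
  ultimately show ?thesis by (simp add: tendsto_cong)
qed

lemma norm_pairing_fock_abs:
  assumes "\<And>z. pairing f (tf_shift z gaussian) = bargmann_factor z * F (bargmann_point z)"
  shows "cmod (pairing f (tf_shift z gaussian)) = fock_abs F (bargmann_point z)"
  unfolding assms fock_abs_def norm_mult norm_bargmann_factor by simp

lemma mod_norm_fock_int:
  assumes "\<And>z. pairing f (tf_shift z gaussian) = bargmann_factor z * F (bargmann_point z)" "p \<noteq> \<infinity>"
  shows "mod_norm p f = lp_root (enn2real p) (fock_int (enn2real p) F)"
  unfolding mod_norm_def lp_root_def fock_int_def Let_def norm_pairing_fock_abs[OF assms(1)] using assms(2) by simp

lemma mod_norm_infinity:
  assumes "\<And>z. pairing f (tf_shift z gaussian) = bargmann_factor z * F (bargmann_point z)"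
  shows "mod_norm \<infinity> f = (SUP z. ennreal (fock_abs F (bargmann_point z)))"
  unfolding mod_norm_def norm_pairing_fock_abs[OF assms] by simp

lemma tempered_fock_series:
  assumes "f \<in> tempered"
  shows "summable (\<lambda>n. f (hermite_mode n) * \<zeta> ^ n)" "f (coherent \<zeta>) = taylor (\<lambda>n. f (hermite_mode n)) \<zeta>"
  using tempered_coherent_sums[OF assms, of \<zeta>] by (auto simp: sums_iff)

lemma pairing_tempered:
  assumes "f \<in> tempered"
  shows "pairing f (tf_shift z gaussian) = bargmann_factor z * (taylor (\<lambda>n. f (hermite_mode n))) (bargmann_point z)"
  using pairing_tf_shift[OF assms] tempered_fock_series(2)[OF assms] by simp

lemma pairing_hermite_partial:
  assumes "f \<in> tempered"
  shows "pairing (hermite_partial N f) (tf_shift z gaussian) = bargmann_factor z * taylor_upto N (\<lambda>n. f (hermite_mode n)) (bargmann_point z)"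
  using pairing_tf_shift[OF hermite_partial_tempered[OF assms]] hermite_partial_coherent[OF assms] by simp

lemma pairing_hermite_partial_diff:
  assumes "f \<in> tempered"
  shows "pairing (\<lambda>g. hermite_partial N f g - f g) (tf_shift z gaussian) = bargmann_factor z *
    (\<lambda>\<zeta>. taylor_upto N (\<lambda>n. f (hermite_mode n)) \<zeta> - taylor (\<lambda>n. f (hermite_mode n)) \<zeta>) (bargmann_point z)"
  using pairing_hermite_partial[OF assms, of N z] pairing_tempered[OF assms, of z]
  by (simp add: pairing_def right_diff_distrib)

lemma ennreal_exponent:
  assumes "1 < p" "p < (\<infinity> :: ennreal)"
  shows "enn2real p > 1"
  using assms by (cases p) (auto simp: ennreal_less_iff simp flip: ennreal_1)

theorem hermite_partial_bounded:
  assumes p: "1 < p" "p < (\<infinity>::ennreal)"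
  shows "\<exists>C::real. C > 0 \<and> (\<forall>N. \<forall>f\<in>mod_space p. mod_norm p (hermite_partial N f) \<le> ennreal C * mod_norm p f)"
proof -
  define q where "q = enn2real p"
  have q: "q > 1" unfolding q_def by (rule ennreal_exponent[OF p])
  have pinf: "p \<noteq> \<infinity>" using p by auto
  obtain C where C: "C \<ge> 0" and trunc: "\<And>c N. (\<And>z. summable (\<lambda>n. c n * z ^ n)) \<Longrightarrow>
    fock_int q (taylor_upto N c) \<le> ennreal C * fock_int q (taylor c)"
    using fock_truncation_bound[OF q] by blast
  have "mod_norm p (hermite_partial N f) \<le> ennreal (C powr (1 / q) + 1) * mod_norm p f" if f: "f \<in> mod_space p" for N f
  proof -
    have ft: "f \<in> tempered" and fin: "mod_norm p f < \<infinity>" using f by (auto simp: mod_space_def)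
    note n = mod_norm_fock_int[OF pairing_tempered[OF ft] pinf, folded q_def]
      mod_norm_fock_int[OF pairing_hermite_partial[OF ft, of N] pinf, folded q_def]
    have "fock_int q (taylor (\<lambda>n. f (hermite_mode n))) < \<infinity>"
      using fin unfolding n lp_root_def by (auto split: if_splits simp: less_top)
    then have "mod_norm p (hermite_partial N f) \<le> ennreal (C powr (1 / q)) * mod_norm p f"
      unfolding n using q C by (intro lp_root_mono_scaled trunc tempered_fock_series(1)[OF ft]) auto
    also have "\<dots> \<le> ennreal (C powr (1 / q) + 1) * mod_norm p f"
      by (intro mult_right_mono ennreal_leI) auto
    finally show ?thesis .
  qed
  then show ?thesis by (intro exI[of _ "C powr (1 / q) + 1"]) (auto simp: add_nonneg_pos)
qed

theorem hermite_partial_tendsto: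
  assumes p: "1 < p" "p < (\<infinity>::ennreal)" and f: "f \<in> mod_space p"
  shows "(\<lambda>N. mod_norm p (\<lambda>g. hermite_partial N f g - f g)) \<longlonglongrightarrow> 0"
proof -
  define q where "q = enn2real p"
  have q: "q > 1" unfolding q_def by (rule ennreal_exponent[OF p])
  have pinf: "p \<noteq> \<infinity>" using p by auto
  have ft: "f \<in> tempered" and fin: "mod_norm p f < \<infinity>" using f by (auto simp: mod_space_def)
  have "fock_int q (taylor (\<lambda>n. f (hermite_mode n))) < \<infinity>"
    using fin unfolding mod_norm_fock_int[OF pairing_tempered[OF ft] pinf, folded q_def] lp_root_def
    by (auto split: if_splits simp: less_top)
  then show ?thesis
    unfolding mod_norm_fock_int[OF pairing_hermite_partial_diff[OF ft] pinf, folded q_def]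
    using q by (intro lp_root_tendsto_0 fock_truncation_tendsto tempered_fock_series(1)[OF ft]) auto
qed

section \<open>A lower bound for truncated coherent states\<close>

lemma ln_one_plus_ge:
  assumes "x \<ge> (0::real)"
  shows "2 * x / (2 + x) \<le> ln (1 + x)"
proof -
  have "ln (1 + 0) - 2 * 0 / (2 + 0) \<le> ln (1 + x) - 2 * x / (2 + x)"
  proof (rule DERIV_nonneg_imp_nondecreasing[OF assms])
    fix t :: real assume t: "0 \<le> t" "t \<le> x"
    have 1: "((\<lambda>t. ln (1 + t)) has_real_derivative 1 / (1 + t)) (at t)"
      using t by (auto intro!: derivative_eq_intros)
    have 2: "((\<lambda>t. 2 * t / (2 + t)) has_real_derivative 4 / (2 + t)\<^sup>2) (at t)"
      using t by (auto intro!: derivative_eq_intros simp: power2_eq_square)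
    have "4 * (1 + t) \<le> (2 + t)\<^sup>2" by (simp add: power2_eq_square algebra_simps)
    then have "4 / (2 + t)\<^sup>2 \<le> 1 / (1 + t)" using t by (simp add: divide_simps)
    then show "\<exists>y. ((\<lambda>t. ln (1 + t) - 2 * t / (2 + t)) has_real_derivative y) (at t) \<and> 0 \<le> y"
      using DERIV_diff[OF 1 2] by (intro exI conjI) auto
  qed
  then show ?thesis by simp
qed

text \<open>
  The quotient of the two sides decreases in \<open>n\<close> because \<open>(n + 1/2) * ln (1 + 1 / n) \<ge> 1\<close>, and equals 1
  for \<open>n = 1\<close>.
\<close>

lemma fact_le_stirling:
  assumes "n \<ge> 1"
  shows "fact n \<le> exp 1 * sqrt (real n) * (real n / exp 1) ^ n"
  using assms
proof (induction n rule: dec_induct)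
  case base show ?case by simp
next
  case (step n)
  have n: "real n > 0" using step by simp
  have p: "1 + 1 / real n > 0" using n by (simp add: add_pos_pos)
  have "2 * (1 / real n) / (2 + 1 / real n) = 1 / (real n + 1/2)" using n by (simp add: field_simps)
  then have "1 / (real n + 1/2) \<le> ln (1 + 1 / real n)"
    using ln_one_plus_ge[of "1 / real n"] n by simp
  then have "1 \<le> (real n + 1/2) * ln (1 + 1 / real n)" using n by (simp add: divide_le_eq mult.commute)
  then have "exp 1 \<le> exp ((real n + 1/2) * ln (1 + 1 / real n))" by simp
  also have "\<dots> = (1 + 1 / real n) powr (real n + 1/2)" using p by (simp only: powr_def) simp
  also have "\<dots> = (1 + 1 / real n) ^ n * sqrt (1 + 1 / real n)"
    using p by (simp only: powr_add powr_realpow powr_half_sqrt[OF less_imp_le[OF p]])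
  also have "1 + 1 / real n = real (Suc n) / real n" using n by (simp add: field_simps)
  finally have e: "exp 1 \<le> (real (Suc n) / real n) ^ n * sqrt (real (Suc n) / real n)" .
  have "fact (Suc n) = real (Suc n) * fact n" by simp
  also have "\<dots> \<le> real (Suc n) * (exp 1 * sqrt (real n) * (real n / exp 1) ^ n)"
    by (intro mult_left_mono step.IH) simp
  also have "\<dots> = exp 1 * (real (Suc n) / exp 1 ^ Suc n) * (exp 1 * (sqrt (real n) * real n ^ n))"
    by (simp add: power_divide)
  also have "\<dots> \<le> exp 1 * (real (Suc n) / exp 1 ^ Suc n) *
       (((real (Suc n) / real n) ^ n * sqrt (real (Suc n) / real n)) * (sqrt (real n) * real n ^ n))"
    by (intro mult_left_mono mult_right_mono e) (auto simp: mult_nonneg_nonneg)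
  also have "((real (Suc n) / real n) ^ n * sqrt (real (Suc n) / real n)) * (sqrt (real n) * real n ^ n) = real (Suc n) ^ n * sqrt (real (Suc n))"
    using n by (simp add: power_divide real_sqrt_divide)
  finally show ?case by (simp add: power_divide mult_ac)
qed

text \<open>
  Stirling's bound for the factorial, and \<open>ln y \<le> y - 1\<close> for \<open>y = n / x\<close>. The bound says that a Poisson
  distribution of mean \<open>x\<close> spreads over about \<open>sqrt x\<close> integers.
\<close>

lemma poisson_lower_bound:
  assumes n: "n \<ge> 1" and x: "x > 0"
  shows "exp (- (x - real n)\<^sup>2 / x) / (exp 1 * sqrt (real n)) \<le> x ^ n * exp (- x) / fact n"
proof -
  have n0: "real n > 0" using n by simp
  have "ln (real n / x) \<le> real n / x - 1" by (rule ln_le_minus_one) (use n0 x in simp)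
  then have "1 - real n / x \<le> ln x - ln (real n)" using n0 x by (simp add: ln_div)
  then have "real n * (1 - real n / x) \<le> real n * (ln x - ln (real n))" using n0 by (intro mult_left_mono) auto
  moreover have "- (x - real n)\<^sup>2 / x = real n * (1 - real n / x) - x + real n"
    using x by (simp add: power2_eq_square field_simps)
  ultimately have "- (x - real n)\<^sup>2 / x \<le> real n * ln x - real n * ln (real n) - x + real n" by (simp add: algebra_simps)
  then have "exp (- (x - real n)\<^sup>2 / x) \<le> exp (real n * ln x - real n * ln (real n) - x + real n)" by simp
  also have "\<dots> = x ^ n * exp (- x) / (real n / exp 1) ^ n"
  proof -
    have "exp (real n * ln y) = y ^ n" if "y > 0" for y using that by (simp add: exp_of_nat_mult)
    then show ?thesis using n0 x by (simp add: exp_add exp_diff power_divide exp_minus field_simps exp_of_nat_mult[symmetric])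
  qed
  finally have "exp (- (x - real n)\<^sup>2 / x) / (exp 1 * sqrt (real n)) \<le> x ^ n * exp (- x) / (real n / exp 1) ^ n / (exp 1 * sqrt (real n))"
    using n0 by (intro divide_right_mono) auto
  also have "\<dots> = x ^ n * exp (- x) / (exp 1 * sqrt (real n) * (real n / exp 1) ^ n)" by (simp add: mult_ac)
  also have "\<dots> \<le> x ^ n * exp (- x) / fact n"
    using x n0 by (intro divide_left_mono fact_le_stirling[OF n] mult_nonneg_nonneg mult_pos_pos) auto
  finally show ?thesis .
qed

lemma sawtooth_has_integral:
  assumes "m \<ge> 1"
  shows "((\<lambda>\<theta>. of_real (pi - \<theta>) * cis (- real m * \<theta>)) has_integral (- (2 * of_real pi * \<i> / of_nat m))) {0..2 * pi}"
proof -
  have m: "of_nat m \<noteq> (0::complex)" using assms by simp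
  define G where "G \<theta> = of_real (pi - \<theta>) * (cis (- real m * \<theta>) * (\<i> / of_nat m)) + cis (- real m * \<theta>) * (\<i> / of_nat m) * (\<i> / of_nat m)" for \<theta>
  have dc: "((\<lambda>\<theta>. cis (- real m * \<theta>)) has_vector_derivative (- \<i> * of_nat m) * cis (- real m * \<theta>)) (at \<theta> within {0..2*pi})" for \<theta>
  proof -
    have lin: "((\<lambda>\<theta>. (- \<i> * of_nat m) * of_real \<theta>) has_vector_derivative (- \<i> * of_nat m)) (at \<theta>)"
      by (auto intro!: derivative_eq_intros simp: has_vector_derivative_def scaleR_conv_of_real)
    have "((\<lambda>\<theta>. exp ((- \<i> * of_nat m) * of_real \<theta>)) has_vector_derivative (- \<i> * of_nat m) * exp ((- \<i> * of_nat m) * of_real \<theta>)) (at \<theta>)"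
      using field_vector_diff_chain_at[OF lin DERIV_exp] by (simp add: o_def)
    moreover have "cis (- real m * t) = exp ((- \<i> * of_nat m) * of_real t)" for t
      unfolding cis_conv_exp by (simp add: mult_ac)
    ultimately show ?thesis by (simp only:) (rule has_vector_derivative_at_within)
  qed
  have "(G has_vector_derivative of_real (pi - \<theta>) * cis (- real m * \<theta>)) (at \<theta> within {0..2*pi})" for \<theta>
  proof -
    have d1: "((\<lambda>\<theta>. complex_of_real (pi - \<theta>)) has_vector_derivative - 1) (at \<theta> within {0..2*pi})"
      by (auto intro!: derivative_eq_intros simp: has_vector_derivative_def scaleR_conv_of_real)
    note d2 = has_vector_derivative_mult_left[OF dc, of "\<i> / of_nat m" \<theta>]
    note d3 = has_vector_derivative_mult_left[OF d2, of "\<i> / of_nat m"]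
    have K: "(- \<i> * of_nat m) * cis (- real m * \<theta>) * (\<i> / of_nat m) = cis (- real m * \<theta>)"
      using m by (simp add: mult.commute mult.left_commute)
    show ?thesis
      using has_vector_derivative_add[OF has_vector_derivative_mult[OF d1 d2] d3]
      unfolding K G_def[abs_def] by simp
  qed
  then have "((\<lambda>\<theta>. of_real (pi - \<theta>) * cis (- real m * \<theta>)) has_integral (G (2 * pi) - G 0)) {0..2 * pi}"
    by (intro fundamental_theorem_of_calculus) auto
  moreover have "G (2 * pi) - G 0 = - (2 * of_real pi * \<i> / of_nat m)"
  proof -
    have "cis (- real m * (2 * pi)) = 1" using cis_multiple_2pi[of "- real m"] by (simp add: mult_ac)
    then show ?thesis by (simp add: G_def algebra_simps)
  qed
  ultimately show ?thesis by simp
qed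

text \<open>
  Hardy's inequality, read from the leading coefficient downwards. Integrate the polynomial against
  \<open>(pi - \<theta>) * cis (- (N + 1) \<theta>)\<close>: this function is bounded by \<open>pi\<close>, and its Fourier coefficients are those of
  a sawtooth, so that the integral is a multiple of the sum on the left.
\<close>

lemma hardy_truncated:
  fixes a :: "nat \<Rightarrow> real"
  assumes "\<And>n. n \<le> N \<Longrightarrow> a n \<ge> 0"
  shows "2 * (\<Sum>n\<le>N. a n / real (N + 1 - n)) \<le> integral {0..2*pi} (\<lambda>\<theta>. cmod (\<Sum>n\<le>N. of_real (a n) * cis \<theta> ^ n))"
proof -
  define P where "P \<theta> = (\<Sum>n\<le>N. of_real (a n) * cis \<theta> ^ n)" for \<theta>
  define k where "k \<theta> = of_real (pi - \<theta>) * cis (- real (N + 1) * \<theta>)" for \<theta>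
  let ?S = "\<Sum>n\<le>N. a n / real (N + 1 - n)"
  have cP: "continuous_on A P" for A unfolding P_def by (intro continuous_intros)
  have "((\<lambda>\<theta>. \<Sum>n\<le>N. of_real (a n) * (of_real (pi - \<theta>) * cis (- real (N + 1 - n) * \<theta>))) has_integral
      (\<Sum>n\<le>N. of_real (a n) * (- (2 * of_real pi * \<i> / of_nat (N + 1 - n))))) {0..2*pi}"
    by (intro has_integral_sum has_integral_mult_right sawtooth_has_integral) auto
  also have "(\<lambda>\<theta>. \<Sum>n\<le>N. of_real (a n) * (of_real (pi - \<theta>) * cis (- real (N + 1 - n) * \<theta>))) = (\<lambda>\<theta>. P \<theta> * k \<theta>)"
  proof
    fix \<theta>
    have "cis (- real (N + 1 - n) * \<theta>) = cis \<theta> ^ n * cis (- real (N + 1) * \<theta>)" if "n \<le> N" for n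
    proof -
      have "cis \<theta> ^ n * cis (- real (N + 1) * \<theta>) = cis (real n * \<theta> + - real (N + 1) * \<theta>)"
        unfolding Complex.DeMoivre cis_mult ..
      also have "real n * \<theta> + - real (N + 1) * \<theta> = - real (N + 1 - n) * \<theta>"
        using that by (simp add: of_nat_diff algebra_simps)
      finally show ?thesis by simp
    qed
    then show "(\<Sum>n\<le>N. of_real (a n) * (of_real (pi - \<theta>) * cis (- real (N + 1 - n) * \<theta>))) = P \<theta> * k \<theta>"
      unfolding P_def k_def sum_distrib_right by (intro sum.cong refl) (simp add: mult_ac)
  qed
  also have "(\<Sum>n\<le>N. of_real (a n) * (- (2 * of_real pi * \<i> / of_nat (N + 1 - n)))) = - (2 * of_real pi * \<i>) * of_real ?S"
    unfolding of_real_sum sum_distrib_left by (intro sum.cong refl) (simp add: of_nat_diff)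
  finally have "((\<lambda>\<theta>. P \<theta> * k \<theta>) has_integral - (2 * of_real pi * \<i>) * of_real ?S) {0..2*pi}" .
  then have "cmod (- (2 * of_real pi * \<i>) * of_real ?S) \<le> integral {0..2*pi} (\<lambda>\<theta>. pi * cmod (P \<theta>))"
  proof -
    assume *: "((\<lambda>\<theta>. P \<theta> * k \<theta>) has_integral - (2 * of_real pi * \<i>) * of_real ?S) {0..2*pi}"
    have "cmod (integral {0..2*pi} (\<lambda>\<theta>. P \<theta> * k \<theta>)) \<le> integral {0..2*pi} (\<lambda>\<theta>. pi * cmod (P \<theta>))"
    proof (rule integral_norm_bound_integral)
      show "(\<lambda>\<theta>. P \<theta> * k \<theta>) integrable_on {0..2*pi}" using * by blast
      show "(\<lambda>\<theta>. pi * cmod (P \<theta>)) integrable_on {0..2*pi}"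
        by (intro integrable_continuous_interval continuous_intros cP)
      fix \<theta> assume "\<theta> \<in> {0..2*pi}"
      then have "\<bar>pi - \<theta>\<bar> \<le> pi" by auto
      then have "cmod (P \<theta>) * \<bar>pi - \<theta>\<bar> \<le> cmod (P \<theta>) * pi" by (rule mult_left_mono) simp
      then show "cmod (P \<theta> * k \<theta>) \<le> pi * cmod (P \<theta>)"
        unfolding k_def norm_mult norm_of_real norm_cis mult_1_right by (simp only: mult.commute)
    qed
    then show ?thesis using integral_unique[OF *] by simp
  qed
  moreover have "?S \<ge> 0" by (intro sum_nonneg divide_nonneg_nonneg assms) auto
  moreover have "cmod (- (2 * of_real pi * \<i>) * of_real s) = pi * (2 * s)" if "s \<ge> 0" for s
    using that by (simp add: norm_mult)
  ultimately have "pi * (2 * ?S) \<le> integral {0..2*pi} (\<lambda>\<theta>. pi * cmod (P \<theta>))" by metis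
  also have "\<dots> = pi * integral {0..2*pi} (\<lambda>\<theta>. cmod (P \<theta>))" by simp
  finally have "pi * (2 * ?S) \<le> pi * integral {0..2*pi} (\<lambda>\<theta>. cmod (P \<theta>))" .
  then have "2 * ?S \<le> integral {0..2*pi} (\<lambda>\<theta>. cmod (P \<theta>))"
    using mult_le_cancel_left_pos[OF pi_gt_zero] by blast
  then show ?thesis unfolding P_def .
qed

text \<open>
  The product of the losses in the proof of \<open>fock_annulus_lower_bound\<close>; it is absolute, so that the same
  constant serves both endpoints.
\<close>

definition annulus_const :: real where
  "annulus_const = exp (- pi / 2) * exp (- 9) / exp 1 / pi"

lemma annulus_const_pos: "annulus_const > 0" by (simp add: annulus_const_def)

text \<open>
  The Taylor coefficients of a coherent state at distance \<open>w = sqrt (N / pi)\<close> are Poisson weights of mean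
  \<open>N\<close> on the circle of radius \<open>w\<close>. Truncation at \<open>N\<close> cuts them in the middle, which by Hardy's inequality
  costs a logarithm: about \<open>sqrt N\<close> weights below \<open>N\<close> are comparable with \<open>1 / sqrt N\<close>, and they enter
  with the factors \<open>1 / (N + 1 - n)\<close>. The same holds on all circles of radius between \<open>w\<close> and \<open>w + 1\<close>, and
  the area of this annulus is of order \<open>sqrt N\<close>. The hypothesis is an inequality because coefficients
  that are larger only improve the bound.
\<close>

lemma fock_annulus_lower_bound:
  fixes b :: "nat \<Rightarrow> real"
  assumes N: "N \<ge> 1" and w: "w = sqrt (real N / pi)" and m: "m \<ge> 0"
    and b: "\<And>n. n \<le> N \<Longrightarrow> m * (exp (- real N / 2) * (pi * w) ^ n / fact n) \<le> b n"
  shows "ennreal (m * annulus_const * ln (1 + sqrt (real N))) \<le>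
     (\<integral>\<^sup>+z. ennreal (fock_abs (taylor_upto N (\<lambda>n. of_real (b n))) (bargmann_point z)) * indicator {z. norm z \<le> w + 1} z \<partial>lborel)"
proof -
  define c1 :: real where "c1 = exp (- pi / 2) * exp (- 9) / exp 1"
  have c1: "c1 > 0" "annulus_const = c1 / pi" by (simp_all add: c1_def annulus_const_def)
  have N0: "real N > 0" "sqrt (real N) > 0" using N by auto
  have w0: "w > 0" using N by (simp add: w)
  have w2: "pi * w\<^sup>2 = real N" using N by (simp add: w)
  have piw: "pi * w = sqrt (pi * real N)"
    using w0 w2 by (intro real_sqrt_unique[symmetric]) (auto simp: power2_eq_square mult_ac)
  have b0: "b n \<ge> 0" if "n \<le> N" for n
    by (rule order.trans[OF _ b[OF that]]) (use m w0 in auto)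
  define P where "P \<zeta> = (\<Sum>n\<le>N. complex_of_real (b n) * \<zeta> ^ n)" for \<zeta>
  have cP: "continuous_on UNIV P" unfolding P_def by (intro continuous_intros)
  define L where "L = 2 * (m * (c1 / sqrt (real N)) * ln (1 + sqrt (real N)))"
  have L0: "L \<ge> 0" using m c1 N0 by (simp add: L_def)
  \<comment> \<open>\<open>K\<close> counts the exponents in the window \<open>N - sqrt N < n \<le> N\<close>; the strict inequality keeps \<open>n \<ge> 1\<close>,
    which the Poisson bound needs.\<close>
  define K where "K = nat \<lceil>sqrt (real N)\<rceil>"
  have K: "sqrt (real N) \<le> real K" "\<And>k. k < K \<Longrightarrow> real k < sqrt (real N)"
    unfolding K_def using N0 by linarith+
  have KN: "K \<le> N"
  proof -
    have "sqrt (real N) \<le> real N" using N by (intro real_le_lsqrt) (auto simp: power2_eq_square)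
    then show ?thesis unfolding K_def by linarith
  qed
  have coef: "m * (c1 / sqrt (real N)) \<le> exp (- pi / 2 * r\<^sup>2) * (b n * r ^ n)"
    if r: "w \<le> r" "r \<le> w + 1" and n: "n \<le> N" "real N - sqrt (real N) < real n" for r n
  proof -
    \<comment> \<open>The terms of the series on the circle of radius \<open>r\<close> are Poisson weights with mean \<open>x\<close>, up to the
      factor \<open>exp (- pi / 2 * (r - w)\<^sup>2)\<close>. As \<open>x\<close> and \<open>n\<close> differ by at most \<open>3 sqrt N\<close>, these weights are
      at least a constant times \<open>1 / sqrt N\<close>; the constants 9 and \<open>- pi / 2\<close> in \<open>annulus_const\<close> come from here.\<close>
    define x where "x = pi * w * r"
    have xN: "real N \<le> x" "x \<le> real N + 2 * sqrt (real N)"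
    proof -
      have "pi * w * w \<le> x" unfolding x_def using r w0 by (intro mult_left_mono) auto
      then show "real N \<le> x" using w2 by (simp add: power2_eq_square mult.assoc)
      have "x \<le> pi * w * (w + 1)" unfolding x_def using r w0 by (intro mult_left_mono) auto
      also have "\<dots> = pi * w\<^sup>2 + pi * w" by (simp add: power2_eq_square algebra_simps)
      also have "\<dots> = real N + sqrt (pi * real N)" by (simp only: w2 piw)
      also have "sqrt (pi * real N) \<le> sqrt (4 * real N)" using pi_less_4 by (intro real_sqrt_le_mono mult_right_mono) auto
      also have "sqrt (4 * real N) = 2 * sqrt (real N)" by (simp add: real_sqrt_mult)
      finally show "x \<le> real N + 2 * sqrt (real N)" by simp
    qed
    have x0: "x > 0" using xN N0 by linarith
    have "sqrt (real N) \<le> real N" using N by (intro real_le_lsqrt) (auto simp: power2_eq_square)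
    then have n1: "n \<ge> 1" using n(2) by linarith
    have "0 \<le> x - real n" "x - real n \<le> 3 * sqrt (real N)" using xN n by linarith+
    then have "(x - real n)\<^sup>2 \<le> (3 * sqrt (real N))\<^sup>2" by (intro power_mono)
    also have "\<dots> = 9 * real N" by (simp add: power_mult_distrib)
    also have "\<dots> \<le> 9 * x" using xN by simp
    finally have q: "(x - real n)\<^sup>2 / x \<le> 9" using x0 by (simp add: divide_le_eq)
    have "(r - w)\<^sup>2 \<le> 1\<^sup>2" using r by (intro power_mono) auto
    then have e: "exp (- pi / 2) \<le> exp (- pi / 2 * (r - w)\<^sup>2)" by simp
    have "c1 / sqrt (real N) = exp (- pi / 2) * (exp (- 9) / (exp 1 * sqrt (real N)))" by (simp add: c1_def)
    also have "\<dots> \<le> exp (- pi / 2 * (r - w)\<^sup>2) * (exp (- (x - real n)\<^sup>2 / x) / (exp 1 * sqrt (real n)))"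
      using q n1 n by (intro mult_mono e frac_le) (auto intro!: mult_pos_pos)
    also have "\<dots> \<le> exp (- pi / 2 * (r - w)\<^sup>2) * (x ^ n * exp (- x) / fact n)"
      by (intro mult_left_mono poisson_lower_bound n1 x0) auto
    also have "\<dots> = (exp (- pi / 2 * (r - w)\<^sup>2) * exp (- x)) * ((pi * w) ^ n * r ^ n / fact n)"
      by (simp add: x_def power_mult_distrib)
    also have "exp (- pi / 2 * (r - w)\<^sup>2) * exp (- x) = exp (- pi / 2 * r\<^sup>2) * exp (- real N / 2)"
    proof -
      have "- pi / 2 * (r - w)\<^sup>2 + - x = - pi / 2 * r\<^sup>2 + - (pi * w\<^sup>2) / 2"
        by (simp add: x_def power2_eq_square algebra_simps)
      then show ?thesis unfolding w2 by (simp only: exp_add[symmetric])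
    qed
    finally have "c1 / sqrt (real N) \<le> exp (- pi / 2 * r\<^sup>2) * exp (- real N / 2) * ((pi * w) ^ n * r ^ n / fact n)" .
    then have "m * (c1 / sqrt (real N)) \<le> m * (exp (- pi / 2 * r\<^sup>2) * exp (- real N / 2) * ((pi * w) ^ n * r ^ n / fact n))"
      using m by (rule mult_left_mono)
    also have "\<dots> = exp (- pi / 2 * r\<^sup>2) * ((m * (exp (- real N / 2) * (pi * w) ^ n / fact n)) * r ^ n)" by simp
    also have "\<dots> \<le> exp (- pi / 2 * r\<^sup>2) * (b n * r ^ n)"
      using r w0 by (intro mult_left_mono mult_right_mono b[OF n(1)]) auto
    finally show ?thesis .
  qed
  have hardy: "L \<le> exp (- pi / 2 * r\<^sup>2) * integral {0..2*pi} (\<lambda>\<theta>. cmod (P (of_real r * cis \<theta>)))"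
    if r: "w \<le> r" "r \<le> w + 1" for r
  proof -
    have r0: "r \<ge> 0" using r w0 by linarith
    let ?e = "exp (- pi / 2 * r\<^sup>2)"
    have "ln (1 + sqrt (real N)) \<le> ln (real K + 1)" using K(1) N0 by (intro ln_mono) linarith+
    also have "\<dots> \<le> harm K" by (rule ln_le_harm)
    also have "\<dots> = (\<Sum>k<K. 1 / real (k + 1))"
      unfolding harm_def by (rule sum.reindex_bij_witness[of _ "\<lambda>k. k + 1" "\<lambda>k. k - 1"]) (auto simp: field_simps)
    finally have "m * (c1 / sqrt (real N)) * ln (1 + sqrt (real N)) \<le> m * (c1 / sqrt (real N)) * (\<Sum>k<K. 1 / real (k + 1))"
      using m c1 by (intro mult_left_mono) auto
    also have "\<dots> = (\<Sum>k<K. m * (c1 / sqrt (real N)) / real (k + 1))" by (simp add: sum_distrib_left)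
    also have "\<dots> \<le> (\<Sum>k<K. ?e * (b (N - k) * r ^ (N - k)) / real (k + 1))"
      using K KN by (intro sum_mono divide_right_mono coef r) (auto simp: of_nat_diff)
    also have "\<dots> \<le> (\<Sum>k\<le>N. ?e * (b (N - k) * r ^ (N - k)) / real (k + 1))"
      using KN b0 r0 by (intro sum_mono2) auto
    also have "\<dots> = (\<Sum>n\<le>N. ?e * (b n * r ^ n) / real (N + 1 - n))"
      by (rule sum.reindex_bij_witness[of _ "\<lambda>k. N - k" "\<lambda>k. N - k"]) (auto simp: of_nat_diff)
    also have "\<dots> = ?e * (\<Sum>n\<le>N. (b n * r ^ n) / real (N + 1 - n))" by (simp add: sum_distrib_left)
    finally have "L \<le> ?e * (2 * (\<Sum>n\<le>N. (b n * r ^ n) / real (N + 1 - n)))" unfolding L_def by linarith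
    also have "\<dots> \<le> ?e * integral {0..2*pi} (\<lambda>\<theta>. cmod (\<Sum>n\<le>N. of_real (b n * r ^ n) * cis \<theta> ^ n))"
      using b0 r0 by (intro mult_left_mono hardy_truncated) auto
    also have "(\<lambda>\<theta>. cmod (\<Sum>n\<le>N. of_real (b n * r ^ n) * cis \<theta> ^ n)) = (\<lambda>\<theta>. cmod (P (of_real r * cis \<theta>)))"
      unfolding P_def by (simp add: power_mult_distrib mult_ac)
    finally show ?thesis .
  qed
  define g where "g \<zeta> = ennreal (fock_abs P \<zeta>) * indicator {\<zeta>. cmod \<zeta> \<le> w + 1} \<zeta>" for \<zeta>
  have fm: "fock_abs P \<in> borel_measurable borel" by (rule fock_abs_measurable[OF cP])
  have gm[measurable]: "g \<in> borel_measurable borel"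
    unfolding g_def[abs_def] using fm by measurable
  have cism: "cis \<in> borel_measurable borel" by (intro borel_measurable_continuous_onI continuous_intros)
  \<comment> \<open>The interval \<open>[-pi, 3 pi]\<close> contains a full period starting at \<open>- Arg \<zeta>\<close>, whatever the argument of \<open>\<zeta>\<close> is.\<close>
  have circ: "ennreal L \<le> (\<integral>\<^sup>+\<theta>. g (cis \<theta> * \<zeta>) * indicator {-pi..3*pi} \<theta> \<partial>lborel)" if z: "w \<le> cmod \<zeta>" "cmod \<zeta> \<le> w + 1" for \<zeta>
  proof -
    define r \<alpha> where "r = cmod \<zeta>" and "\<alpha> = Arg \<zeta>"
    have \<zeta>: "\<zeta> = of_real r * cis \<alpha>" unfolding r_def \<alpha>_def using rcis_cmod_Arg[of \<zeta>] by (simp add: rcis_def)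
    have \<alpha>: "- pi < \<alpha>" "\<alpha> \<le> pi" unfolding \<alpha>_def using Arg_bounded[of \<zeta>] by auto
    define h where "h \<theta> = g (of_real r * cis \<theta>) * indicator {0..2*pi} \<theta>" for \<theta>
    have hm: "h \<in> borel_measurable borel" unfolding h_def[abs_def] using cism by measurable
    have "((\<lambda>\<theta>. cmod (P (of_real r * cis \<theta>))) has_integral integral {0..2*pi} (\<lambda>\<theta>. cmod (P (of_real r * cis \<theta>)))) {0..2*pi}"
      by (intro integrable_integral integrable_continuous_interval continuous_intros continuous_on_compose2[OF cP]) auto
    then have "((\<lambda>\<theta>. exp (- pi / 2 * r\<^sup>2) * cmod (P (of_real r * cis \<theta>))) has_integral
        exp (- pi / 2 * r\<^sup>2) * integral {0..2*pi} (\<lambda>\<theta>. cmod (P (of_real r * cis \<theta>)))) {0..2*pi}"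
      by (rule has_integral_mult_right)
    then have "(\<integral>\<^sup>+\<theta>. ennreal (exp (- pi / 2 * r\<^sup>2) * cmod (P (of_real r * cis \<theta>))) * indicator {0..2*pi} \<theta> \<partial>lborel)
        = ennreal (exp (- pi / 2 * r\<^sup>2) * integral {0..2*pi} (\<lambda>\<theta>. cmod (P (of_real r * cis \<theta>))))"
      by (intro nn_integral_has_integral_lebesgue') auto
    moreover have "h \<theta> = ennreal (exp (- pi / 2 * r\<^sup>2) * cmod (P (of_real r * cis \<theta>))) * indicator {0..2*pi} \<theta>" for \<theta>
      unfolding h_def g_def fock_abs_def using z by (simp add: norm_mult r_def mult.commute)
    ultimately have "ennreal L \<le> (\<integral>\<^sup>+\<theta>. h \<theta> \<partial>lborel)"
      using hardy[of r] z by (simp add: r_def ennreal_leI)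
    also have "\<dots> = (\<integral>\<^sup>+\<theta>. h (\<alpha> + \<theta>) \<partial>lborel)"
      using nn_integral_real_affine[OF hm, of 1 \<alpha>] by simp
    also have "\<dots> \<le> (\<integral>\<^sup>+\<theta>. g (cis \<theta> * \<zeta>) * indicator {-pi..3*pi} \<theta> \<partial>lborel)"
    proof (rule nn_integral_mono)
      fix \<theta>
      have "of_real r * cis (\<alpha> + \<theta>) = cis \<theta> * \<zeta>" unfolding \<zeta> by (simp add: cis_mult[symmetric] mult_ac)
      then show "h (\<alpha> + \<theta>) \<le> g (cis \<theta> * \<zeta>) * indicator {-pi..3*pi} \<theta>"
        unfolding h_def using \<alpha> by (auto simp: indicator_def)
    qed
    finally show ?thesis .
  qed
  let ?A = "{z :: real \<times> real. w \<le> norm z \<and> norm z \<le> w + 1}"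
  have A: "?A = cball 0 (w + 1) - ball 0 w" by (intro set_eqI) (simp add: not_less conj_commute)
  have dim: "unit_ball_vol (real (DIM(real \<times> real))) = pi" by (simp add: unit_ball_vol_2)
  have "emeasure lborel ?A = emeasure lborel (cball (0::real \<times> real) (w + 1)) - emeasure lborel (ball (0::real \<times> real) w)"
    unfolding A using w0 by (intro emeasure_Diff) (auto simp: emeasure_ball dim)
  also have "\<dots> = ennreal (pi * (w + 1)\<^sup>2) - ennreal (pi * w\<^sup>2)"
    using w0 emeasure_cball[of "w + 1" "0 :: real \<times> real"] emeasure_ball[of w "0 :: real \<times> real"] dim
    by (simp add: power2_eq_square)
  also have "\<dots> = ennreal (pi * (2 * w + 1))"
    by (subst ennreal_minus) (simp, intro arg_cong[where f=ennreal], simp add: power2_eq_square algebra_simps)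
  finally have area: "emeasure lborel ?A = ennreal (pi * (2 * w + 1))" .
  have "L * (pi * (2 * w + 1)) \<ge> L * (2 * sqrt (real N))"
  proof (rule mult_left_mono[OF _ L0])
    have "sqrt (real N) \<le> pi * w" unfolding piw using pi_ge_two N0 by (intro real_sqrt_le_mono) auto
    then have "2 * sqrt (real N) \<le> 2 * (pi * w)" by simp
    also have "\<dots> \<le> pi * (2 * w + 1)" using pi_gt_zero by (simp add: algebra_simps)
    finally show "2 * sqrt (real N) \<le> pi * (2 * w + 1)" .
  qed
  moreover have "L * (2 * sqrt (real N)) = 4 * pi * (m * (c1 / pi) * ln (1 + sqrt (real N)))"
    using N0 by (simp add: L_def)
  ultimately have "ennreal (4 * pi * (m * (c1 / pi) * ln (1 + sqrt (real N)))) \<le> ennreal (L * (pi * (2 * w + 1)))"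
    by (intro ennreal_leI) simp
  also have "\<dots> = ennreal L * emeasure lborel ?A" unfolding area using L0 w0 by (simp add: ennreal_mult)
  also have "\<dots> = (\<integral>\<^sup>+z. ennreal L * indicator ?A z \<partial>lborel)"
    unfolding A by (simp add: nn_integral_cmult_indicator)
  also have "\<dots> \<le> (\<integral>\<^sup>+z. (\<integral>\<^sup>+\<theta>. g (cis \<theta> * bargmann_point z) * indicator {-pi..3*pi} \<theta> \<partial>lborel) \<partial>lborel)"
  proof (rule nn_integral_mono)
    fix z
    show "ennreal L * indicator ?A z \<le> (\<integral>\<^sup>+\<theta>. g (cis \<theta> * bargmann_point z) * indicator {-pi..3*pi} \<theta> \<partial>lborel)"
      using circ[of "bargmann_point z"] by (cases "z \<in> ?A") (simp_all del: ennreal_le_iff)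
  qed
  also have "\<dots> = ennreal (3 * pi - (- pi)) * (\<integral>\<^sup>+z. g (bargmann_point z) \<partial>lborel)"
    by (intro nn_integral_circle_average gm) (use pi_gt_zero in linarith)
  also have "3 * pi - (- pi) = 4 * pi" by simp
  finally have "ennreal (4 * pi) * ennreal (m * (c1 / pi) * ln (1 + sqrt (real N))) \<le> ennreal (4 * pi) * (\<integral>\<^sup>+z. g (bargmann_point z) \<partial>lborel)"
    by (subst ennreal_mult'[symmetric]) auto
  then have "ennreal (m * (c1 / pi) * ln (1 + sqrt (real N))) \<le> (\<integral>\<^sup>+z. g (bargmann_point z) \<partial>lborel)"
    by (subst (asm) ennreal_mult_le_mult_iff) auto
  then show ?thesis unfolding g_def P_def[abs_def] c1(2) by (simp add: indicator_def)
qed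

section \<open>Superpositions of coherent states\<close>

definition coherent_weight :: "complex \<Rightarrow> real" where
  "coherent_weight \<eta> = exp (- pi / 2 * (cmod \<eta>)\<^sup>2)"

text \<open>
  The test functions at both endpoints are superpositions of normalised coherent states: series, where
  \<open>\<mu>\<close> is a counting measure, for \<open>M\<^sup>1\<close>, and integrals over a disc in the plane for \<open>M\<^sup>\<infinity>\<close>.
\<close>

definition coherent_mix :: "'i measure \<Rightarrow> ('i \<Rightarrow> complex) \<Rightarrow> ('i \<Rightarrow> complex) \<Rightarrow> distr" where
  "coherent_mix \<mu> m \<eta> g = (LINT \<tau>|\<mu>. m \<tau> * (of_real (coherent_weight (\<eta> \<tau>)) * distr_of (coherent (\<eta> \<tau>)) g))"

lemma coherent_weight_measurable [measurable]: "coherent_weight \<in> borel_measurable borel"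
  unfolding coherent_weight_def[abs_def] by (intro borel_measurable_continuous_onI continuous_intros)

lemma norm_coherent_weight_distr:
  assumes g: "g \<in> schwartz"
  shows "cmod (of_real (coherent_weight \<eta>) * distr_of (coherent \<eta>) g) \<le> 2 * schwartz_seminorm 0 0 g"
proof -
  have s: "schwartz_seminorm 0 0 g \<ge> 0" by (rule order.trans[OF norm_ge_zero schwartz_sup_bound[OF g, of 0]])
  have "cmod (distr_of (coherent \<eta>) g) \<le> 2 powr (1/4) * exp (pi / 2 * (cmod \<eta>)\<^sup>2) * schwartz_seminorm 0 0 g"
    using norm_distr_of_le[OF coherent_integrable g] unfolding integral_norm_coherent .
  then have "coherent_weight \<eta> * cmod (distr_of (coherent \<eta>) g) \<le> coherent_weight \<eta> * (2 powr (1/4) * exp (pi / 2 * (cmod \<eta>)\<^sup>2) * schwartz_seminorm 0 0 g)"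
    by (intro mult_left_mono) (auto simp: coherent_weight_def)
  also have "\<dots> = 2 powr (1/4) * (coherent_weight \<eta> * exp (pi / 2 * (cmod \<eta>)\<^sup>2)) * schwartz_seminorm 0 0 g" by simp
  also have "coherent_weight \<eta> * exp (pi / 2 * (cmod \<eta>)\<^sup>2) = 1" by (simp add: coherent_weight_def flip: exp_add)
  also have "2 powr (1/4) * 1 * schwartz_seminorm 0 0 g \<le> 2 * schwartz_seminorm 0 0 g"
  proof -
    have "2 powr (1/4) \<le> (2::real) powr 1" by (intro powr_mono) auto
    then show ?thesis using s by (intro mult_right_mono) auto
  qed
  finally show ?thesis by (simp add: norm_mult coherent_weight_def)
qed

lemma distr_of_coherent_measurable:
  assumes g: "g \<in> schwartz"
  shows "(\<lambda>\<eta>. distr_of (coherent \<eta>) g) \<in> borel_measurable borel"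
proof -
  have gc: "continuous_on UNIV g" by (rule schwartz_continuous[OF g])
  have "continuous_on UNIV (\<lambda>x :: complex \<times> real. coherent (fst x) (snd x) * g (snd x))"
    unfolding coherent_def by (intro continuous_intros continuous_on_compose2[OF gc]) auto
  then have "(\<lambda>x :: complex \<times> real. coherent (fst x) (snd x) * g (snd x)) \<in> borel_measurable borel"
    by (rule borel_measurable_continuous_onI)
  then have "(\<lambda>(\<eta>, t). coherent \<eta> t * g t) \<in> borel_measurable (borel \<Otimes>\<^sub>M lborel)"
    unfolding split_beta measurable_lborel1[symmetric]
    by (subst measurable_cong_sets[OF sets_pair_measure_cong[OF refl sets_lborel] refl]) (simp add: borel_prod)
  then have "(\<lambda>\<eta>. LINT t|lborel. coherent \<eta> t * g t) \<in> borel_measurable borel"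
    by (rule lborel.borel_measurable_lebesgue_integral)
  then show ?thesis using g by (simp add: distr_of_def)
qed

context
  fixes \<mu> :: "'i measure" and m \<eta> :: "'i \<Rightarrow> complex"
  assumes m: "integrable \<mu> m" and \<eta>: "\<eta> \<in> borel_measurable \<mu>"
begin

lemma coherent_mix_integrable:
  assumes g: "g \<in> schwartz"
  shows "integrable \<mu> (\<lambda>\<tau>. m \<tau> * (of_real (coherent_weight (\<eta> \<tau>)) * distr_of (coherent (\<eta> \<tau>)) g))"
proof (rule Bochner_Integration.integrable_bound[OF integrable_mult_left[OF m, of "complex_of_real (2 * schwartz_seminorm 0 0 g)"]])
  note [measurable] = \<eta> measurable_compose[OF \<eta> distr_of_coherent_measurable[OF g]] borel_measurable_integrable[OF m]
  show "(\<lambda>\<tau>. m \<tau> * (of_real (coherent_weight (\<eta> \<tau>)) * distr_of (coherent (\<eta> \<tau>)) g)) \<in> borel_measurable \<mu>"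
    by measurable
  have s: "schwartz_seminorm 0 0 g \<ge> 0" by (rule order.trans[OF norm_ge_zero schwartz_sup_bound[OF g, of 0]])
  show "AE \<tau> in \<mu>. cmod (m \<tau> * (of_real (coherent_weight (\<eta> \<tau>)) * distr_of (coherent (\<eta> \<tau>)) g)) \<le> cmod (m \<tau> * complex_of_real (2 * schwartz_seminorm 0 0 g))"
  proof (rule AE_I2)
    fix \<tau>
    have "cmod (m \<tau>) * cmod (of_real (coherent_weight (\<eta> \<tau>)) * distr_of (coherent (\<eta> \<tau>)) g) \<le> cmod (m \<tau>) * (2 * schwartz_seminorm 0 0 g)"
      by (intro mult_left_mono norm_coherent_weight_distr g) auto
    then show "cmod (m \<tau> * (of_real (coherent_weight (\<eta> \<tau>)) * distr_of (coherent (\<eta> \<tau>)) g)) \<le> cmod (m \<tau> * complex_of_real (2 * schwartz_seminorm 0 0 g))"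
      using s by (simp add: norm_mult)
  qed
qed

lemma coherent_mix_tempered: "coherent_mix \<mu> m \<eta> \<in> tempered"
proof (rule temperedI)
  have lin: "distr_of (coherent \<zeta>) \<in> tempered" for \<zeta> by (intro distr_of_tempered coherent_integrable)
  show "coherent_mix \<mu> m \<eta> g = 0" if "g \<notin> schwartz" for g
    using that by (simp add: coherent_mix_def distr_of_def)
  show "coherent_mix \<mu> m \<eta> (\<lambda>t. g t + h t) = coherent_mix \<mu> m \<eta> g + coherent_mix \<mu> m \<eta> h" if gh: "g \<in> schwartz" "h \<in> schwartz" for g h
  proof -
    have "distr_of (coherent \<zeta>) (\<lambda>t. g t + h t) = distr_of (coherent \<zeta>) g + distr_of (coherent \<zeta>) h" for \<zeta>
      using lin[of \<zeta>] gh unfolding tempered_def by blast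
    then show ?thesis
      unfolding coherent_mix_def using coherent_mix_integrable[OF gh(1)] coherent_mix_integrable[OF gh(2)]
      by (simp add: distrib_left)
  qed
  show "coherent_mix \<mu> m \<eta> (\<lambda>t. a * g t) = a * coherent_mix \<mu> m \<eta> g" if g: "g \<in> schwartz" for a g
  proof -
    have "distr_of (coherent \<zeta>) (\<lambda>t. a * g t) = a * distr_of (coherent \<zeta>) g" for \<zeta>
      using lin[of \<zeta>] g unfolding tempered_def by blast
    then show ?thesis
      unfolding coherent_mix_def by (simp add: mult.left_commute[of _ a])
  qed
  show "cmod (coherent_mix \<mu> m \<eta> g) \<le> (LINT \<tau>|\<mu>. cmod (m \<tau>)) * 2 * schwartz_seminorm 0 0 g" if g: "g \<in> schwartz" for g
  proof -
    have "cmod (coherent_mix \<mu> m \<eta> g) \<le> (LINT \<tau>|\<mu>. cmod (m \<tau> * (of_real (coherent_weight (\<eta> \<tau>)) * distr_of (coherent (\<eta> \<tau>)) g)))"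
      unfolding coherent_mix_def by (rule integral_norm_bound)
    also have "\<dots> \<le> (LINT \<tau>|\<mu>. cmod (m \<tau>) * (2 * schwartz_seminorm 0 0 g))"
    proof (rule integral_mono)
      show "integrable \<mu> (\<lambda>\<tau>. cmod (m \<tau> * (of_real (coherent_weight (\<eta> \<tau>)) * distr_of (coherent (\<eta> \<tau>)) g)))"
        by (intro integrable_norm coherent_mix_integrable g)
      show "integrable \<mu> (\<lambda>\<tau>. cmod (m \<tau>) * (2 * schwartz_seminorm 0 0 g))"
        by (intro integrable_mult_left integrable_norm m)
      show "cmod (m \<tau> * (of_real (coherent_weight (\<eta> \<tau>)) * distr_of (coherent (\<eta> \<tau>)) g)) \<le> cmod (m \<tau>) * (2 * schwartz_seminorm 0 0 g)" for \<tau>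
        unfolding norm_mult[of "m \<tau>"] by (intro mult_left_mono norm_coherent_weight_distr g) auto
    qed
    finally show ?thesis by simp
  qed
qed

lemma coherent_mix_coherent:
  "coherent_mix \<mu> m \<eta> (coherent \<zeta>) = (LINT \<tau>|\<mu>. m \<tau> * (of_real (coherent_weight (\<eta> \<tau>)) * exp (of_real pi * \<eta> \<tau> * \<zeta>)))"
  using coherent_schwartz by (simp add: coherent_mix_def distr_of_def integral_coherent_coherent)

lemma coherent_mix_mode:
  "coherent_mix \<mu> m \<eta> (hermite_mode n) = (LINT \<tau>|\<mu>. m \<tau> * (of_real (coherent_weight (\<eta> \<tau>)) * ((of_real pi * \<eta> \<tau>) ^ n / fact n)))"
  using hermite_mode_schwartz by (simp add: coherent_mix_def distr_of_def integral_coherent_hermite_mode)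

lemma coherent_mix_mode_integrable:
  "integrable \<mu> (\<lambda>\<tau>. m \<tau> * (of_real (coherent_weight (\<eta> \<tau>)) * ((of_real pi * \<eta> \<tau>) ^ n / fact n)))"
  using coherent_mix_integrable[OF hermite_mode_schwartz[of n]] hermite_mode_schwartz
  by (simp add: distr_of_def integral_coherent_hermite_mode)

end

definition gauss_mass :: ennreal where
  "gauss_mass = (\<integral>\<^sup>+z. ennreal (exp (- pi / 2 * (norm z)\<^sup>2)) \<partial>(lborel :: (real \<times> real) measure))"

lemma gauss_mass_finite: "gauss_mass < \<infinity>"
proof -
  let ?h = "\<lambda>t::real. ennreal (exp (- pi * (1/2) * (t - 0)\<^sup>2))"
  have h: "(\<integral>\<^sup>+t. ?h t \<partial>lborel) < \<infinity>"
    using integral_gaussian(1)[of "1/2" 0] by (auto simp: integrable_iff_bounded)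
  have [measurable]: "?h \<in> borel_measurable lborel" by measurable
  have "gauss_mass = (\<integral>\<^sup>+z. ?h (fst z) * ?h (snd z) \<partial>(lborel \<Otimes>\<^sub>M lborel))"
    unfolding gauss_mass_def lborel_prod
    by (intro nn_integral_cong)
       (simp add: norm_prod_def ennreal_mult[symmetric] exp_add[symmetric] algebra_simps)
  also have "\<dots> = (\<integral>\<^sup>+x. \<integral>\<^sup>+y. ?h x * ?h y \<partial>lborel \<partial>lborel)"
    by (subst lborel.nn_integral_fst[symmetric]) (auto intro!: measurable_compose[OF measurable_fst] measurable_compose[OF measurable_snd])
  also have "\<dots> = (\<integral>\<^sup>+x. ?h x \<partial>lborel) * (\<integral>\<^sup>+y. ?h y \<partial>lborel)"
    by (simp add: nn_integral_cmult nn_integral_multc del: diff_zero)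
  also have "\<dots> < \<infinity>" using h by (simp add: ennreal_mult_less_top)
  finally show ?thesis .
qed

lemma gauss_mass_translate:
  "(\<integral>\<^sup>+z. ennreal (exp (- pi / 2 * (cmod (bargmann_point z - \<xi>))\<^sup>2)) \<partial>lborel) = gauss_mass"
proof -
  define z0 :: "real \<times> real" where "z0 = (- Re \<xi>, Im \<xi>)"
  have "cmod (bargmann_point z - \<xi>) = norm (z0 + z)" for z
    by (simp add: bargmann_point_def z0_def cmod_def norm_prod_def power2_eq_square algebra_simps)
  then have "(\<integral>\<^sup>+z. ennreal (exp (- pi / 2 * (cmod (bargmann_point z - \<xi>))\<^sup>2)) \<partial>lborel)
     = (\<integral>\<^sup>+z. ennreal (exp (- pi / 2 * (norm (z0 + z))\<^sup>2)) \<partial>lborel)" by simp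
  also have "\<dots> = (\<integral>\<^sup>+z. ennreal (exp (- pi / 2 * (norm z)\<^sup>2)) \<partial>distr lborel borel ((+) z0))"
    by (subst nn_integral_distr) auto
  also have "\<dots> = gauss_mass" by (simp add: lborel_distr_plus gauss_mass_def)
  finally show ?thesis .
qed

text \<open>
  Complete the square: the Bargmann transform of a normalised coherent state is a Gaussian bump of fixed
  shape around \<open>cnj \<eta>\<close>.
\<close>

lemma coherent_kernel_abs:
  "cmod (of_real (coherent_weight \<eta>) * exp (of_real pi * \<eta> * \<zeta>)) * exp (- pi / 2 * (cmod \<zeta>)\<^sup>2) = exp (- pi / 2 * (cmod (\<zeta> - cnj \<eta>))\<^sup>2)"
proof -
  have "- pi / 2 * (cmod \<eta>)\<^sup>2 + pi * Re (\<eta> * \<zeta>) + - pi / 2 * (cmod \<zeta>)\<^sup>2 = - pi / 2 * (cmod (\<zeta> - cnj \<eta>))\<^sup>2"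
    unfolding cmod_power2 by (simp add: power2_eq_square algebra_simps)
  moreover have "cmod (of_real (coherent_weight \<eta>) * exp (of_real pi * \<eta> * \<zeta>)) = exp (- pi / 2 * (cmod \<eta>)\<^sup>2 + pi * Re (\<eta> * \<zeta>))"
    unfolding exp_add by (simp add: norm_mult coherent_weight_def mult.assoc)
  ultimately show ?thesis by (simp add: exp_add[symmetric])
qed

lemma fock_abs_coherent_mix_le:
  assumes m: "integrable \<mu> m" and \<eta>: "\<eta> \<in> borel_measurable \<mu>"
  shows "ennreal (fock_abs (\<lambda>\<zeta>. coherent_mix \<mu> m \<eta> (coherent \<zeta>)) \<zeta>)
     \<le> (\<integral>\<^sup>+\<tau>. ennreal (cmod (m \<tau>) * exp (- pi / 2 * (cmod (\<zeta> - cnj (\<eta> \<tau>)))\<^sup>2)) \<partial>\<mu>)"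
proof -
  let ?f = "\<lambda>\<tau>. m \<tau> * (of_real (coherent_weight (\<eta> \<tau>)) * exp (of_real pi * \<eta> \<tau> * \<zeta>))"
  let ?e = "exp (- pi / 2 * (cmod \<zeta>)\<^sup>2)"
  note [measurable] = \<eta> borel_measurable_integrable[OF m]
  have "ennreal (fock_abs (\<lambda>\<zeta>. coherent_mix \<mu> m \<eta> (coherent \<zeta>)) \<zeta>) = ennreal (cmod (LINT \<tau>|\<mu>. ?f \<tau>)) * ennreal ?e"
    unfolding fock_abs_def coherent_mix_coherent[OF m \<eta>] by (simp add: ennreal_mult)
  also have "\<dots> \<le> (\<integral>\<^sup>+\<tau>. ennreal (cmod (?f \<tau>)) \<partial>\<mu>) * ennreal ?e"
  proof (intro mult_right_mono)
    have "integrable \<mu> ?f"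
      using coherent_mix_integrable[OF m \<eta> coherent_schwartz, of \<zeta>] coherent_schwartz
      by (simp add: distr_of_def integral_coherent_coherent)
    then show "ennreal (cmod (LINT \<tau>|\<mu>. ?f \<tau>)) \<le> (\<integral>\<^sup>+\<tau>. ennreal (cmod (?f \<tau>)) \<partial>\<mu>)"
      by (rule integral_norm_bound_ennreal)
  qed simp
  also have "\<dots> = (\<integral>\<^sup>+\<tau>. ennreal (cmod (?f \<tau>)) * ennreal ?e \<partial>\<mu>)"
    by (rule nn_integral_multc[symmetric]) measurable
  also have "\<dots> = (\<integral>\<^sup>+\<tau>. ennreal (cmod (m \<tau>) * exp (- pi / 2 * (cmod (\<zeta> - cnj (\<eta> \<tau>)))\<^sup>2)) \<partial>\<mu>)"
    unfolding coherent_kernel_abs[symmetric] by (simp add: norm_mult mult.assoc flip: ennreal_mult)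
  finally show ?thesis .
qed

section \<open>Unboundedness at the endpoints\<close>

lemma fock_int_1: "fock_int 1 F = (\<integral>\<^sup>+z. ennreal (fock_abs F (bargmann_point z)) \<partial>lborel)"
  unfolding fock_int_def by (simp add: fock_abs_nonneg)

lemma mod_norm_1:
  assumes "\<And>z. pairing f (tf_shift z gaussian) = bargmann_factor z * F (bargmann_point z)"
  shows "mod_norm 1 f = fock_int 1 F"
  using mod_norm_fock_int[OF assms, where p=1] by (simp add: lp_root_1)

text \<open>
  All the coherent states involved have nonnegative Taylor coefficients. The coefficients of the sum are
  therefore at least those of each summand, and no cancellation between different summands has to be
  excluded.
\<close>

lemma coherent_sequence_lower_bound:
  fixes m :: "nat \<Rightarrow> real" and N :: "nat \<Rightarrow> nat"
  assumes m0: "\<And>j. m j \<ge> 0" and ms: "summable m" and N: "\<And>j. N j \<ge> 1"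
  shows "\<exists>f\<in>tempered. mod_norm 1 f \<le> ennreal (suminf m) * gauss_mass \<and>
        (\<forall>j. ennreal (m j * annulus_const * ln (1 + sqrt (real (N j)))) \<le> mod_norm 1 (hermite_partial (N j) f))"
proof -
  define w where "w j = sqrt (real (N j) / pi)" for j
  have w0: "w j \<ge> 0" for j by (simp add: w_def)
  let ?\<mu> = "count_space (UNIV :: nat set)"
  let ?m = "\<lambda>j. complex_of_real (m j)" and ?w = "\<lambda>j. complex_of_real (w j)"
  have mi: "integrable ?\<mu> ?m" using ms m0 by (simp add: integrable_count_space_nat_iff)
  have wm: "?w \<in> borel_measurable ?\<mu>" by simp
  define f where "f = coherent_mix ?\<mu> ?m ?w"
  have ft: "f \<in> tempered" unfolding f_def by (rule coherent_mix_tempered[OF mi wm])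
  have "mod_norm 1 f = fock_int 1 (\<lambda>\<zeta>. f (coherent \<zeta>))"
    by (rule mod_norm_1[OF pairing_tf_shift[OF ft]])
  also have "\<dots> \<le> (\<integral>\<^sup>+z. (\<integral>\<^sup>+j. ennreal (cmod (?m j) * exp (- pi / 2 * (cmod (bargmann_point z - cnj (?w j)))\<^sup>2)) \<partial>?\<mu>) \<partial>lborel)"
    unfolding fock_int_1 f_def by (intro nn_integral_mono fock_abs_coherent_mix_le mi wm)
  also have "\<dots> = (\<Sum>j. (\<integral>\<^sup>+z. ennreal (m j) * ennreal (exp (- pi / 2 * (cmod (bargmann_point z - cnj (?w j)))\<^sup>2)) \<partial>lborel))"
    unfolding nn_integral_count_space_nat using m0 by (subst nn_integral_suminf) (auto simp: ennreal_mult)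
  also have "\<dots> = (\<Sum>j. ennreal (m j) * gauss_mass)"
  proof (intro suminf_cong)
    fix j
    have "(\<integral>\<^sup>+z. ennreal (m j) * ennreal (exp (- pi / 2 * (cmod (bargmann_point z - cnj (?w j)))\<^sup>2)) \<partial>lborel)
       = ennreal (m j) * (\<integral>\<^sup>+z. ennreal (exp (- pi / 2 * (cmod (bargmann_point z - cnj (?w j)))\<^sup>2)) \<partial>lborel)"
      by (rule nn_integral_cmult) measurable
    then show "(\<integral>\<^sup>+z. ennreal (m j) * ennreal (exp (- pi / 2 * (cmod (bargmann_point z - cnj (?w j)))\<^sup>2)) \<partial>lborel)
       = ennreal (m j) * gauss_mass" by (simp only: gauss_mass_translate)
  qed
  also have "\<dots> = ennreal (suminf m) * gauss_mass"
    using m0 ms by (simp add: ennreal_suminf_multc suminf_ennreal2)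
  finally have upper: "mod_norm 1 f \<le> ennreal (suminf m) * gauss_mass" .
  define t where "t n j = m j * (exp (- real (N j) / 2) * (pi * w j) ^ n / fact n)" for n j
  define b where "b n = (\<Sum>j. t n j)" for n
  have t0: "t n j \<ge> 0" for n j using m0 w0 by (simp add: t_def)
  have cw: "coherent_weight (?w j) = exp (- real (N j) / 2)" for j
    by (simp add: coherent_weight_def w_def)
  have te: "?m j * (of_real (coherent_weight (?w j)) * ((of_real pi * ?w j) ^ n / fact n)) = of_real (t n j)" for n j
    by (simp add: t_def cw)
  have ti: "integrable ?\<mu> (\<lambda>j. complex_of_real (t n j))" for n
    using coherent_mix_mode_integrable[OF mi wm, of n] unfolding te .
  have ts: "summable (t n)" for n
    using ti[of n] t0 by (simp add: integrable_count_space_nat_iff)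
  have fb: "f (hermite_mode n) = of_real (b n)" for n
  proof -
    have "f (hermite_mode n) = (LINT j|?\<mu>. complex_of_real (t n j))"
      unfolding f_def coherent_mix_mode[OF mi wm] te ..
    also have "\<dots> = (\<Sum>j. complex_of_real (t n j))" by (rule integral_count_space_nat[OF ti])
    also have "\<dots> = of_real (b n)" unfolding b_def by (rule suminf_of_real[OF ts, symmetric])
    finally show ?thesis .
  qed
  have bge: "t n j \<le> b n" for n j
    using sum_le_suminf[OF ts, of "{j}" n] t0 by (simp add: b_def)
  have "ennreal (m j * annulus_const * ln (1 + sqrt (real (N j)))) \<le> mod_norm 1 (hermite_partial (N j) f)" for j
  proof -
    let ?P = "taylor_upto (N j) (\<lambda>n. complex_of_real (b n))"
    have "ennreal (m j * annulus_const * ln (1 + sqrt (real (N j)))) \<le>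
        (\<integral>\<^sup>+z. ennreal (fock_abs ?P (bargmann_point z)) * indicator {z. norm z \<le> w j + 1} z \<partial>lborel)"
      by (rule fock_annulus_lower_bound[OF N w_def m0]) (use bge in \<open>simp add: t_def\<close>)
    also have "\<dots> \<le> (\<integral>\<^sup>+z. ennreal (fock_abs ?P (bargmann_point z)) \<partial>lborel)"
      by (intro nn_integral_mono) (simp split: split_indicator)
    also have "\<dots> = mod_norm 1 (hermite_partial (N j) f)"
      using mod_norm_1[OF pairing_hermite_partial[OF ft]] by (simp add: fock_int_1 fb)
    finally show ?thesis .
  qed
  with upper ft show ?thesis by blast
qed

text \<open>
  This is dual to the case of \<open>M\<^sup>1\<close>. Let \<open>P\<close> be the Bargmann transform of the truncated coherent state at
  \<open>w\<close>. A superposition of coherent states with weights \<open>cnj (sgn P)\<close> is bounded in \<open>M\<^sup>\<infinity>\<close>, and the value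
  at \<open>w\<close> of its truncation is the weighted integral of \<open>|P|\<close>, which is bounded below by the annulus
  estimate.
\<close>

lemma hermite_partial_lower_bound_infinity:
  assumes N: "N \<ge> 1"
  shows "\<exists>f\<in>tempered. mod_norm \<infinity> f \<le> gauss_mass \<and>
        ennreal (annulus_const * ln (1 + sqrt (real N))) \<le> mod_norm \<infinity> (hermite_partial N f)"
proof -
  define w where "w = sqrt (real N / pi)"
  define b where "b n = exp (- real N / 2) * (pi * w) ^ n / fact n" for n
  define P where "P \<zeta> = (\<Sum>n\<le>N. complex_of_real (b n) * \<zeta> ^ n)" for \<zeta>
  have cP: "continuous_on UNIV P" unfolding P_def by (intro continuous_intros)
  let ?D = "{u :: real \<times> real. norm u \<le> w + 1}"
  have D: "?D = cball 0 (w + 1)" by (intro set_eqI) simp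
  have D_meas: "?D \<in> sets lborel" unfolding D by simp
  \<comment> \<open>The phase of the weight cancels that of \<open>P\<close>. The cut-off makes the weight integrable; the lower bound
    of \<open>fock_annulus_lower_bound\<close> is already attained on this disc.\<close>
  define m where "m u = indicator ?D u * cnj (sgn (P (bargmann_point u)))" for u
  have [measurable]: "P \<in> borel_measurable borel" by (rule borel_measurable_continuous_onI[OF cP])
  have cnj_m [measurable]: "cnj \<in> borel_measurable borel"
    by (intro borel_measurable_continuous_onI continuous_intros)
  have sgn_m [measurable]: "(\<lambda>z. cnj (sgn z)) \<in> borel_measurable borel"
    unfolding sgn_eq by measurable
  have mi: "integrable lborel m"
  proof (rule Bochner_Integration.integrable_bound[where f="\<lambda>u. indicator ?D u :: real"])
    show "integrable lborel (\<lambda>u. indicator ?D u :: real)"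
      unfolding D by (intro integrable_real_indicator) (use emeasure_bounded_finite[OF bounded_cball, of "0 :: real \<times> real" "w + 1"] in simp_all)
    show "m \<in> borel_measurable lborel" unfolding m_def[abs_def] using D_meas measurable_compose[OF measurable_compose[OF bargmann_point_measurable borel_measurable_continuous_onI[OF cP]] sgn_m]
      by (intro borel_measurable_times borel_measurable_indicator) simp_all
    show "AE u in lborel. norm (m u) \<le> norm (indicator ?D u :: real)"
      by (intro AE_I2) (auto simp: m_def norm_mult norm_sgn split: split_indicator)
  qed
  have bm: "bargmann_point \<in> borel_measurable lborel" by simp
  define f where "f = coherent_mix lborel m bargmann_point"
  have ft: "f \<in> tempered" unfolding f_def by (rule coherent_mix_tempered[OF mi bm])
  have "ennreal (fock_abs (\<lambda>\<zeta>. f (coherent \<zeta>)) \<zeta>) \<le> gauss_mass" for \<zeta>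
  proof -
    have "ennreal (fock_abs (\<lambda>\<zeta>. f (coherent \<zeta>)) \<zeta>) \<le> (\<integral>\<^sup>+u. ennreal (cmod (m u) * exp (- pi / 2 * (cmod (\<zeta> - cnj (bargmann_point u)))\<^sup>2)) \<partial>lborel)"
      unfolding f_def by (rule fock_abs_coherent_mix_le[OF mi bm])
    also have "\<dots> \<le> (\<integral>\<^sup>+u. ennreal (exp (- pi / 2 * (cmod (bargmann_point u - cnj \<zeta>))\<^sup>2)) \<partial>lborel)"
    proof (intro nn_integral_mono ennreal_leI)
      fix u
      have "cmod (m u) \<le> 1" by (auto simp: m_def norm_mult norm_sgn split: split_indicator)
      moreover have "cmod (\<zeta> - cnj (bargmann_point u)) = cmod (bargmann_point u - cnj \<zeta>)"
        using complex_mod_cnj[of "\<zeta> - cnj (bargmann_point u)"] by (simp del: complex_mod_cnj add: norm_minus_commute)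
      ultimately show "cmod (m u) * exp (- pi / 2 * (cmod (\<zeta> - cnj (bargmann_point u)))\<^sup>2) \<le> exp (- pi / 2 * (cmod (bargmann_point u - cnj \<zeta>))\<^sup>2)"
        by (simp add: mult_left_le_one_le)
    qed
    also have "\<dots> = gauss_mass" by (rule gauss_mass_translate)
    finally show ?thesis .
  qed
  then have upper: "mod_norm \<infinity> f \<le> gauss_mass"
    unfolding mod_norm_infinity[OF pairing_tf_shift[OF ft]] by (intro SUP_least)
  have sgnP: "cnj (sgn z) * z = of_real (cmod z)" for z :: complex
    by (cases "z = 0") (simp_all add: sgn_eq complex_norm_square[symmetric] mult.commute[of _ z] power2_eq_square)
  let ?h = "\<lambda>u. fock_abs P (bargmann_point u) * indicator ?D u"
  have nb: "complex_of_real (exp (real N / 2)) * complex_of_real (b n) = of_real ((pi * w) ^ n / fact n)" for n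
    unfolding of_real_mult[symmetric] b_def by (simp add: exp_minus)
  have integrand: "(\<Sum>n\<le>N. m u * (of_real (coherent_weight (bargmann_point u)) * ((of_real pi * bargmann_point u) ^ n / fact n)) * of_real w ^ n)
     = of_real (exp (real N / 2) * ?h u)" for u
  proof -
    let ?z = "bargmann_point u" and ?c = "complex_of_real (coherent_weight (bargmann_point u))"
    have "m u * (?c * ((of_real pi * ?z) ^ n / fact n)) * of_real w ^ n = m u * ?c * (of_real ((pi * w) ^ n / fact n) * ?z ^ n)" for n
      by (simp add: power_mult_distrib)
    then have "(\<Sum>n\<le>N. m u * (?c * ((of_real pi * ?z) ^ n / fact n)) * of_real w ^ n) = m u * ?c * (of_real (exp (real N / 2)) * P ?z)"
      unfolding nb[symmetric] by (simp add: P_def sum_distrib_left mult.assoc)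
    also have "\<dots> = ?c * of_real (exp (real N / 2)) * (indicator ?D u * (cnj (sgn (P ?z)) * P ?z))"
      by (simp add: m_def)
    also have "\<dots> = of_real (exp (real N / 2) * ?h u)"
      unfolding sgnP by (simp add: fock_abs_def coherent_weight_def split: split_indicator)
    finally show ?thesis .
  qed
  have "hermite_partial N f (coherent (of_real w)) = (\<Sum>n\<le>N. f (hermite_mode n) * of_real w ^ n)"
    by (rule hermite_partial_coherent[OF ft])
  also have "\<dots> = (LINT u|lborel. (\<Sum>n\<le>N. m u * (of_real (coherent_weight (bargmann_point u)) * ((of_real pi * bargmann_point u) ^ n / fact n)) * of_real w ^ n))"
    unfolding f_def coherent_mix_mode[OF mi bm]
    by (subst Bochner_Integration.integral_sum) (intro integrable_mult_left coherent_mix_mode_integrable[OF mi bm], simp)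
  also have "\<dots> = of_real (LINT u|lborel. exp (real N / 2) * ?h u)"
    unfolding integrand by (rule integral_complex_of_real)
  finally have val: "hermite_partial N f (coherent (of_real w)) = of_real (exp (real N / 2) * (LINT u|lborel. ?h u))"
    by simp
  have hi: "integrable lborel ?h"
  proof -
    have "integrable lborel (\<lambda>u. complex_of_real (exp (real N / 2) * ?h u))"
      unfolding integrand[symmetric]
      by (intro Bochner_Integration.integrable_sum integrable_mult_left coherent_mix_mode_integrable[OF mi bm])
    from integrable_Re[OF this] have "integrable lborel (\<lambda>u. exp (real N / 2) * ?h u)"
      by (simp only: Re_complex_of_real)
    from integrable_mult_right[OF this, of "exp (- (real N / 2))"] show ?thesis
      by (simp add: exp_minus)
  qed
  have "ennreal (1 * annulus_const * ln (1 + sqrt (real N))) \<le>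
     (\<integral>\<^sup>+z. ennreal (fock_abs (taylor_upto N (\<lambda>n. of_real (b n))) (bargmann_point z)) * indicator ?D z \<partial>lborel)"
    by (rule fock_annulus_lower_bound[OF N w_def]) (simp_all add: b_def)
  also have "\<dots> = (\<integral>\<^sup>+z. ennreal (?h z) \<partial>lborel)"
    by (intro nn_integral_cong) (simp add: P_def[abs_def] split: split_indicator)
  also have "\<dots> = ennreal (LINT u|lborel. ?h u)"
    by (rule nn_integral_eq_integral[OF hi]) (simp add: fock_abs_nonneg)
  also have "\<dots> = ennreal (fock_abs (\<lambda>\<zeta>. hermite_partial N f (coherent \<zeta>)) (bargmann_point (w, 0)))"
  proof -
    have "bargmann_point (w, 0) = of_real w" by (simp add: bargmann_point_def complex_eq_iff)
    moreover have "(LINT u|lborel. ?h u) \<ge> 0" by (intro Bochner_Integration.integral_nonneg) (simp add: fock_abs_nonneg)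
    moreover have "exp (- pi / 2 * w\<^sup>2) * exp (real N / 2) = 1" by (simp add: w_def flip: exp_add)
    ultimately show ?thesis
      unfolding fock_abs_def[of "\<lambda>\<zeta>. hermite_partial N f (coherent \<zeta>)"] by (simp add: val norm_mult mult_ac)
  qed
  also have "\<dots> \<le> mod_norm \<infinity> (hermite_partial N f)"
    unfolding mod_norm_infinity[OF pairing_tf_shift[OF hermite_partial_tempered[OF ft]]] by (intro SUP_upper) simp
  finally show ?thesis using ft upper by auto
qed

section \<open>Hermite expansions in modulation spaces\<close>

lemma ln_sqrt_unbounded: "\<exists>N::nat. N \<ge> 1 \<and> N \<ge> M \<and> ln (1 + sqrt (real N)) \<ge> B"
proof -
  define N where "N = max (max 1 M) (nat \<lceil>(exp B)\<^sup>2\<rceil>)"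
  have "(exp B)\<^sup>2 \<le> real N" unfolding N_def by linarith
  then have "exp B \<le> sqrt (real N)" using real_le_rsqrt by blast
  then have "exp B \<le> 1 + sqrt (real N)" by linarith
  then have "B \<le> ln (1 + sqrt (real N))" by (simp add: ln_ge_iff add_pos_nonneg)
  then show ?thesis unfolding N_def by (intro exI[of _ N]) (auto simp: N_def)
qed

text \<open>
  Indeed \<open>(1 + sqrt N) ^ 4 \<ge> (1 + N)\<^sup>2 \<ge> 2 * N\<close>.
\<close>

lemma ln_le_ln_sqrt:
  assumes "N \<ge> 1"
  shows "ln (2 * real N) \<le> 4 * ln (1 + sqrt (real N))"
proof -
  have "1 + real N \<le> (1 + sqrt (real N))\<^sup>2" by (simp add: power2_eq_square algebra_simps)
  then have "(1 + real N)\<^sup>2 \<le> ((1 + sqrt (real N))\<^sup>2)\<^sup>2" by (intro power_mono) auto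
  moreover have "2 * real N \<le> (1 + real N)\<^sup>2" by (simp add: power2_eq_square algebra_simps)
  ultimately have "2 * real N \<le> (1 + sqrt (real N)) ^ 4" by (simp add: power_mult[symmetric])
  then have "ln (2 * real N) \<le> ln ((1 + sqrt (real N)) ^ 4)" using assms by (intro ln_mono) auto
  also have "\<dots> = 4 * ln (1 + sqrt (real N))" by (simp add: ln_realpow add_pos_nonneg)
  finally show ?thesis .
qed

lemma mod_norm_1_triangle:
  assumes f: "f \<in> tempered"
  shows "mod_norm 1 (hermite_partial N f) \<le> mod_norm 1 (\<lambda>g. hermite_partial N f g - f g) + mod_norm 1 f"
proof -
  let ?F = "taylor (\<lambda>n. f (hermite_mode n))" and ?P = "taylor_upto N (\<lambda>n. f (hermite_mode n))"
  have cF: "continuous_on UNIV ?F" by (rule taylor_continuous[OF tempered_fock_series(1)[OF f]])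
  have cP: "continuous_on UNIV (\<lambda>\<zeta>. ?P \<zeta> - ?F \<zeta>)" by (intro continuous_intros cF)
  note [measurable] = fock_abs_measurable[OF cF] fock_abs_measurable[OF cP]
  have le: "fock_abs ?P \<zeta> \<le> fock_abs (\<lambda>\<zeta>. ?P \<zeta> - ?F \<zeta>) \<zeta> + fock_abs ?F \<zeta>" for \<zeta>
  proof -
    have "cmod (a + b) * e \<le> cmod a * e + cmod b * e" if "e \<ge> 0" for a b :: complex and e
      unfolding distrib_right[symmetric] using that by (intro mult_right_mono norm_triangle_ineq)
    from this[of _ "?P \<zeta> - ?F \<zeta>" "?F \<zeta>"] show ?thesis by (simp add: fock_abs_def)
  qed
  have "fock_int 1 ?P \<le> (\<integral>\<^sup>+z. ennreal (fock_abs (\<lambda>\<zeta>. ?P \<zeta> - ?F \<zeta>) (bargmann_point z)) + ennreal (fock_abs ?F (bargmann_point z)) \<partial>lborel)"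
    unfolding fock_int_1
    by (intro nn_integral_mono) (simp add: le fock_abs_nonneg flip: ennreal_plus)
  also have "\<dots> = fock_int 1 (\<lambda>\<zeta>. ?P \<zeta> - ?F \<zeta>) + fock_int 1 ?F"
    unfolding fock_int_1 by (rule nn_integral_add) measurable
  finally show ?thesis
    unfolding mod_norm_1[OF pairing_hermite_partial[OF f]] mod_norm_1[OF pairing_hermite_partial_diff[OF f]]
      mod_norm_1[OF pairing_tempered[OF f]] .
qed

theorem theorem1p2:
  shows
    "(\<forall>p::ennreal. 1 \<le> p \<longrightarrow>
        ((\<exists>C::real. C > 0 \<and> (\<forall>N::nat. N \<ge> 1 \<longrightarrow> (\<forall>f\<in>mod_space p.
            mod_norm p (hermite_partial N f) \<le> ennreal C * mod_norm p f)))
         \<longleftrightarrow> 1 < p \<and> p < \<infinity>))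
     \<and> (\<exists>c C::real. c > 1 \<and> C > 0 \<and> (\<forall>N::nat. N \<ge> 1 \<longrightarrow>
          mod_opnorm 1 (hermite_partial N) \<ge> ennreal (C * ln (c * real N))))
     \<and> (\<forall>p::ennreal. 1 < p \<and> p < \<infinity> \<longrightarrow> (\<forall>f\<in>mod_space p.
          (\<lambda>N. mod_norm p (\<lambda>g. hermite_partial N f g - f g)) \<longlonglongrightarrow> 0))
     \<and> (\<exists>f\<in>mod_space 1.
          limsup (\<lambda>N. mod_norm 1 (hermite_partial N f)) = \<infinity>
          \<and> \<not> (\<lambda>N. mod_norm 1 (\<lambda>g. hermite_partial N f g - f g)) \<longlonglongrightarrow> 0)"
proof -
  define c1 where "c1 = annulus_const"
  have c1: "c1 > 0" by (simp add: c1_def annulus_const_pos)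
  note seq = coherent_sequence_lower_bound[folded c1_def] and inf = hermite_partial_lower_bound_infinity[folded c1_def]
  \<comment> \<open>A finite bound for the norm of a normalised coherent state; the summand 1 makes it positive.\<close>
  define G where "G = enn2real gauss_mass + 1"
  have G: "G > 0" by (simp add: G_def add_nonneg_pos)
  have gauss_le: "gauss_mass \<le> ennreal G"
    using gauss_mass_finite unfolding G_def by (cases gauss_mass) auto
  \<comment> \<open>A single coherent state, scaled into the unit ball.\<close>
  have one: "\<exists>f\<in>mod_space 1. mod_norm 1 f \<le> 1 \<and> ennreal (c1 / G * ln (1 + sqrt (real N))) \<le> mod_norm 1 (hermite_partial N f)"
    if N: "N \<ge> 1" for N
  proof -
    define m where "m j = (if j = 0 then 1 / G else 0)" for j :: nat
    have "m sums (1 / G)" unfolding m_def[abs_def] by (rule sums_single[of 0 "\<lambda>_. 1 / G"])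
    then have m: "summable m" "suminf m = 1 / G" by (auto simp: sums_iff)
    have m0: "m j \<ge> 0" for j using G by (simp add: m_def)
    obtain f where f: "f \<in> tempered" "mod_norm 1 f \<le> ennreal (1 / G) * gauss_mass"
      "\<And>j. ennreal (m j * c1 * ln (1 + sqrt (real N))) \<le> mod_norm 1 (hermite_partial N f)"
      using seq[of m "\<lambda>_. N"] m0 m N by metis
    have "mod_norm 1 f \<le> ennreal (1 / G) * ennreal G"
      by (rule order.trans[OF f(2)]) (intro mult_left_mono gauss_le, simp)
    also have "\<dots> = 1" using G by (simp flip: ennreal_mult)
    finally have le: "mod_norm 1 f \<le> 1" .
    then have "mod_norm 1 f < \<infinity>" by (rule le_less_trans) simp
    then show ?thesis using f(1,3) f(3)[of 0] le by (intro bexI[of _ f]) (auto simp: mod_space_def m_def)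
  qed
  have no_C1: "\<not> (\<exists>C::real. C > 0 \<and> (\<forall>N::nat. N \<ge> 1 \<longrightarrow> (\<forall>f\<in>mod_space 1. mod_norm 1 (hermite_partial N f) \<le> ennreal C * mod_norm 1 f)))"
  proof
    assume "\<exists>C::real. C > 0 \<and> (\<forall>N::nat. N \<ge> 1 \<longrightarrow> (\<forall>f\<in>mod_space 1. mod_norm 1 (hermite_partial N f) \<le> ennreal C * mod_norm 1 f))"
    then obtain C :: real where C: "C > 0" "\<And>N f. N \<ge> 1 \<Longrightarrow> f \<in> mod_space 1 \<Longrightarrow> mod_norm 1 (hermite_partial N f) \<le> ennreal C * mod_norm 1 f" by blast
    obtain N :: nat where N: "N \<ge> 1" "ln (1 + sqrt (real N)) \<ge> (C + 1) * G / c1" using ln_sqrt_unbounded by blast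
    obtain f where f: "f \<in> mod_space 1" "mod_norm 1 f \<le> 1" "ennreal (c1 / G * ln (1 + sqrt (real N))) \<le> mod_norm 1 (hermite_partial N f)"
      using one[OF N(1)] by blast
    have "C + 1 \<le> c1 / G * ln (1 + sqrt (real N))" using N(2) c1 G by (simp add: field_simps)
    then have "ennreal (C + 1) \<le> ennreal (c1 / G * ln (1 + sqrt (real N)))" by (rule ennreal_leI)
    also have "\<dots> \<le> ennreal C * mod_norm 1 f" using f(3) C(2)[OF N(1) f(1)] by (rule order.trans)
    also have "\<dots> \<le> ennreal C * 1" by (intro mult_left_mono f(2)) simp
    finally show False using C(1) by (simp del: ennreal_plus)
  qed
  have no_Cinf: "\<not> (\<exists>C::real. C > 0 \<and> (\<forall>N::nat. N \<ge> 1 \<longrightarrow> (\<forall>f\<in>mod_space \<infinity>. mod_norm \<infinity> (hermite_partial N f) \<le> ennreal C * mod_norm \<infinity> f)))"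
  proof
    assume "\<exists>C::real. C > 0 \<and> (\<forall>N::nat. N \<ge> 1 \<longrightarrow> (\<forall>f\<in>mod_space \<infinity>. mod_norm \<infinity> (hermite_partial N f) \<le> ennreal C * mod_norm \<infinity> f))"
    then obtain C :: real where C: "C > 0" "\<And>N f. N \<ge> 1 \<Longrightarrow> f \<in> mod_space \<infinity> \<Longrightarrow> mod_norm \<infinity> (hermite_partial N f) \<le> ennreal C * mod_norm \<infinity> f" by blast
    obtain N :: nat where N: "N \<ge> 1" "ln (1 + sqrt (real N)) \<ge> (C * G + 1) / c1" using ln_sqrt_unbounded by blast
    obtain f where f: "f \<in> tempered" "mod_norm \<infinity> f \<le> gauss_mass" "ennreal (c1 * ln (1 + sqrt (real N))) \<le> mod_norm \<infinity> (hermite_partial N f)"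
      using inf[OF N(1)] by blast
    have fs: "f \<in> mod_space \<infinity>" using f le_less_trans[OF f(2) gauss_mass_finite] by (simp add: mod_space_def)
    have "C * G + 1 \<le> c1 * ln (1 + sqrt (real N))" using N(2) c1 by (simp add: field_simps)
    then have "ennreal (C * G + 1) \<le> ennreal (c1 * ln (1 + sqrt (real N)))" by (rule ennreal_leI)
    also have "\<dots> \<le> ennreal C * mod_norm \<infinity> f" using f(3) C(2)[OF N(1) fs] by (rule order.trans)
    also have "\<dots> \<le> ennreal C * ennreal G" by (intro mult_left_mono order.trans[OF f(2) gauss_le]) simp
    also have "\<dots> = ennreal (C * G)" using C G by (simp flip: ennreal_mult)
    finally show False using C(1) G by (simp del: ennreal_plus)
  qed
  have A: "(\<exists>C::real. C > 0 \<and> (\<forall>N::nat. N \<ge> 1 \<longrightarrow> (\<forall>f\<in>mod_space p. mod_norm p (hermite_partial N f) \<le> ennreal C * mod_norm p f)))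
         \<longleftrightarrow> 1 < p \<and> p < \<infinity>" if p: "1 \<le> p" for p
  proof (cases "1 < p \<and> p < \<infinity>")
    case True
    then show ?thesis using hermite_partial_bounded[of p] by blast
  next
    case False
    then consider "p = 1" | "p = \<infinity>" using p by (auto simp: less_top[symmetric])
    then show ?thesis using no_C1 no_Cinf by cases auto
  qed
  have B: "ennreal (c1 / (4 * G) * ln (2 * real N)) \<le> mod_opnorm 1 (hermite_partial N)" if N: "N \<ge> 1" for N
  proof -
    obtain f where f: "f \<in> mod_space 1" "mod_norm 1 f \<le> 1" "ennreal (c1 / G * ln (1 + sqrt (real N))) \<le> mod_norm 1 (hermite_partial N f)"
      using one[OF N] by blast
    have "c1 / (4 * G) * ln (2 * real N) \<le> c1 / (4 * G) * (4 * ln (1 + sqrt (real N)))"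
      using c1 G by (intro mult_left_mono ln_le_ln_sqrt N) auto
    also have "\<dots> = c1 / G * ln (1 + sqrt (real N))" by simp
    finally have "ennreal (c1 / (4 * G) * ln (2 * real N)) \<le> ennreal (c1 / G * ln (1 + sqrt (real N)))" by (rule ennreal_leI)
    also have "\<dots> \<le> mod_norm 1 (hermite_partial N f)" by (rule f(3))
    also have "\<dots> \<le> mod_opnorm 1 (hermite_partial N)"
      unfolding mod_opnorm_def using f by (intro SUP_upper) auto
    finally show ?thesis .
  qed
  have D: "\<exists>f\<in>mod_space 1. limsup (\<lambda>N. mod_norm 1 (hermite_partial N f)) = \<infinity>
          \<and> \<not> (\<lambda>N. mod_norm 1 (\<lambda>g. hermite_partial N f g - f g)) \<longlonglongrightarrow> 0"
  proof -
    \<comment> \<open>The weights \<open>2 ^ (- j)\<close> are summable and yet \<open>2 ^ (- j) * 4 ^ j\<close> is unbounded.\<close>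
    have "\<forall>j. \<exists>N::nat. N \<ge> 1 \<and> N \<ge> j \<and> ln (1 + sqrt (real N)) \<ge> 4 ^ j / c1" using ln_sqrt_unbounded by blast
    then obtain N :: "nat \<Rightarrow> nat" where N: "\<And>j. N j \<ge> 1" "\<And>j. N j \<ge> j" "\<And>j. ln (1 + sqrt (real (N j))) \<ge> 4 ^ j / c1" by metis
    have ms: "summable (\<lambda>j. (1/2::real) ^ j)" "(\<Sum>j. (1/2::real) ^ j) = 2" by (auto simp: summable_geometric suminf_geometric)
    obtain f where f: "f \<in> tempered" "mod_norm 1 f \<le> ennreal 2 * gauss_mass"
      "\<And>j. ennreal ((1/2) ^ j * c1 * ln (1 + sqrt (real (N j)))) \<le> mod_norm 1 (hermite_partial (N j) f)"
      using seq[of "\<lambda>j. (1/2) ^ j" N] ms N(1) by auto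
    have fin: "mod_norm 1 f < \<infinity>"
      by (rule le_less_trans[OF f(2)]) (use gauss_mass_finite in \<open>simp add: ennreal_mult_less_top\<close>)
    have big: "ennreal (2 ^ j) \<le> mod_norm 1 (hermite_partial (N j) f)" for j
    proof -
      have "(2::real) ^ j = (1/2) ^ j * c1 * (4 ^ j / c1)" using c1 by (simp flip: power_mult_distrib)
      also have "\<dots> \<le> (1/2) ^ j * c1 * ln (1 + sqrt (real (N j)))" using c1 by (intro mult_left_mono N(3)) auto
      finally show ?thesis using f(3)[of j] ennreal_leI order.trans by blast
    qed
    have unbdd: "\<exists>k\<ge>n. ennreal r < mod_norm 1 (hermite_partial k f)" for n r
    proof -
      obtain i where i: "r < 2 ^ i" using real_arch_pow[of 2 r] by auto
      define j where "j = max i n"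
      have "(2::real) ^ i \<le> 2 ^ j" by (intro power_increasing) (auto simp: j_def)
      then have "r < 2 ^ j" using i by linarith
      then have "ennreal r < ennreal (2 ^ j)" by (intro ennreal_lessI) auto
      then show ?thesis using big[of j] N(2)[of j] by (intro exI[of _ "N j"]) (auto simp: j_def)
    qed
    have sup: "limsup (\<lambda>N. mod_norm 1 (hermite_partial N f)) = \<infinity>"
    proof (rule ccontr)
      assume "limsup (\<lambda>N. mod_norm 1 (hermite_partial N f)) \<noteq> \<infinity>"
      then obtain r where "r \<ge> 0" "limsup (\<lambda>N. mod_norm 1 (hermite_partial N f)) = ennreal r"
        by (cases "limsup (\<lambda>N. mod_norm 1 (hermite_partial N f))") auto
      then have "limsup (\<lambda>N. mod_norm 1 (hermite_partial N f)) < ennreal (r + 1)" by (simp add: ennreal_lessI)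
      then have "\<forall>\<^sub>F k in sequentially. mod_norm 1 (hermite_partial k f) < ennreal (r + 1)" by (rule Limsup_lessD)
      then obtain n where "\<And>k. k \<ge> n \<Longrightarrow> mod_norm 1 (hermite_partial k f) < ennreal (r + 1)"
        by (auto simp: eventually_sequentially)
      then show False using unbdd[of n "r + 1"] by (meson less_asym)
    qed
    have "\<not> (\<lambda>N. mod_norm 1 (\<lambda>g. hermite_partial N f g - f g)) \<longlonglongrightarrow> 0"
    proof
      assume "(\<lambda>N. mod_norm 1 (\<lambda>g. hermite_partial N f g - f g)) \<longlonglongrightarrow> 0"
      then have "\<forall>\<^sub>F k in sequentially. mod_norm 1 (\<lambda>g. hermite_partial k f g - f g) < 1"
        by (rule order_tendstoD) simp
      then obtain n where n: "\<And>k. k \<ge> n \<Longrightarrow> mod_norm 1 (\<lambda>g. hermite_partial k f g - f g) < 1"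
        by (auto simp: eventually_sequentially)
      obtain r where r: "r \<ge> 0" "mod_norm 1 f = ennreal r" using fin by (cases "mod_norm 1 f") auto
      have "mod_norm 1 (hermite_partial k f) \<le> ennreal (1 + r)" if "k \<ge> n" for k
      proof -
        have "mod_norm 1 (hermite_partial k f) \<le> mod_norm 1 (\<lambda>g. hermite_partial k f g - f g) + mod_norm 1 f"
          by (rule mod_norm_1_triangle[OF f(1)])
        also have "\<dots> \<le> 1 + mod_norm 1 f"
          by (intro add_right_mono less_imp_le n that)
        finally show ?thesis using r by simp
      qed
      then show False using unbdd[of n "1 + r"] by (meson not_le)
    qed
    then show ?thesis using sup f(1) fin by (auto simp: mod_space_def)
  qed
  have B': "\<exists>c C::real. c > 1 \<and> C > 0 \<and> (\<forall>N::nat. N \<ge> 1 \<longrightarrow> mod_opnorm 1 (hermite_partial N) \<ge> ennreal (C * ln (c * real N)))"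
    by (rule exI[of _ 2], rule exI[of _ "c1 / (4 * G)"]) (use B c1 G in auto)
  show ?thesis
    using A B' D hermite_partial_tendsto by blast
qed

end
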